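(* For the Cup voting protocol, where the assignment of candidates to leaves is given (as part of the instance), the decision problem CONSTRUCTIVE-COALITIONAL-WEIGHTED-MANIPULATION (CCWM) is in $\mathcal{P}$.
   Context: An election consists of $m$ candidates, $n$ voters each casting a vote (a total order on the candidates), and a winner determination function given by the voting protocol. Neither $m$ nor $n$ is bounded. Voters have nonnegative integer weights, encoded in binary; a vote of weight $k$ is interpreted as $k$ identical unweighted votes. CCWM (for a given protocol): given a set $S$ of weighted votes, the weights for a set $T$ of votes that are still open, and a preferred candidate $p$, decide whether the votes in $T$ can be cast so that $p$ wins the election determined by the votes in $S\cup T$. Cup protocol: there is a balanced binary tree with one leaf per candidate, and an assignment (schedule) of the candidates to the leaves. Each non-leaf node is assigned the candidate that wins the pairwise election between the candidates assigned to the node's two children, where a candidate wins a pairwise election if it is preferred over the other candidate by more than half of the (unweighted) votes. The candidate assigned to the root wins. Ties in pairwise elections are broken adversarially to the manipulators: $p$ counts as winning only if it wins however ties are broken. *)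

theory Defs
  imports "HOL-Computational_Algebra.Polynomial"
begin

section \<open>Deterministic multitape Turing machines and the class P\<close>

text \<open>
  The tape alphabet of a machine for words over the finite alphabet \<open>'a\<close> consists of the blank,
  the input symbols and finitely many auxiliary symbols \<open>Aux 0, \<dots>, Aux (g - 1)\<close>.  The states are
  \<open>0, \<dots>, s - 1\<close>, with start state \<open>0\<close>.  Only the values of the transition function on
  states and tape symbols of the machine matter, so it is a finite object.
\<close>

datatype 'a tsym = Blank | Inp 'a | Aux nat

datatype move = Go_Left | Stay | Go_Right

record 'a tm =
  num_tapes :: nat
  num_states :: nat
  num_aux :: nat
  accept_state :: nat
  reject_state :: nat
  delta :: "nat \<Rightarrow> 'a tsym list \<Rightarrow> nat \<times> ('a tsym \<times> move) list"

definition tape_symbols :: "'a tm \<Rightarrow> 'a tsym set" where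
  "tape_symbols M = {Blank} \<union> range Inp \<union> Aux ` {..<num_aux M}"

definition turing_machine :: "'a tm \<Rightarrow> bool" where
  "turing_machine M \<longleftrightarrow>
     1 \<le> num_tapes M \<and> 0 < num_states M \<and>
     accept_state M < num_states M \<and> reject_state M < num_states M \<and>
     accept_state M \<noteq> reject_state M \<and>
     (\<forall>q<num_states M. \<forall>xs. length xs = num_tapes M \<and> set xs \<subseteq> tape_symbols M \<longrightarrow>
        (case delta M q xs of (q', acts) \<Rightarrow>
           q' < num_states M \<and> length acts = num_tapes M \<and> fst ` set acts \<subseteq> tape_symbols M))"

text \<open>A tape is infinite in both directions; it is given by its head position and its contents.\<close>

type_synonym 'a tape = "int \<times> (int \<Rightarrow> 'a tsym)"

type_synonym 'a config = "nat \<times> 'a tape list"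

definition tape_read :: "'a tape \<Rightarrow> 'a tsym" where
  "tape_read t = snd t (fst t)"

fun offset :: "move \<Rightarrow> int" where
  "offset Go_Left = -1"
| "offset Stay = 0"
| "offset Go_Right = 1"

definition tape_act :: "'a tsym \<times> move \<Rightarrow> 'a tape \<Rightarrow> 'a tape" where
  "tape_act a t = (fst t + offset (snd a), (snd t)(fst t := fst a))"

definition tm_step :: "'a tm \<Rightarrow> 'a config \<Rightarrow> 'a config" where
  "tm_step M = (\<lambda>(q, ts).
     if q = accept_state M \<or> q = reject_state M then (q, ts)
     else case delta M q (map tape_read ts) of (q', acts) \<Rightarrow> (q', map2 tape_act acts ts))"

definition word_tape :: "'a list \<Rightarrow> 'a tape" where
  "word_tape w = (0, \<lambda>i. if 0 \<le> i \<and> i < int (length w) then Inp (w ! nat i) else Blank)"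

definition initial_config :: "'a tm \<Rightarrow> 'a list \<Rightarrow> 'a config" where
  "initial_config M w = (0, word_tape w # replicate (num_tapes M - 1) (word_tape []))"

definition decides_in_time :: "'a tm \<Rightarrow> 'a list set \<Rightarrow> (nat \<Rightarrow> nat) \<Rightarrow> bool" where
  "decides_in_time M L T \<longleftrightarrow>
     (\<forall>w. \<exists>t\<le>T (length w).
        fst ((tm_step M ^^ t) (initial_config M w)) =
          (if w \<in> L then accept_state M else reject_state M))"

definition class_P :: "'a::finite list set set" where
  "class_P = {L. \<exists>(M :: 'a tm) (p :: nat poly). turing_machine M \<and> decides_in_time M L (poly p)}"


section \<open>Elections and coalitional weighted manipulation\<close>

text \<open>A vote, that is, a total order on the candidates, is the list of all candidates from the
  most to the least preferred one.\<close>

type_synonym 'c vote = "'c list"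

definition is_vote :: "'c set \<Rightarrow> 'c vote \<Rightarrow> bool" where
  "is_vote C v \<longleftrightarrow> distinct v \<and> set v = C"

definition prefers :: "'c vote \<Rightarrow> 'c \<Rightarrow> 'c \<Rightarrow> bool" where
  "prefers v a b \<longleftrightarrow> (\<exists>xs ys zs. v = xs @ a # ys @ b # zs)"

definition unweighted :: "(nat \<times> 'c vote) list \<Rightarrow> 'c vote list" where
  "unweighted wvs = concat (map (\<lambda>(k, v). replicate k v) wvs)"

text \<open>\<open>wins V c\<close> says that \<open>c\<close> wins the election with the unweighted votes \<open>V\<close>.\<close>

definition CCWM ::
  "('c vote list \<Rightarrow> 'c \<Rightarrow> bool) \<Rightarrow> 'c set \<Rightarrow> (nat \<times> 'c vote) list \<Rightarrow> nat list \<Rightarrow> 'c \<Rightarrow> bool" where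
  "CCWM wins C S T p \<longleftrightarrow>
     (\<exists>vs. length vs = length T \<and> (\<forall>v\<in>set vs. is_vote C v) \<and>
           wins (unweighted (S @ zip T vs)) p)"


section \<open>The Cup protocol\<close>

datatype 'c cup_tree = Leaf 'c | Match "'c cup_tree" "'c cup_tree"

fun leaves :: "'c cup_tree \<Rightarrow> 'c list" where
  "leaves (Leaf c) = [c]"
| "leaves (Match l r) = leaves l @ leaves r"

fun leaf_depths :: "'c cup_tree \<Rightarrow> nat list" where
  "leaf_depths (Leaf c) = [0]"
| "leaf_depths (Match l r) = map Suc (leaf_depths l @ leaf_depths r)"

text \<open>The number of candidates need not be a power of two, so the depths of two leaves may differ
  by one.\<close>

definition balanced :: "'c cup_tree \<Rightarrow> bool" where
  "balanced t \<longleftrightarrow> (\<forall>d\<in>set (leaf_depths t). \<forall>e\<in>set (leaf_depths t). d \<le> e + 1)"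

definition beats :: "'c vote list \<Rightarrow> 'c \<Rightarrow> 'c \<Rightarrow> bool" where
  "beats V a b \<longleftrightarrow> 2 * length (filter (\<lambda>v. prefers v a b) V) > length V"

text \<open>\<open>tie a b\<close> says that \<open>a\<close>, coming from the left child, advances if it ties with \<open>b\<close>.  As every
  candidate labels one leaf, two candidates meet at most once, so such a function describes every
  way of breaking the ties that occur.\<close>

fun cup_winner :: "('c \<Rightarrow> 'c \<Rightarrow> bool) \<Rightarrow> 'c vote list \<Rightarrow> 'c cup_tree \<Rightarrow> 'c" where
  "cup_winner tie V (Leaf c) = c"
| "cup_winner tie V (Match l r) =
     (let a = cup_winner tie V l; b = cup_winner tie V r in
      if beats V a b then a
      else if beats V b a then b
      else if tie a b then a else b)"

definition cup_wins :: "'c cup_tree \<Rightarrow> 'c vote list \<Rightarrow> 'c \<Rightarrow> bool" where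
  "cup_wins t V c \<longleftrightarrow> (\<forall>tie. cup_winner tie V t = c)"


section \<open>The decision problem\<close>

text \<open>Candidates are named by natural numbers; the candidates of an instance are the labels of the
  leaves of its schedule.\<close>

record cup_instance =
  schedule :: "nat cup_tree"
  fixed_votes :: "(nat \<times> nat vote) list"
  open_weights :: "nat list"
  preferred :: nat

definition candidates :: "cup_instance \<Rightarrow> nat set" where
  "candidates I = set (leaves (schedule I))"

definition valid_instance :: "cup_instance \<Rightarrow> bool" where
  "valid_instance I \<longleftrightarrow>
     balanced (schedule I) \<and> distinct (leaves (schedule I)) \<and>
     (\<forall>(k, v)\<in>set (fixed_votes I). is_vote (candidates I) v) \<and>
     preferred I \<in> candidates I"

definition cup_CCWM :: "cup_instance set" where
  "cup_CCWM = {I. valid_instance I \<and>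
     CCWM (cup_wins (schedule I)) (candidates I) (fixed_votes I) (open_weights I) (preferred I)}"


section \<open>Encoding of instances\<close>

datatype letter = Bit bool | Item | Stop

instance letter :: finite
proof
  have "x \<in> range Bit \<union> {Item, Stop}" for x
    by (cases x) auto
  then have "(UNIV :: letter set) \<subseteq> range Bit \<union> {Item, Stop}"
    by blast
  then show "finite (UNIV :: letter set)"
    by (rule finite_subset) simp
qed

text \<open>Binary representation, least significant bit first and without leading zeros.\<close>

fun bits :: "nat \<Rightarrow> bool list" where
  "bits n = (if n = 0 then [] else odd n # bits (n div 2))"

declare bits.simps [simp del]

definition enc_nat :: "nat \<Rightarrow> letter list" where
  "enc_nat n = map Bit (bits n) @ [Stop]"

definition enc_list :: "('b \<Rightarrow> letter list) \<Rightarrow> 'b list \<Rightarrow> letter list" where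
  "enc_list f xs = concat (map (\<lambda>x. Item # f x) xs) @ [Stop]"

fun enc_tree :: "nat cup_tree \<Rightarrow> letter list" where
  "enc_tree (Leaf c) = enc_nat c"
| "enc_tree (Match l r) = Item # enc_tree l @ enc_tree r"

definition enc_wvote :: "nat \<times> nat vote \<Rightarrow> letter list" where
  "enc_wvote kv = enc_nat (fst kv) @ enc_list enc_nat (snd kv)"

definition encode :: "cup_instance \<Rightarrow> letter list" where
  "encode I = enc_tree (schedule I) @ enc_list enc_wvote (fixed_votes I) @
     enc_list enc_nat (open_weights I) @ enc_nat (preferred I)"

definition prefix_code :: "('b \<Rightarrow> letter list) \<Rightarrow> bool" where
  "prefix_code f \<longleftrightarrow> (\<forall>x y r s. f x @ r = f y @ s \<longrightarrow> x = y \<and> r = s)"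

lemma prefix_codeD: "prefix_code f \<Longrightarrow> f x @ r = f y @ s \<Longrightarrow> x = y \<and> r = s"
  unfolding prefix_code_def by blast

lemma bits_inject: "bits m = bits n \<Longrightarrow> m = n"
proof (induction m arbitrary: n rule: bits.induct)
  case (1 m)
  show ?case
  proof (cases "m = 0 \<or> n = 0")
    case True
    with "1.prems" show ?thesis
      by (subst (asm) (1 2) bits.simps) (auto split: if_splits)
  next
    case False
    then have "odd m = odd n" "bits (m div 2) = bits (n div 2)"
      using "1.prems" by (subst (asm) (1 2) bits.simps, simp)+
    with "1.IH" False have "m div 2 = n div 2" "m mod 2 = n mod 2"
      by (simp, presburger)
    then show ?thesis
      by (metis div_mult_mod_eq)
  qed
qed

lemma Bit_Stop_inject:
  "map Bit xs @ Stop # r = map Bit ys @ Stop # s \<Longrightarrow> xs = ys \<and> r = s"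
proof (induction xs arbitrary: ys)
  case Nil
  then show ?case by (cases ys) auto
next
  case (Cons x xs)
  then show ?case by (cases ys) auto
qed

lemma prefix_code_nat: "prefix_code enc_nat"
  unfolding prefix_code_def enc_nat_def by (auto dest!: Bit_Stop_inject bits_inject)

lemma prefix_code_list:
  assumes "prefix_code f"
  shows "prefix_code (enc_list f)"
proof -
  have "xs = ys \<and> r = s" if "enc_list f xs @ r = enc_list f ys @ s" for xs ys r s
    using that
  proof (induction xs arbitrary: ys)
    case Nil
    then show ?case by (cases ys) (auto simp: enc_list_def)
  next
    case (Cons x xs)
    then obtain y ys' where ys: "ys = y # ys'"
      by (cases ys) (auto simp: enc_list_def)
    from Cons.prems have "f x @ (enc_list f xs @ r) = f y @ (enc_list f ys' @ s)"
      by (simp add: enc_list_def ys)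
    from prefix_codeD[OF assms this] Cons.IH ys show ?case by blast
  qed
  then show ?thesis unfolding prefix_code_def by blast
qed

lemma prefix_code_tree: "prefix_code enc_tree"
proof -
  have no_Item: "enc_nat c @ r \<noteq> Item # s" for c r s
    by (cases "bits c") (auto simp: enc_nat_def)
  have "t = u \<and> r = s" if "enc_tree t @ r = enc_tree u @ s" for t u r s
    using that
  proof (induction t arbitrary: u r s)
    case (Leaf c)
    show ?case
    proof (cases u)
      case (Leaf d)
      with Leaf.prems have "enc_nat c @ r = enc_nat d @ s" by simp
      from prefix_codeD[OF prefix_code_nat this] Leaf show ?thesis by simp
    next
      case (Match u1 u2)
      with Leaf.prems no_Item show ?thesis by simp
    qed
  next
    case (Match t1 t2)
    obtain u1 u2 where u: "u = Match u1 u2"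
    proof (cases u)
      case (Leaf d)
      with Match.prems have "enc_nat d @ s = Item # (enc_tree t1 @ enc_tree t2) @ r" by simp
      with no_Item show ?thesis by blast
    qed
    from Match.prems have "enc_tree t1 @ (enc_tree t2 @ r) = enc_tree u1 @ (enc_tree u2 @ s)"
      by (simp add: u)
    from Match.IH(1)[OF this] Match.IH(2) u show ?case by blast
  qed
  then show ?thesis unfolding prefix_code_def by blast
qed

lemma prefix_code_wvote: "prefix_code enc_wvote"
  unfolding prefix_code_def enc_wvote_def
  by (auto simp: prod_eq_iff dest!: prefix_codeD[OF prefix_code_nat]
      prefix_codeD[OF prefix_code_list[OF prefix_code_nat]])

lemma inj_encode: "inj encode"
proof (rule injI)
  fix I J
  assume eq: "encode I = encode J"
  have "enc_nat (preferred I) @ [] = enc_nat (preferred J) @ []"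
    and "open_weights I = open_weights J" "fixed_votes I = fixed_votes J" "schedule I = schedule J"
    using eq unfolding encode_def
    by (auto dest!: prefix_codeD[OF prefix_code_tree]
        prefix_codeD[OF prefix_code_list[OF prefix_code_wvote]]
        prefix_codeD[OF prefix_code_list[OF prefix_code_nat]])
  with prefix_codeD[OF prefix_code_nat] show "I = J"
    by (metis (full_types) cup_instance.equality unit.exhaust)
qed

end

theory Submission imports Defs begin

text \<open>
  For candidates \<open>a\<close> and \<open>b\<close>, let \<open>a\<close> be able to advance against \<open>b\<close> if all manipulators
  together can make it beat \<open>b\<close> or, when their total weight is \<open>0\<close>, if \<open>b\<close> does not beat it.
  Bottom-up, call \<open>a\<close> a possible winner of a subtree if it is a possible winner of one child and
  is able to advance against some possible winner of the other.  If the manipulators have positive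
  weight, the possible winners are exactly the candidates that they can make win however ties are
  broken: between any two candidates a tie can be avoided, and concatenating the orders of the two
  subtrees, the winner's side first, gives one vote that all manipulators can cast.  If the weight
  is \<open>0\<close>, the possible winners are those candidates that win under some tie-breaking, and \<open>p\<close> has
  to be the only one.

  The polynomial running time is obtained from a calculus of polynomial-time functions on binary
  trees, which is closed under composition, pairing, case distinction and folds over lists with
  polynomially bounded results.  Trees are stored as prefix words on stacks, and a stack is a tape
  whose head scans the top.
\<close>

section \<open>Stack programs and their compilation\<close>

text \<open>Weights are binary, so the unfolded election can be exponentially long; only the
  weighted supports of ordered pairs are computed, by adding and comparing bit lists. The test for
  one match is sharp because open votes shift the difference of two supports by at most their total
  weight. Distinct leaf labels let one linear order attain this shift in all decisive matches at
  once. The term \<open>max 1\<close> in \<open>can_advance\<close> lets a single recursion serve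
  both positive weight and weight 0.

  A decider also has to reject every word that is not an encoding. Instead of a parser with error
  handling, a word is cut into parts that always belong to some instance; these are encoded again
  and compared with the word.

  Trees are the only data type because booleans, letters, pairs and lists embed in them and a prefix
  word marks its own end. Iteration can leave polynomial time even if each step is polynomial, hence
  every fold carries a size bound; for most folds here additive growth per entry provides
  it.\<close>

text \<open>A tape whose head scans the top of a stack that extends to the right holds that stack;
  the cells to the left of the head are irrelevant.  The input tape initially holds the input
  word in this sense, with the first letter on top.\<close>

datatype 'a com =
    Skip
  | Push nat 'a
  | Dup nat nat
  | Pop nat
  | Seq "'a com" "'a com"  (infixr \<open>;;\<close> 60)
  | If_top nat "'a tsym \<Rightarrow> bool" "'a com" "'a com"
  | While_top nat "'a tsym \<Rightarrow> bool" "'a com"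

type_synonym 'a store = "nat \<Rightarrow> 'a list"

fun top_sym :: "'a list \<Rightarrow> 'a tsym" where
  "top_sym [] = Blank"
| "top_sym (a # as) = Inp a"

text \<open>The counters are the exact step numbers of the compiled machine. A then-branch pays one
  more step than an else-branch, for the jump over the latter, and every loop body pays for the jump
  back.\<close>

inductive exec :: "'a com \<Rightarrow> 'a store \<Rightarrow> nat \<Rightarrow> 'a store \<Rightarrow> bool" where
  Skip: "exec Skip s 0 s"
| Push: "exec (Push i a) s 2 (s(i := a # s i))"
| Dup: "s i = a # as \<Longrightarrow> exec (Dup i j) s 2 (s(j := a # s j))" if "i \<noteq> j"
| Pop: "exec (Pop i) s 1 (s(i := tl (s i)))"
| Seq: "exec c s t s' \<Longrightarrow> exec d s' u s'' \<Longrightarrow> exec (c ;; d) s (t + u) s''"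
| If_True: "P (top_sym (s i)) \<Longrightarrow> exec c s t s' \<Longrightarrow> exec (If_top i P c d) s (1 + (t + 1)) s'"
| If_False: "\<not> P (top_sym (s i)) \<Longrightarrow> exec d s t s' \<Longrightarrow> exec (If_top i P c d) s (1 + t) s'"
| While_False: "\<not> P (top_sym (s i)) \<Longrightarrow> exec (While_top i P c) s 1 s"
| While_True: "P (top_sym (s i)) \<Longrightarrow> exec c s t s' \<Longrightarrow> exec (While_top i P c) s' u s'' \<Longrightarrow>
    exec (While_top i P c) s (1 + (t + (1 + u))) s''"

fun width :: "'a com \<Rightarrow> nat" where
  "width Skip = 1"
| "width (Push i a) = Suc i"
| "width (Dup i j) = Suc (max i j)"
| "width (Pop i) = Suc i"
| "width (c ;; d) = max (width c) (width d)"
| "width (If_top i P c d) = max (Suc i) (max (width c) (width d))"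
| "width (While_top i P c) = max (Suc i) (width c)"

fun code_length :: "'a com \<Rightarrow> nat" where
  "code_length Skip = 0"
| "code_length (Push i a) = 2"
| "code_length (Dup i j) = 2"
| "code_length (Pop i) = 1"
| "code_length (c ;; d) = code_length c + code_length d"
| "code_length (If_top i P c d) = 2 + code_length c + code_length d"
| "code_length (While_top i P c) = 2 + code_length c"

type_synonym 'a instr = "'a tsym list \<Rightarrow> nat \<times> ('a tsym \<times> move) list"

definition stay :: "'a tsym list \<Rightarrow> ('a tsym \<times> move) list" where
  "stay xs = map (\<lambda>x. (x, Stay)) xs"

text \<open>States act as program counters with absolute jump targets: \<open>n\<close> is the
  address of the first instruction, and control leaves at \<open>n + code_length c\<close>.\<close>

fun code :: "'a com \<Rightarrow> nat \<Rightarrow> 'a instr list" where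
  "code Skip n = []"
| "code (Push i a) n =
     [\<lambda>xs. (n + 1, (stay xs)[i := (xs ! i, Go_Left)]),
      \<lambda>xs. (n + 2, (stay xs)[i := (Inp a, Stay)])]"
| "code (Dup i j) n =
     [\<lambda>xs. (n + 1, (stay xs)[j := (xs ! j, Go_Left)]),
      \<lambda>xs. (n + 2, (stay xs)[j := (xs ! i, Stay)])]"
| "code (Pop i) n = [\<lambda>xs. (n + 1, (stay xs)[i := (xs ! i, Go_Right)])]"
| "code (c ;; d) n = code c n @ code d (n + code_length c)"
| "code (If_top i P c d) n =
     [\<lambda>xs. (if P (xs ! i) then n + 1 else n + 2 + code_length c, stay xs)] @
     code c (n + 1) @
     [\<lambda>xs. (n + 2 + code_length c + code_length d, stay xs)] @
     code d (n + 2 + code_length c)"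
| "code (While_top i P c) n =
     [\<lambda>xs. (if P (xs ! i) then n + 1 else n + 2 + code_length c, stay xs)] @
     code c (n + 1) @
     [\<lambda>xs. (n, stay xs)]"

lemma length_code [simp]: "length (code c n) = code_length c"
  by (induction c arbitrary: n) auto

lemma length_stay [simp]: "length (stay xs) = length xs"
  by (simp add: stay_def)

lemma set_update_fst:
  "fst ` set ((stay xs)[i := a]) \<subseteq> insert (fst a) (set xs)"
  using set_update_subset_insert[of "stay xs" i a] by (auto simp: stay_def)

text \<open>The state bound is not strict: equality is the exit address, where
  \<open>machine\<close> places its decision.\<close>

lemma code_wellformed:
  assumes "f \<in> set (code c n)" "width c \<le> length xs" "set xs \<subseteq> tape_symbols M"
  shows "fst (f xs) \<le> n + code_length c \<and> length (snd (f xs)) = length xs \<and>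
    fst ` set (snd (f xs)) \<subseteq> tape_symbols M"
proof -
  have upd: "y \<in> tape_symbols M"
    if "(y, d) \<in> set ((stay xs)[i := (z, e)])" "z \<in> tape_symbols M" for y z d e i
    using subsetD[OF set_update_fst[of xs i "(z, e)"], of y] that assms(3) by force
  have read: "xs ! i \<in> tape_symbols M" if "i < length xs" for i
    using that assms(3) by auto
  have stay: "fst ` set (stay xs) \<subseteq> tape_symbols M"
    using assms(3) by (auto simp: stay_def)
  have Inp: "Inp a \<in> tape_symbols M" for a
    by (simp add: tape_symbols_def)
  show ?thesis
    using assms(1,2)
  proof (induction c arbitrary: n)
    case (Seq c d)
    then consider "f \<in> set (code c n)" | "f \<in> set (code d (n + code_length c))" by auto
    then show ?case
    proof cases
      case 1
      from Seq.IH(1)[OF this] Seq.prems show ?thesis by auto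
    next
      case 2
      from Seq.IH(2)[OF this] Seq.prems show ?thesis by auto
    qed
  next
    case (If_top i P c d)
    then consider "f = (\<lambda>xs. (if P (xs ! i) then n + 1 else n + 2 + code_length c, stay xs))"
      | "f \<in> set (code c (n + 1))" | "f = (\<lambda>xs. (n + 2 + code_length c + code_length d, stay xs))"
      | "f \<in> set (code d (n + 2 + code_length c))" by auto
    then show ?case
    proof cases
      case 2
      from If_top.IH(1)[OF this] If_top.prems show ?thesis by auto
    next
      case 4
      from If_top.IH(2)[OF this] If_top.prems show ?thesis by auto
    qed (use stay in auto)
  next
    case (While_top i P c)
    then consider "f = (\<lambda>xs. (if P (xs ! i) then n + 1 else n + 2 + code_length c, stay xs))"
      | "f \<in> set (code c (n + 1))" | "f = (\<lambda>xs. (n, stay xs))" by auto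
    then show ?case
    proof cases
      case 2
      from While_top.IH[OF this] While_top.prems show ?thesis by auto
    qed (use stay in auto)
  qed (auto dest!: upd simp: read Inp Suc_le_eq)
qed

section \<open>Tapes that hold stacks, and correctness of the compilation\<close>

definition holds :: "'a tape \<Rightarrow> 'a list \<Rightarrow> bool" where
  "holds t as \<longleftrightarrow> (\<forall>j. snd t (fst t + int j) = (if j < length as then Inp (as ! j) else Blank))"

definition represents :: "'a tape list \<Rightarrow> 'a store \<Rightarrow> bool" where
  "represents ts s \<longleftrightarrow> (\<forall>i<length ts. holds (ts ! i) (s i))"

lemma holds_read: "holds t as \<Longrightarrow> tape_read t = top_sym as"
  unfolding holds_def tape_read_def by (cases as) (auto dest: spec[of _ 0])

lemma holds_pop: "holds t as \<Longrightarrow> holds (tape_act (tape_read t, Go_Right) t) (tl as)"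
  unfolding holds_def
proof
  fix j
  assume *: "\<forall>j. snd t (fst t + int j) = (if j < length as then Inp (as ! j) else Blank)"
  show "snd (tape_act (tape_read t, Go_Right) t) (fst (tape_act (tape_read t, Go_Right) t) + int j) =
    (if j < length (tl as) then Inp (tl as ! j) else Blank)"
    using spec[OF *, of "Suc j"]
    by (cases as) (auto simp: tape_act_def tape_read_def algebra_simps)
qed

text \<open>A machine step writes before it moves. Hence the first step restores the scanned symbol
  while moving left onto an irrelevant cell, and the second overwrites that cell.\<close>

lemma holds_push:
  assumes "holds t as" "x = tape_read t"
  shows "holds (tape_act (Inp a, Stay) (tape_act (x, Go_Left) t)) (a # as)"
  unfolding holds_def
proof
  fix j
  show "snd (tape_act (Inp a, Stay) (tape_act (x, Go_Left) t))
      (fst (tape_act (Inp a, Stay) (tape_act (x, Go_Left) t)) + int j) =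
    (if j < length (a # as) then Inp ((a # as) ! j) else Blank)"
  proof (cases j)
    case (Suc i)
    then show ?thesis
      using assms unfolding holds_def
      by (auto dest: spec[of _ i] simp: tape_act_def tape_read_def algebra_simps)
  qed (auto simp: tape_act_def)
qed

lemma tape_act_stay [simp]: "tape_act (tape_read t, Stay) t = t"
  by (simp add: tape_act_def tape_read_def)

lemma map2_act_stay [simp]: "map2 tape_act (stay (map tape_read ts)) ts = ts"
  by (rule nth_equalityI) (auto simp: stay_def)

lemma map2_act_update:
  "i < length ts \<Longrightarrow>
    map2 tape_act ((stay (map tape_read ts))[i := a]) ts = ts[i := tape_act a (ts ! i)]"
  by (rule nth_equalityI) (auto simp: stay_def nth_list_update)

lemma represents_update:
  "represents ts s \<Longrightarrow> holds t as \<Longrightarrow> represents (ts[i := t]) (s(i := as))"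
  by (auto simp: represents_def nth_list_update)

text \<open>The halting states have to be avoided because \<open>tm_step\<close> stands still
  there.\<close>

definition located :: "'a tm \<Rightarrow> 'a com \<Rightarrow> nat \<Rightarrow> bool" where
  "located M c n \<longleftrightarrow> (\<forall>j<code_length c.
     n + j \<noteq> accept_state M \<and> n + j \<noteq> reject_state M \<and> delta M (n + j) = code c n ! j)"

lemma located_Seq:
  "located M (c ;; d) n \<Longrightarrow> located M c n \<and> located M d (n + code_length c)"
proof -
  assume a: "located M (c ;; d) n"
  have *: "n + j \<noteq> accept_state M \<and> n + j \<noteq> reject_state M \<and>
      delta M (n + j) = code (c ;; d) n ! j" if "j < code_length c + code_length d" for j
    using a that by (simp add: located_def)
  have "located M c n"
    unfolding located_def using * by (auto simp: nth_append)
  moreover have "located M d (n + code_length c)"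
    unfolding located_def using *[of "code_length c + _"] by (auto simp: nth_append add.assoc)
  ultimately show ?thesis ..
qed

lemma located_If:
  assumes "located M (If_top i P c d) n"
  shows "located M c (n + 1)" "located M d (n + 2 + code_length c)"
proof -
  have *: "n + j \<noteq> accept_state M \<and> n + j \<noteq> reject_state M \<and>
      delta M (n + j) = code (If_top i P c d) n ! j" if "j < 2 + code_length c + code_length d" for j
    using assms that by (simp add: located_def)
  show "located M c (n + 1)"
    unfolding located_def using *[of "Suc _"] by (auto simp: nth_append)
  show "located M d (n + 2 + code_length c)"
    unfolding located_def
  proof (intro allI impI)
    fix j assume "j < code_length d"
    with *[of "2 + code_length c + j"]
    show "n + 2 + code_length c + j \<noteq> accept_state M \<and> n + 2 + code_length c + j \<noteq> reject_state M \<and>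
         delta M (n + 2 + code_length c + j) = code d (n + 2 + code_length c) ! j"
      by (simp add: nth_append add.assoc)
  qed
qed

lemma located_While: "located M (While_top i P c) n \<Longrightarrow> located M c (n + 1)"
proof -
  assume a: "located M (While_top i P c) n"
  have *: "n + j \<noteq> accept_state M \<and> n + j \<noteq> reject_state M \<and>
      delta M (n + j) = code (While_top i P c) n ! j" if "j < 2 + code_length c" for j
    using a that by (simp add: located_def)
  show "located M c (n + 1)"
    unfolding located_def using *[of "Suc _"] by (auto simp: nth_append)
qed

lemma located_step:
  assumes "located M c n" "j < code_length c"
  shows "tm_step M (n + j, ts) =
    (case (code c n ! j) (map tape_read ts) of (q, acts) \<Rightarrow> (q, map2 tape_act acts ts))"
  using assms by (auto simp: located_def tm_step_def)

lemma located_steps: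
  assumes "located M c n"
  shows "0 < code_length c \<Longrightarrow> tm_step M (n, ts) =
    (case (code c n ! 0) (map tape_read ts) of (q, acts) \<Rightarrow> (q, map2 tape_act acts ts))"
   and "Suc 0 < code_length c \<Longrightarrow> tm_step M (Suc n, ts) =
    (case (code c n ! Suc 0) (map tape_read ts) of (q, acts) \<Rightarrow> (q, map2 tape_act acts ts))"
  using located_step[OF assms, of 0] located_step[OF assms, of "Suc 0"] by simp_all

lemma funpow_add_apply: "(f ^^ (m + n)) x = (f ^^ n) ((f ^^ m) x)"
  by (subst add.commute) (simp add: funpow_add)

text \<open>The induction follows the execution and not the program, since the remainder of a loop
  execution is again an execution of the same loop at the same address.\<close>

lemma code_correct:
  assumes "exec c s t s'" "located M c n" "width c \<le> length ts" "represents ts s"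
  shows "\<exists>ts'. (tm_step M ^^ t) (n, ts) = (n + code_length c, ts') \<and>
    length ts' = length ts \<and> represents ts' s'"
  using assms
proof (induction arbitrary: n ts rule: exec.induct)
  case (Skip s)
  then show ?case by auto
next
  case (Push i a s)
  have i: "i < length ts" using Push.prems by simp
  then have h: "holds (ts ! i) (s i)" using Push.prems by (simp add: represents_def)
  from holds_push[OF this refl, of a] Push.prems(3)
  have "represents (ts[i := tape_act (Inp a, Stay) (tape_act (tape_read (ts ! i), Go_Left) (ts ! i))])
    (s(i := a # s i))" by (intro represents_update)
  moreover have "(tm_step M ^^ 2) (n, ts) = (n + 2,
     ts[i := tape_act (Inp a, Stay) (tape_act (tape_read (ts ! i), Go_Left) (ts ! i))])"
    using i by (simp add: numeral_2_eq_2 located_steps[OF Push.prems(1)] map2_act_update)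
  ultimately show ?case by (simp add: fun_upd_def)
next
  case (Dup i j s a as)
  have ij: "i < length ts" "j < length ts" using Dup.prems by simp_all
  then have h: "holds (ts ! i) (s i)" "holds (ts ! j) (s j)"
    using Dup.prems by (simp_all add: represents_def)
  from holds_push[OF h(2) refl, of a] Dup.prems(3)
  have "represents (ts[j := tape_act (Inp a, Stay) (tape_act (tape_read (ts ! j), Go_Left) (ts ! j))])
    (s(j := a # s j))" by (intro represents_update)
  moreover have "tape_read (ts ! i) = Inp a"
    using holds_read[OF h(1)] Dup by simp
  then have "(tm_step M ^^ 2) (n, ts) = (n + 2,
     ts[j := tape_act (Inp a, Stay) (tape_act (tape_read (ts ! j), Go_Left) (ts ! j))])"
    using ij Dup(1)
    by (simp add: numeral_2_eq_2 located_steps[OF Dup.prems(1)] map2_act_update)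
  ultimately show ?case by (simp add: fun_upd_def)
next
  case (Pop i s)
  have i: "i < length ts" using Pop.prems by simp
  then have "holds (ts ! i) (s i)" using Pop.prems by (simp add: represents_def)
  from holds_pop[OF this] Pop.prems(3)
  have "represents (ts[i := tape_act (tape_read (ts ! i), Go_Right) (ts ! i)]) (s(i := tl (s i)))"
    by (intro represents_update)
  then show ?case
    using i by (simp add: fun_upd_def located_steps[OF Pop.prems(1)] map2_act_update)
next
  case (Seq c s t s' d u s'')
  from Seq.prems have "located M c n" "located M d (n + code_length c)" "width c \<le> length ts"
    "width d \<le> length ts" by (auto dest: located_Seq)
  note loc = this
  from Seq.IH(1)[OF loc(1,3) Seq.prems(3)] obtain ts' where
    1: "(tm_step M ^^ t) (n, ts) = (n + code_length c, ts')" "length ts' = length ts"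
    "represents ts' s'" by auto
  from Seq.IH(2)[OF loc(2) _ 1(3)] 1(2) loc(4) obtain ts'' where
    "(tm_step M ^^ u) (n + code_length c, ts') = (n + code_length c + code_length d, ts'')"
    "length ts'' = length ts" "represents ts'' s''" by auto
  with 1 show ?case
    by (auto simp: funpow_add_apply add.assoc)
next
  case (If_True P s i c t s' d)
  have i: "i < length ts" using If_True.prems by simp
  have "tape_read (ts ! i) = top_sym (s i)"
    using If_True.prems i by (auto simp: represents_def intro: holds_read)
  then have first: "tm_step M (n, ts) = (n + 1, ts)"
    using i If_True.hyps by (simp add: located_steps[OF If_True.prems(1)])
  from If_True.IH[OF located_If(1)[OF If_True.prems(1)] _ If_True.prems(3)] If_True.prems(2)
  obtain ts' where mid: "(tm_step M ^^ t) (n + 1, ts) = (n + 1 + code_length c, ts')"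
    "length ts' = length ts" "represents ts' s'" by auto
  have "tm_step M (n + (1 + code_length c), ts') = (n + (2 + code_length c + code_length d), ts')"
    using located_step[OF If_True.prems(1), of "1 + code_length c" ts'] by (simp add: nth_append)
  then have "(tm_step M ^^ (1 + (t + 1))) (n, ts) = (n + (2 + code_length c + code_length d), ts')"
    unfolding funpow_add_apply using first mid(1) by (simp add: add.assoc)
  with mid show ?case by auto
next
  case (If_False P s i d t s' c)
  have i: "i < length ts" using If_False.prems by simp
  have "tape_read (ts ! i) = top_sym (s i)"
    using If_False.prems i by (auto simp: represents_def intro: holds_read)
  then have first: "tm_step M (n, ts) = (n + 2 + code_length c, ts)"
    using i If_False.hyps by (simp add: located_steps[OF If_False.prems(1)])
  from If_False.IH[OF located_If(2)[OF If_False.prems(1)] _ If_False.prems(3)] If_False.prems(2)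
  obtain ts' where mid: "(tm_step M ^^ t) (n + 2 + code_length c, ts) =
      (n + 2 + code_length c + code_length d, ts')"
    "length ts' = length ts" "represents ts' s'" by auto
  then have "(tm_step M ^^ (1 + t)) (n, ts) = (n + (2 + code_length c + code_length d), ts')"
    unfolding funpow_add_apply using first mid(1) by (simp add: add.assoc)
  with mid show ?case by auto
next
  case (While_False P s i c)
  have i: "i < length ts" using While_False.prems by simp
  have "tape_read (ts ! i) = top_sym (s i)"
    using While_False.prems i by (auto simp: represents_def intro: holds_read)
  then have "tm_step M (n, ts) = (n + 2 + code_length c, ts)"
    using i While_False.hyps by (simp add: located_steps[OF While_False.prems(1)])
  with While_False.prems show ?case by auto
next
  case (While_True P s i c t s' u s'')
  have i: "i < length ts" using While_True.prems by simp
  have "tape_read (ts ! i) = top_sym (s i)"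
    using While_True.prems i by (auto simp: represents_def intro: holds_read)
  then have first: "tm_step M (n, ts) = (n + 1, ts)"
    using i While_True.hyps by (simp add: located_steps[OF While_True.prems(1)])
  from While_True.IH(1)[OF located_While[OF While_True.prems(1)] _ While_True.prems(3)] While_True.prems(2)
  obtain ts' where mid: "(tm_step M ^^ t) (n + 1, ts) = (n + 1 + code_length c, ts')"
    "length ts' = length ts" "represents ts' s'" by auto
  have jump: "tm_step M (n + (1 + code_length c), ts') = (n, ts')"
    using located_step[OF While_True.prems(1), of "1 + code_length c" ts'] by (simp add: nth_append)
  from While_True.IH(2)[OF While_True.prems(1) _ mid(3)] While_True.prems(2) mid(2)
  obtain ts'' where last: "(tm_step M ^^ u) (n, ts') = (n + code_length (While_top i P c), ts'')"
    "length ts'' = length ts" "represents ts'' s''" by auto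
  have "(tm_step M ^^ (1 + (t + (1 + u)))) (n, ts) = (n + code_length (While_top i P c), ts'')"
    unfolding funpow_add_apply using first mid(1) jump last(1) by (simp add: add.assoc)
  with last show ?case by blast
qed

text \<open>State \<open>code_length c\<close> is the exit of the program; one further step from
  there inspects the top of stack 0 and decides. This is the \<open>Suc\<close> in the running time
  of \<open>machine_run\<close>.\<close>

definition machine :: "'a com \<Rightarrow> ('a tsym \<Rightarrow> bool) \<Rightarrow> 'a tm" where
  "machine c P = \<lparr>num_tapes = width c, num_states = code_length c + 3, num_aux = 0,
     accept_state = code_length c + 1, reject_state = code_length c + 2,
     delta = (\<lambda>q xs. if q < code_length c then (code c 0 ! q) xs
       else (if P (xs ! 0) then code_length c + 1 else code_length c + 2, stay xs))\<rparr>"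

lemma width_pos: "1 \<le> width c"
  by (induction c) auto

lemma turing_machine_machine: "turing_machine (machine c P)"
  unfolding turing_machine_def
proof (intro conjI allI impI)
  fix q and xs :: "'a tsym list"
  assume q: "q < num_states (machine c P)"
    and xs: "length xs = num_tapes (machine c P) \<and> set xs \<subseteq> tape_symbols (machine c P)"
  show "case delta (machine c P) q xs of (q', acts) \<Rightarrow>
     q' < num_states (machine c P) \<and> length acts = num_tapes (machine c P) \<and>
     fst ` set acts \<subseteq> tape_symbols (machine c P)"
  proof (cases "q < code_length c")
    case True
    then have "code c 0 ! q \<in> set (code c 0)" by simp
    moreover have width: "num_tapes (machine c P) = width c"
      by (simp add: machine_def)
    ultimately have "fst ((code c 0 ! q) xs) \<le> code_length c \<and>
        length (snd ((code c 0 ! q) xs)) = length xs \<and>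
        fst ` set (snd ((code c 0 ! q) xs)) \<subseteq> tape_symbols (machine c P)"
      using code_wellformed[of "code c 0 ! q" c 0 xs "machine c P"] xs by simp
    moreover have "delta (machine c P) q xs = (code c 0 ! q) xs"
      using True by (simp add: machine_def)
    moreover have "num_states (machine c P) = code_length c + 3"
      by (simp add: machine_def)
    ultimately show ?thesis
      using xs by (simp add: case_prod_beta)
  next
    case False
    then have "delta (machine c P) q xs =
        (if P (xs ! 0) then code_length c + 1 else code_length c + 2, stay xs)"
      by (simp add: machine_def)
    moreover have "num_states (machine c P) = code_length c + 3"
      by (simp add: machine_def)
    moreover have "fst ` set (stay xs) = set xs"
      by (simp add: stay_def image_image)
    ultimately show ?thesis
      using xs by (simp add: case_prod_beta)
  qed
qed (use width_pos in \<open>auto simp: machine_def\<close>)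

lemma machine_run:
  assumes "exec c (\<lambda>i. if i = 0 then w else []) t s'"
  shows "fst ((tm_step (machine c P) ^^ Suc t) (initial_config (machine c P) w)) =
    (if P (top_sym (s' 0)) then accept_state (machine c P) else reject_state (machine c P))"
proof -
  let ?M = "machine c P"
  define ts where "ts = word_tape w # replicate (width c - 1) (word_tape [])"
  have init: "initial_config ?M w = (0, ts)"
    by (simp add: initial_config_def ts_def machine_def)
  have "holds (word_tape u) u" for u :: "'a list"
    by (simp add: holds_def word_tape_def)
  then have rep: "represents ts (\<lambda>i. if i = 0 then w else [])"
    by (auto simp: represents_def ts_def nth_Cons split: nat.splits)
  have len: "length ts = width c"
    using width_pos[of c] by (simp add: ts_def)
  have "located ?M c 0"
    by (auto simp: located_def machine_def)
  from code_correct[OF assms this _ rep] len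
  obtain ts' where ts': "(tm_step ?M ^^ t) (0, ts) = (code_length c, ts')"
    "length ts' = width c" "represents ts' s'" by auto
  then have "tape_read (ts' ! 0) = top_sym (s' 0)"
    using width_pos[of c] by (intro holds_read) (auto simp: represents_def)
  moreover have "ts' \<noteq> []"
    using ts'(2) width_pos[of c] by auto
  ultimately have "fst (tm_step ?M (code_length c, ts')) =
      (if P (top_sym (s' 0)) then accept_state ?M else reject_state ?M)"
    by (simp add: tm_step_def machine_def)
  then show ?thesis
    by (simp add: init ts'(1))
qed

section \<open>Polynomial-time computation on binary trees\<close>

datatype tree = Tip | Fork tree tree

fun word :: "tree \<Rightarrow> letter list" where
  "word Tip = [Stop]"
| "word (Fork a b) = Item # word a @ word b"

definition tsize :: "tree \<Rightarrow> nat" where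
  "tsize t = length (word t)"

lemma tsize_simps [simp]: "tsize Tip = 1" "tsize (Fork a b) = 1 + tsize a + tsize b"
  by (simp_all add: tsize_def)

lemma length_word [simp]: "length (word t) = tsize t"
  by (simp add: tsize_def)

lemma word_append_inject: "word s @ xs = word t @ ys \<Longrightarrow> s = t \<and> xs = ys"
proof (induction s arbitrary: t xs ys)
  case Tip
  then show ?case by (cases t) auto
next
  case (Fork s1 s2)
  from Fork.prems obtain t1 t2 where t: "t = Fork t1 t2"
    by (cases t) auto
  with Fork.prems have "word s1 @ (word s2 @ xs) = word t1 @ (word t2 @ ys)" by simp
  from Fork.IH(1)[OF this] Fork.IH(2) t show ?case by blast
qed

lemma word_inject [simp]: "word s = word t \<longleftrightarrow> s = t"
  using word_append_inject[of s "[]" t "[]"] by auto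

lemma set_word: "set (word t) \<subseteq> {Item, Stop}"
  by (induction t) auto

lemma word_nonempty [simp]: "word t \<noteq> []"
  by (cases t) auto

lemma top_sym_word: "top_sym (word t) = Inp (if t = Tip then Stop else Item)"
  by (cases t) auto

lemma top_sym_Blank [simp]: "top_sym xs = Blank \<longleftrightarrow> xs = []"
  by (cases xs) auto

text \<open>An upper bound replaces the exact time so that one number can cover both branches of a
  test.\<close>

definition run :: "'a com \<Rightarrow> 'a store \<Rightarrow> nat \<Rightarrow> 'a store \<Rightarrow> bool" where
  "run c s b s' \<longleftrightarrow> (\<exists>t\<le>b. exec c s t s')"

lemma run_exec: "exec c s t s' \<Longrightarrow> run c s t s'"
  by (auto simp: run_def)

lemma run_weaken: "run c s b s' \<Longrightarrow> s' = s'' \<Longrightarrow> b \<le> b' \<Longrightarrow> run c s b' s''"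
  by (auto simp: run_def intro: order_trans)

lemma run_start: "run c s b s' \<Longrightarrow> s'' = s \<Longrightarrow> run c s'' b s'"
  by simp

lemma run_Seq: "run c s b s' \<Longrightarrow> run d s' b' s'' \<Longrightarrow> run (c ;; d) s (b + b') s''"
  unfolding run_def by (meson exec.Seq add_mono)

lemmas run_Skip = run_exec[OF exec.Skip]
  and run_Push = run_exec[OF exec.Push]
  and run_Pop = run_exec[OF exec.Pop]

lemma run_Dup: "i \<noteq> j \<Longrightarrow> s i \<noteq> [] \<Longrightarrow> run (Dup i j) s 2 (s(j := hd (s i) # s j))"
  using exec.Dup[of i j s] by (cases "s i") (auto intro: run_exec)

lemma run_If:
  assumes "P (top_sym (s i)) \<Longrightarrow> run c s b s'" "\<not> P (top_sym (s i)) \<Longrightarrow> run d s b s'"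
  shows "run (If_top i P c d) s (b + 2) s'"
proof (cases "P (top_sym (s i))")
  case True
  with assms(1) obtain t where "t \<le> b" "exec c s t s'" by (auto simp: run_def)
  with exec.If_True[of P s i c t s' d] True show ?thesis
    unfolding run_def by (intro exI[of _ "1 + (t + 1)"]) auto
next
  case False
  with assms(2) obtain t where "t \<le> b" "exec d s t s'" by (auto simp: run_def)
  with exec.If_False[of P s i d t s' c] False show ?thesis
    unfolding run_def by (intro exI[of _ "1 + t"]) auto
qed

lemma run_While_False: "\<not> P (top_sym (s i)) \<Longrightarrow> run (While_top i P c) s 1 s"
  by (intro run_exec exec.While_False)

lemma run_While_True:
  assumes "P (top_sym (s i))" "run c s b s'" "run (While_top i P c) s' b' s''"
  shows "run (While_top i P c) s (2 + b + b') s''"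
proof -
  from assms obtain t u where "t \<le> b" "exec c s t s'" "u \<le> b'" "exec (While_top i P c) s' u s''"
    by (auto simp: run_def)
  with exec.While_True[of P s i c t s' u s''] assms(1) show ?thesis
    unfolding run_def by (intro exI[of _ "1 + (t + (1 + u))"]) auto
qed

text \<open>A program cannot write more than its time permits. This makes results of polynomial-time
  programs polynomial in size, which composition relies on.\<close>

lemma exec_length: "exec c s t s' \<Longrightarrow> length (s' i) \<le> length (s i) + t"
  by (induction rule: exec.induct) (auto split: if_splits)

lemma run_length: "run c s b s' \<Longrightarrow> length (s' i) \<le> length (s i) + b"
  unfolding run_def using exec_length by (metis add_le_cancel_left order_trans)

section \<open>Moving, clearing, copying and splitting stacks\<close>

abbreviation nonblank :: "'a tsym \<Rightarrow> bool" where
  "nonblank x \<equiv> x \<noteq> Blank"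

abbreviation is_sym :: "'a \<Rightarrow> 'a tsym \<Rightarrow> bool" where
  "is_sym a x \<equiv> x = Inp a"

text \<open>Moving reverses the contents, so a word that is to keep its order is always moved
  twice.\<close>

definition move :: "nat \<Rightarrow> nat \<Rightarrow> 'a com" where
  "move i j = While_top i nonblank (Dup i j ;; Pop i)"

definition clear :: "nat \<Rightarrow> 'a com" where
  "clear i = While_top i nonblank (Pop i)"

definition copy :: "nat \<Rightarrow> nat \<Rightarrow> nat \<Rightarrow> 'a com" where
  "copy i j h = move i h ;; While_top h nonblank (Dup h i ;; Dup h j ;; Pop h)"

lemma run_move:
  assumes "i \<noteq> j"
  shows "run (move i j) s (5 * length (s i) + 1) (s(i := [], j := rev (s i) @ s j))"
proof (induction "s i" arbitrary: s)
  case Nil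
  then show ?case
    using assms unfolding move_def
    by (intro run_weaken[OF run_While_False]) (auto simp: fun_eq_iff)
next
  case (Cons a xs)
  show ?case
    unfolding move_def
  proof (rule run_weaken)
    show "run (While_top i nonblank (Dup i j ;; Pop i)) s (2 + (2 + 1) + (5 * length xs + 1))
      (s(i := [], j := rev (s i) @ s j))"
    proof (rule run_While_True)
      show "run (Dup i j ;; Pop i) s (2 + 1) (s(j := a # s j, i := xs))"
        by (rule run_weaken[OF run_Seq[OF run_Dup run_Pop]])
          (use assms in \<open>auto simp flip: Cons.hyps(2) simp: fun_eq_iff\<close>)
      have "run (move i j) (s(j := a # s j, i := xs)) (5 * length xs + 1)
          (s(i := [], j := rev (s i) @ s j))"
        by (rule run_weaken[OF Cons.hyps(1)])
          (use assms in \<open>auto simp flip: Cons.hyps(2) simp: fun_eq_iff\<close>)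
      then show "run (While_top i nonblank (Dup i j ;; Pop i)) (s(j := a # s j, i := xs))
        (5 * length xs + 1) (s(i := [], j := rev (s i) @ s j))"
        by (simp add: move_def)
    qed (auto simp flip: Cons.hyps(2))
  qed (auto simp flip: Cons.hyps(2))
qed

lemma run_clear: "run (clear i) s (3 * length (s i) + 1) (s(i := []))"
proof (induction "s i" arbitrary: s)
  case Nil
  then show ?case
    unfolding clear_def
    by (intro run_weaken[OF run_While_False]) (auto simp: fun_eq_iff)
next
  case (Cons a xs)
  have "run (clear i) (s(i := tl (s i))) (3 * length xs + 1) (s(i := []))"
    by (rule run_weaken[OF Cons.hyps(1)]) (auto simp flip: Cons.hyps(2))
  then have "run (clear i) s (2 + 1 + (3 * length xs + 1)) (s(i := []))"
    unfolding clear_def by (intro run_While_True[OF _ run_Pop]) (auto simp flip: Cons.hyps(2))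
  then show ?case
    by (simp flip: Cons.hyps(2))
qed

lemma run_copy_loop:
  assumes "i \<noteq> j" "i \<noteq> h" "j \<noteq> h"
  shows "run (While_top h nonblank (Dup h i ;; Dup h j ;; Pop h)) s (7 * length (s h) + 1)
    (s(h := [], i := rev (s h) @ s i, j := rev (s h) @ s j))"
proof (induction "s h" arbitrary: s)
  case Nil
  then show ?case
    using assms by (intro run_weaken[OF run_While_False]) (auto simp: fun_eq_iff)
next
  case (Cons a xs)
  have "run (While_top h nonblank (Dup h i ;; Dup h j ;; Pop h)) s
      (2 + (2 + (2 + 1)) + (7 * length xs + 1))
      (s(h := [], i := rev (s h) @ s i, j := rev (s h) @ s j))"
  proof (rule run_While_True)
    show "run (Dup h i ;; Dup h j ;; Pop h) s (2 + (2 + 1)) (s(i := a # s i, j := a # s j, h := xs))"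
      by (rule run_weaken[OF run_Seq[OF run_Dup run_Seq[OF run_Dup run_Pop]]])
        (use assms in \<open>auto simp flip: Cons.hyps(2) simp: fun_eq_iff\<close>)
    show "run (While_top h nonblank (Dup h i ;; Dup h j ;; Pop h))
       (s(i := a # s i, j := a # s j, h := xs)) (7 * length xs + 1)
       (s(h := [], i := rev (s h) @ s i, j := rev (s h) @ s j))"
      by (rule run_weaken[OF Cons.hyps(1)])
        (use assms in \<open>auto simp flip: Cons.hyps(2) simp: fun_eq_iff\<close>)
  qed (auto simp flip: Cons.hyps(2))
  then show ?case
    by (simp flip: Cons.hyps(2))
qed

lemma run_copy:
  assumes "i \<noteq> j" "i \<noteq> h" "j \<noteq> h" "s h = []"
  shows "run (copy i j h) s (12 * length (s i) + 2) (s(j := s i @ s j))"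
  unfolding copy_def
  by (rule run_weaken[OF run_Seq[OF run_move run_copy_loop]])
    (use assms in \<open>auto simp: fun_eq_iff\<close>)

text \<open>Stack \<open>h\<close> counts the tree words that are still to be moved from \<open>i\<close> to \<open>j\<close>.\<close>

definition split_loop :: "nat \<Rightarrow> nat \<Rightarrow> nat \<Rightarrow> letter com" where
  "split_loop i j h = While_top h nonblank
     (Dup i j ;; If_top i (is_sym Item) (Pop i ;; Push h Item) (Pop i ;; Pop h))"

definition split_word :: "nat \<Rightarrow> nat \<Rightarrow> nat \<Rightarrow> letter com" where
  "split_word i j h = Push h Item ;; split_loop i j h"

text \<open>The rest of the loop enters as a continuation with bound \<open>b\<close>, because the
  second subtree is processed by the same loop run as the first. A \<open>Fork\<close> replaces one
  pending word by two, a \<open>Tip\<close> settles one; the constant 9 is the cost of an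
  \<open>Item\<close> letter.\<close>

lemma run_split_loop:
  assumes "i \<noteq> j" "i \<noteq> h" "j \<noteq> h" "s i = word t @ xs" "s h \<noteq> []"
    "run (split_loop i j h) (s(i := xs, j := rev (word t) @ s j, h := tl (s h))) b s'"
  shows "run (split_loop i j h) s (9 * tsize t + b) s'"
  using assms(4-)
proof (induction t arbitrary: s xs b)
  case Tip
  have "run (split_loop i j h) s (2 + (2 + ((1 + 1) + 2)) + b) s'"
    unfolding split_loop_def
  proof (rule run_While_True)
    show "run (Dup i j ;; If_top i (is_sym Item) (Pop i ;; Push h Item) (Pop i ;; Pop h)) s
        (2 + ((1 + 1) + 2)) (s(i := xs, j := rev (word Tip) @ s j, h := tl (s h)))"
      by (rule run_Seq[OF run_Dup run_If[OF _ run_weaken[OF run_Seq[OF run_Pop run_Pop]]]])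
        (use assms(1-3) Tip.prems in \<open>auto simp: fun_eq_iff\<close>)
    show "run (While_top h nonblank (Dup i j ;;
        If_top i (is_sym Item) (Pop i ;; Push h Item) (Pop i ;; Pop h)))
       (s(i := xs, j := rev (word Tip) @ s j, h := tl (s h))) b s'"
      using Tip.prems(3) unfolding split_loop_def .
  qed (use Tip.prems in auto)
  then show ?case by (rule run_weaken) auto
next
  case (Fork t1 t2)
  have "run (split_loop i j h) s (2 + (2 + ((1 + 2) + 2)) + (9 * tsize t1 + (9 * tsize t2 + b))) s'"
    unfolding split_loop_def
  proof (rule run_While_True)
    show "run (Dup i j ;; If_top i (is_sym Item) (Pop i ;; Push h Item) (Pop i ;; Pop h)) s
        (2 + ((1 + 2) + 2)) (s(i := word t1 @ word t2 @ xs, j := Item # s j, h := Item # s h))"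
      by (rule run_Seq[OF run_Dup run_If[OF run_weaken[OF run_Seq[OF run_Pop run_Push]]]])
        (use assms(1-3) Fork.prems in \<open>auto simp: fun_eq_iff\<close>)
    show "run (While_top h nonblank (Dup i j ;;
        If_top i (is_sym Item) (Pop i ;; Push h Item) (Pop i ;; Pop h)))
       (s(i := word t1 @ word t2 @ xs, j := Item # s j, h := Item # s h))
       (9 * tsize t1 + (9 * tsize t2 + b)) s'"
      unfolding split_loop_def[symmetric]
    proof (rule Fork.IH(1))
      show "run (split_loop i j h)
         ((s(i := word t1 @ word t2 @ xs, j := Item # s j, h := Item # s h))
          (i := word t2 @ xs,
           j := rev (word t1) @ (s(i := word t1 @ word t2 @ xs, j := Item # s j, h := Item # s h)) j,
           h := tl ((s(i := word t1 @ word t2 @ xs, j := Item # s j, h := Item # s h)) h)))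
         (9 * tsize t2 + b) s'"
        by (rule Fork.IH(2)[where xs = xs], use assms(1-3) Fork.prems in simp_all)
          (rule run_start[OF Fork.prems(3)], use assms(1-3) in \<open>auto simp: fun_eq_iff\<close>)
    qed (use assms(1-3) in auto)
  qed (use Fork.prems in auto)
  then show ?case by (rule run_weaken) auto
qed

lemma run_split_word:
  assumes "i \<noteq> j" "i \<noteq> h" "j \<noteq> h" "s h = []" "s i = word t @ xs"
  shows "run (split_word i j h) s (9 * tsize t + 3) (s(i := xs, j := rev (word t) @ s j))"
proof -
  have "run (split_loop i j h) (s(h := Item # s h)) (9 * tsize t + 1)
      (s(i := xs, j := rev (word t) @ s j))"
    by (rule run_split_loop[where xs = xs])
      (use assms in \<open>auto simp: split_loop_def fun_eq_iff intro!: run_weaken[OF run_While_False]\<close>)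
  from run_Seq[OF run_Push this] show ?thesis
    unfolding split_word_def by (rule run_weaken) auto
qed

section \<open>Polynomial bounds, and families of trees computed in polynomial time\<close>

definition poly_bounded :: "'x set \<Rightarrow> ('x \<Rightarrow> nat) \<Rightarrow> ('x \<Rightarrow> nat) \<Rightarrow> bool" where
  "poly_bounded X n b \<longleftrightarrow> (\<exists>p. \<forall>x\<in>X. b x \<le> poly p (n x))"

text \<open>Coefficients are natural numbers, so every polynomial is monotone and bounds can be
  substituted into bounds.\<close>

lemma poly_nat_mono: "m \<le> n \<Longrightarrow> poly p m \<le> poly p n" for p :: "nat poly"
  by (induction p) (auto intro!: add_mono mult_mono)

lemma poly_bounded_const: "poly_bounded X n (\<lambda>_. c)"
  unfolding poly_bounded_def by (intro exI[of _ "[:c:]"]) simp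

lemma poly_bounded_self: "poly_bounded X n n"
  unfolding poly_bounded_def by (intro exI[of _ "[:0, 1:]"]) simp

lemma poly_bounded_add:
  assumes "poly_bounded X n b" "poly_bounded X n c"
  shows "poly_bounded X n (\<lambda>x. b x + c x)"
proof -
  from assms obtain p q where "\<forall>x\<in>X. b x \<le> poly p (n x)" "\<forall>x\<in>X. c x \<le> poly q (n x)"
    by (auto simp: poly_bounded_def)
  then show ?thesis
    unfolding poly_bounded_def by (intro exI[of _ "p + q"]) (simp add: add_mono)
qed

lemma poly_bounded_mult:
  assumes "poly_bounded X n b" "poly_bounded X n c"
  shows "poly_bounded X n (\<lambda>x. b x * c x)"
proof -
  from assms obtain p q where "\<forall>x\<in>X. b x \<le> poly p (n x)" "\<forall>x\<in>X. c x \<le> poly q (n x)"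
    by (auto simp: poly_bounded_def)
  then show ?thesis
    unfolding poly_bounded_def by (intro exI[of _ "p * q"]) (simp add: mult_mono)
qed

lemma poly_bounded_trans:
  assumes "poly_bounded X n m" "poly_bounded X m b"
  shows "poly_bounded X n b"
proof -
  from assms obtain p q where "\<forall>x\<in>X. m x \<le> poly p (n x)" "\<forall>x\<in>X. b x \<le> poly q (m x)"
    by (auto simp: poly_bounded_def)
  then have "b x \<le> poly (pcompose q p) (n x)" if "x \<in> X" for x
    using that poly_nat_mono[of "m x" "poly p (n x)" q] by (fastforce simp: poly_pcompose)
  then show ?thesis
    unfolding poly_bounded_def by blast
qed

lemma poly_bounded_le: "poly_bounded X n b \<Longrightarrow> (\<And>x. x \<in> X \<Longrightarrow> c x \<le> b x) \<Longrightarrow> poly_bounded X n c"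
  unfolding poly_bounded_def by (meson order_trans)

lemmas poly_bounded_intros =
  poly_bounded_const poly_bounded_self poly_bounded_add poly_bounded_mult

text \<open>In the following definition \<open>e\<close> and \<open>f\<close> are families of trees: one program turns \<open>e x\<close> into
  \<open>f x\<close>, for all indices \<open>x\<close>.  It works on the stacks below \<open>k\<close> and leaves the others alone.\<close>

definition realizes ::
  "letter com \<Rightarrow> nat \<Rightarrow> ('x \<Rightarrow> nat) \<Rightarrow> 'x set \<Rightarrow> ('x \<Rightarrow> tree) \<Rightarrow> ('x \<Rightarrow> tree) \<Rightarrow> bool" where
  "realizes c k b X e f \<longleftrightarrow> 0 < k \<and> poly_bounded X (\<lambda>x. tsize (e x)) b \<and>
     (\<forall>x\<in>X. \<forall>s. s 0 = word (e x) \<longrightarrow> (\<forall>i. 0 < i \<and> i < k \<longrightarrow> s i = []) \<longrightarrow>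
        run c s (b x) (s(0 := word (f x))))"

definition computes :: "'x set \<Rightarrow> ('x \<Rightarrow> tree) \<Rightarrow> ('x \<Rightarrow> tree) \<Rightarrow> bool" where
  "computes X e f \<longleftrightarrow> (\<exists>c k b. realizes c k b X e f)"

lemma computesI:
  assumes "poly_bounded X (\<lambda>x. tsize (e x)) b" "0 < k"
    "\<And>x s. x \<in> X \<Longrightarrow> s 0 = word (e x) \<Longrightarrow> (\<And>i. 0 < i \<Longrightarrow> i < k \<Longrightarrow> s i = []) \<Longrightarrow>
       run c s (b x) (s(0 := word (f x)))"
  shows "computes X e f"
  unfolding computes_def realizes_def
proof (intro exI[of _ c] exI[of _ k] exI[of _ b] conjI ballI allI impI)
  fix x and s :: "letter store"
  assume "x \<in> X" "s 0 = word (e x)" and s: "\<forall>i. 0 < i \<and> i < k \<longrightarrow> s i = []"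
  from this(1,2) show "run c s (b x) (s(0 := word (f x)))"
    by (rule assms(3)) (use s in simp)
qed (rule assms)+

lemma realizesD:
  assumes "realizes c k b X e f"
  shows "0 < k" "poly_bounded X (\<lambda>x. tsize (e x)) b"
    "\<And>x s. x \<in> X \<Longrightarrow> s 0 = word (e x) \<Longrightarrow> (\<And>i. 0 < i \<Longrightarrow> i < k \<Longrightarrow> s i = []) \<Longrightarrow>
       run c s (b x) (s(0 := word (f x)))"
  using assms by (auto simp: realizes_def)

lemma computes_size:
  assumes "computes X e f"
  shows "poly_bounded X (\<lambda>x. tsize (e x)) (\<lambda>x. tsize (f x))"
proof -
  from assms obtain c k b where real_c: "realizes c k b X e f"
    by (auto simp: computes_def)
  note c = realizesD[OF real_c]
  have "tsize (f x) \<le> tsize (e x) + b x" if "x \<in> X" for x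
    using run_length[OF c(3)[of x "\<lambda>i. if i = 0 then word (e x) else []"], of 0] that by auto
  then show ?thesis
    by (rule poly_bounded_le[OF poly_bounded_add[OF poly_bounded_self c(2)]])
qed

text \<open>A program sees only the trees, so the index set can be exchanged. In this way a program
  for all values of a type is applied to the intermediate results of another computation.\<close>

lemma computes_reindex:
  assumes "computes Y e f"
    and h: "\<And>x. x \<in> X \<Longrightarrow> h x \<in> Y \<and> e (h x) = e' x \<and> f (h x) = f' x"
  shows "computes X e' f'"
proof -
  from assms(1) obtain c k b where real_c: "realizes c k b Y e f"
    by (auto simp: computes_def)
  note c = realizesD[OF real_c]
  show ?thesis
  proof (rule computesI[where k = k and b = "\<lambda>x. b (h x)" and c = c])
    from c(2) obtain p where "\<forall>x\<in>Y. b x \<le> poly p (tsize (e x))"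
      by (auto simp: poly_bounded_def)
    then have "\<forall>x\<in>X. b (h x) \<le> poly p (tsize (e' x))"
      using h by metis
    then show "poly_bounded X (\<lambda>x. tsize (e' x)) (\<lambda>x. b (h x))"
      unfolding poly_bounded_def by blast
  next
    fix x and s :: "letter store"
    assume x: "x \<in> X" and s: "s 0 = word (e' x)" "\<And>i. 0 < i \<Longrightarrow> i < k \<Longrightarrow> s i = []"
    have "run c s (b (h x)) (s(0 := word (f (h x))))"
      by (rule c(3)) (use h[OF x] s in auto)
    with h[OF x] show "run c s (b (h x)) (s(0 := word (f' x)))" by simp
  qed (rule c)
qed

lemma computes_subset: "computes X e f \<Longrightarrow> Y \<subseteq> X \<Longrightarrow> computes Y e f"
  by (erule computes_reindex[where h = "\<lambda>x. x"]) auto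

lemma computes_cong:
  "computes X e f \<Longrightarrow> (\<And>x. x \<in> X \<Longrightarrow> e x = e' x) \<Longrightarrow> (\<And>x. x \<in> X \<Longrightarrow> f x = f' x) \<Longrightarrow> computes X e' f'"
  by (erule computes_reindex[where h = "\<lambda>x. x"]) auto

lemma computes_id: "computes X e e"
  by (rule computesI[where k = 1 and b = "\<lambda>_. 0" and c = Skip])
    (auto intro: poly_bounded_intros run_weaken[OF run_Skip] simp: fun_eq_iff)

lemma computes_comp:
  assumes "computes X e f" "computes X f g"
  shows "computes X e g"
proof -
  from assms(1) obtain c k b where real_1: "realizes c k b X e f"
    by (auto simp: computes_def)
  note 1 = realizesD[OF real_1]
  from assms(2) obtain d l b' where real_2: "realizes d l b' X f g"
    by (auto simp: computes_def)
  note 2 = realizesD[OF real_2]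
  show ?thesis
  proof (rule computesI[where k = "max k l" and c = "c ;; d" and b = "\<lambda>x. b x + b' x"])
    show "poly_bounded X (\<lambda>x. tsize (e x)) (\<lambda>x. b x + b' x)"
      using poly_bounded_trans[OF computes_size[OF assms(1)] 2(2)] 1(2) by (rule poly_bounded_add[rotated])
    fix x and s :: "letter store"
    assume "x \<in> X" "s 0 = word (e x)" "\<And>i. 0 < i \<Longrightarrow> i < max k l \<Longrightarrow> s i = []"
    then show "run (c ;; d) s (b x + b' x) (s(0 := word (g x)))"
      by (intro run_weaken[OF run_Seq[OF 1(3) 2(3)]]) auto
  qed (use 1 in auto)
qed

lemma computes_Tip: "computes X e (\<lambda>_. Tip)"
proof (rule computesI[where k = 1 and b = "\<lambda>x. 3 * tsize (e x) + 1 + 2" and c = "clear 0 ;; Push 0 Stop"])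
  fix x and s :: "letter store"
  assume "s 0 = word (e x)"
  then show "run (clear 0 ;; Push 0 Stop) s (3 * tsize (e x) + 1 + 2) (s(0 := word Tip))"
    by (intro run_weaken[OF run_Seq[OF run_clear run_Push]]) auto
qed (rule poly_bounded_intros | simp)+

lemma computes_Fork:
  assumes "computes X e f" "computes X e g"
  shows "computes X e (\<lambda>x. Fork (f x) (g x))"
proof -
  from assms(1) obtain c k b where real_1: "realizes c k b X e f"
    by (auto simp: computes_def)
  note 1 = realizesD[OF real_1]
  from assms(2) obtain d l b' where real_2: "realizes d l b' X e g"
    by (auto simp: computes_def)
  note 2 = realizesD[OF real_2]
  define m where "m = max k l"
  have m: "0 < m" using 1(1) by (simp add: m_def)
  \<comment> \<open>The stacks from \<open>m\<close> on lie above both workspaces: \<open>m\<close>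
    keeps the input, \<open>m + 1\<close> is used for copying and reversing, and
    \<open>m + 2\<close> keeps the first result during the second computation.\<close>
  let ?P = "copy 0 m (m + 1) ;; c ;; move 0 (m + 1) ;; move (m + 1) (m + 2) ;; move m (m + 1) ;;
    move (m + 1) 0 ;; d ;; move (m + 2) (m + 1) ;; move (m + 1) 0 ;; Push 0 Item"
  let ?b = "\<lambda>x. 100 * tsize (e x) + 100 * tsize (f x) + 100 + b x + b' x"
  show ?thesis
  proof (rule computesI[where k = "m + 3" and c = ?P and b = ?b])
    show "poly_bounded X (\<lambda>x. tsize (e x)) ?b"
      by (intro poly_bounded_intros 1(2) 2(2) computes_size[OF assms(1)])
    fix x and s :: "letter store"
    assume x: "x \<in> X" and s0: "s 0 = word (e x)" and s: "\<And>i. 0 < i \<Longrightarrow> i < m + 3 \<Longrightarrow> s i = []"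
    let ?e = "word (e x)" and ?f = "word (f x)" and ?g = "word (g x)"
    have [simp]: "0 < m" "m \<noteq> 0" "0 \<noteq> m" using m by auto
    have r1: "run (copy 0 m (m + 1)) s (12 * tsize (e x) + 2) (s(m := ?e))"
      by (rule run_weaken[OF run_copy]) (auto simp: s0 s)
    have r2: "run c (s(m := ?e)) (b x) (s(m := ?e, 0 := ?f))"
      by (rule 1(3)[OF x]) (auto simp: s0 s m_def)
    have r3: "run (move 0 (m + 1)) (s(m := ?e, 0 := ?f)) (5 * tsize (f x) + 1)
        (s(m := ?e, 0 := [], m + 1 := rev ?f))"
      by (rule run_weaken[OF run_move]) (auto simp: s0 s fun_eq_iff)
    have r4: "run (move (m + 1) (m + 2)) (s(m := ?e, 0 := [], m + 1 := rev ?f)) (5 * tsize (f x) + 1)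
        (s(m := ?e, 0 := [], m + 2 := ?f))"
      by (rule run_weaken[OF run_move]) (auto simp: s0 s fun_eq_iff)
    have r5: "run (move m (m + 1)) (s(m := ?e, 0 := [], m + 2 := ?f)) (5 * tsize (e x) + 1)
        (s(0 := [], m + 1 := rev ?e, m + 2 := ?f))"
      by (rule run_weaken[OF run_move]) (auto simp: s0 s fun_eq_iff)
    have r6: "run (move (m + 1) 0) (s(0 := [], m + 1 := rev ?e, m + 2 := ?f)) (5 * tsize (e x) + 1)
        (s(m + 2 := ?f))"
      by (rule run_weaken[OF run_move]) (auto simp: s0 s fun_eq_iff)
    have r7: "run d (s(m + 2 := ?f)) (b' x) (s(m + 2 := ?f, 0 := ?g))"
      by (rule 2(3)[OF x]) (auto simp: s0 s m_def)
    have r8: "run (move (m + 2) (m + 1)) (s(m + 2 := ?f, 0 := ?g)) (5 * tsize (f x) + 1)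
       (s(m + 1 := rev ?f, 0 := ?g))"
      by (rule run_weaken[OF run_move]) (auto simp: s0 s fun_eq_iff)
    have r9: "run (move (m + 1) 0) (s(m + 1 := rev ?f, 0 := ?g)) (5 * tsize (f x) + 1)
       (s(0 := ?f @ ?g))"
      by (rule run_weaken[OF run_move]) (auto simp: s0 s fun_eq_iff)
    show "run ?P s (?b x) (s(0 := word (Fork (f x) (g x))))"
      by (rule run_weaken[OF run_Seq[OF r1 run_Seq[OF r2 run_Seq[OF r3 run_Seq[OF r4 run_Seq[OF r5
                  run_Seq[OF r6 run_Seq[OF r7 run_Seq[OF r8 run_Seq[OF r9 run_Push]]]]]]]]]]) auto
  qed simp
qed

section \<open>Destructors, branching, iteration and equality of trees\<close>

fun car :: "tree \<Rightarrow> tree" where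
  "car Tip = Tip"
| "car (Fork a b) = a"

fun cdr :: "tree \<Rightarrow> tree" where
  "cdr Tip = Tip"
| "cdr (Fork a b) = b"

lemma computes_car:
  assumes "computes X e f"
  shows "computes X e (\<lambda>x. car (f x))"
proof (rule computes_comp[OF assms])
  let ?P = "If_top 0 (is_sym Item) (Pop 0 ;; split_word 0 1 2 ;; clear 0 ;; move 1 0) Skip"
  let ?b = "\<lambda>x. 100 * tsize (f x) + 100"
  show "computes X f (\<lambda>x. car (f x))"
  proof (rule computesI[where k = 3 and c = ?P and b = ?b])
    fix x and s :: "letter store"
    assume s0: "s 0 = word (f x)" and s: "\<And>i. 0 < i \<Longrightarrow> i < 3 \<Longrightarrow> s i = []"
    have "run ?P s (98 * tsize (f x) + 98 + 2) (s(0 := word (car (f x))))"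
    proof (cases "f x")
      case Tip
      then show ?thesis
        by (intro run_If run_weaken[OF run_Skip]) (auto simp: s0 s fun_eq_iff)
    next
      case (Fork a b)
      have r1: "run (Pop 0) s 1 (s(0 := word a @ word b))"
        by (rule run_weaken[OF run_Pop]) (auto simp: s0 Fork)
      have r2: "run (split_word 0 1 2) (s(0 := word a @ word b)) (9 * tsize a + 3)
          (s(0 := word b, 1 := rev (word a)))"
        by (rule run_weaken[OF run_split_word[where xs = "word b"]]) (auto simp: s)
      have r3: "run (clear 0) (s(0 := word b, 1 := rev (word a))) (3 * tsize b + 1)
          (s(0 := [], 1 := rev (word a)))"
        by (rule run_weaken[OF run_clear]) (auto simp: fun_eq_iff)
      have r4: "run (move 1 0) (s(0 := [], 1 := rev (word a))) (5 * tsize a + 1) (s(0 := word a))"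
        by (rule run_weaken[OF run_move]) (auto simp: s fun_eq_iff)
      show ?thesis
        by (rule run_If[OF run_weaken[OF run_Seq[OF r1 run_Seq[OF r2 run_Seq[OF r3 r4]]]]])
          (auto simp: s0 Fork)
    qed
    then show "run ?P s (?b x) (s(0 := word (car (f x))))"
      by (rule run_weaken) auto
  qed (rule poly_bounded_intros | simp)+
qed

lemma computes_cdr:
  assumes "computes X e f"
  shows "computes X e (\<lambda>x. cdr (f x))"
proof (rule computes_comp[OF assms])
  let ?P = "If_top 0 (is_sym Item) (Pop 0 ;; split_word 0 1 2 ;; clear 1) Skip"
  let ?b = "\<lambda>x. 100 * tsize (f x) + 100"
  show "computes X f (\<lambda>x. cdr (f x))"
  proof (rule computesI[where k = 3 and c = ?P and b = ?b])
    fix x and s :: "letter store"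
    assume s0: "s 0 = word (f x)" and s: "\<And>i. 0 < i \<Longrightarrow> i < 3 \<Longrightarrow> s i = []"
    have "run ?P s (98 * tsize (f x) + 98 + 2) (s(0 := word (cdr (f x))))"
    proof (cases "f x")
      case Tip
      then show ?thesis
        by (intro run_If run_weaken[OF run_Skip]) (auto simp: s0 s fun_eq_iff)
    next
      case (Fork a b)
      have r1: "run (Pop 0) s 1 (s(0 := word a @ word b))"
        by (rule run_weaken[OF run_Pop]) (auto simp: s0 Fork)
      have r2: "run (split_word 0 1 2) (s(0 := word a @ word b)) (9 * tsize a + 3)
          (s(0 := word b, 1 := rev (word a)))"
        by (rule run_weaken[OF run_split_word[where xs = "word b"]]) (auto simp: s)
      have r3: "run (clear 1) (s(0 := word b, 1 := rev (word a))) (3 * tsize a + 1)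
          (s(0 := word b))"
        by (rule run_weaken[OF run_clear]) (auto simp: fun_eq_iff s)
      show ?thesis
        by (rule run_If[OF run_weaken[OF run_Seq[OF r1 run_Seq[OF r2 r3]]]])
          (auto simp: s0 Fork)
    qed
    then show "run ?P s (?b x) (s(0 := word (cdr (f x))))"
      by (rule run_weaken) auto
  qed (rule poly_bounded_intros | simp)+
qed

text \<open>Each branch has to work only where the test selects it, so that a case distinction on
  lists can take apart a list known to be nonempty.\<close>

lemma computes_If:
  assumes "computes X e t" "computes {x \<in> X. t x \<noteq> Tip} e f" "computes {x \<in> X. t x = Tip} e g"
  shows "computes X e (\<lambda>x. if t x = Tip then g x else f x)"
proof -
  from assms(1) obtain ct kt bt where real_t: "realizes ct kt bt X e t"
    by (auto simp: computes_def)
  note t = realizesD[OF real_t]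
  from assms(2) obtain cf kf bf where real_f: "realizes cf kf bf {x \<in> X. t x \<noteq> Tip} e f"
    by (auto simp: computes_def)
  note f = realizesD[OF real_f]
  from assms(3) obtain cg kg bg where real_g: "realizes cg kg bg {x \<in> X. t x = Tip} e g"
    by (auto simp: computes_def)
  note g = realizesD[OF real_g]
  define m where "m = max kt (max kf kg)"
  have m: "0 < m" using t(1) by (simp add: m_def)
  \<comment> \<open>The test has replaced the input on stack 0, so each branch first restores the
    input from its copy.\<close>
  let ?R = "\<lambda>c. clear 0 ;; move m (m + 1) ;; move (m + 1) 0 ;; c"
  let ?P = "copy 0 m (m + 1) ;; ct ;; If_top 0 (is_sym Item) (?R cf) (?R cg)"
  let ?b = "\<lambda>x. 100 * tsize (e x) + 3 * tsize (t x) + 100 + bt x + (if t x = Tip then bg x else bf x)"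
  have if_bound: "poly_bounded X (\<lambda>x. tsize (e x)) (\<lambda>x. if t x = Tip then bg x else bf x)"
  proof -
    from f(2) g(2) obtain p q where "\<forall>x\<in>X. t x \<noteq> Tip \<longrightarrow> bf x \<le> poly p (tsize (e x))"
      "\<forall>x\<in>X. t x = Tip \<longrightarrow> bg x \<le> poly q (tsize (e x))"
      by (auto simp: poly_bounded_def)
    then show ?thesis
      unfolding poly_bounded_def by (intro exI[of _ "p + q"]) (auto intro: trans_le_add1 trans_le_add2)
  qed
  show ?thesis
  proof (rule computesI[where k = "m + 2" and c = ?P and b = ?b])
    show "poly_bounded X (\<lambda>x. tsize (e x)) ?b"
      by (intro poly_bounded_intros t(2) if_bound computes_size[OF assms(1)])
    fix x and s :: "letter store"
    assume x: "x \<in> X" and s0: "s 0 = word (e x)" and s: "\<And>i. 0 < i \<Longrightarrow> i < m + 2 \<Longrightarrow> s i = []"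
    let ?e = "word (e x)" and ?t = "word (t x)"
    have [simp]: "0 < m" "m \<noteq> 0" "0 \<noteq> m" using m by auto
    have r1: "run (copy 0 m (m + 1)) s (12 * tsize (e x) + 2) (s(m := ?e))"
      by (rule run_weaken[OF run_copy]) (auto simp: s0 s)
    have r2: "run ct (s(m := ?e)) (bt x) (s(m := ?e, 0 := ?t))"
      by (rule t(3)[OF x]) (auto simp: s0 s m_def)
    have R: "run (?R c) (s(m := ?e, 0 := ?t)) (3 * tsize (t x) + 10 * tsize (e x) + 3 + b') s'"
      if "run c s b' s'" for c b' s'
    proof -
      have "run (clear 0) (s(m := ?e, 0 := ?t)) (3 * tsize (t x) + 1) (s(m := ?e, 0 := []))"
        by (rule run_weaken[OF run_clear]) (auto simp: fun_eq_iff)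
      moreover have "run (move m (m + 1)) (s(m := ?e, 0 := [])) (5 * tsize (e x) + 1)
          (s(m + 1 := rev ?e, 0 := []))"
        by (rule run_weaken[OF run_move]) (auto simp: s fun_eq_iff)
      moreover have "run (move (m + 1) 0) (s(m + 1 := rev ?e, 0 := [])) (5 * tsize (e x) + 1) s"
        by (rule run_weaken[OF run_move]) (auto simp: s s0 fun_eq_iff)
      ultimately have "run (?R c) (s(m := ?e, 0 := ?t))
         (3 * tsize (t x) + 1 + (5 * tsize (e x) + 1 + (5 * tsize (e x) + 1 + b'))) s'"
        using that by (blast intro: run_Seq)
      then show ?thesis by (rule run_weaken) auto
    qed
    show "run ?P s (?b x) (s(0 := word (if t x = Tip then g x else f x)))"
    proof (rule run_weaken[OF run_Seq[OF r1 run_Seq[OF r2 run_If]]])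
      assume "is_sym Item (top_sym ((s(m := ?e, 0 := ?t)) 0))"
      then have "t x \<noteq> Tip" by (simp add: top_sym_word split: if_splits)
      then show "run (?R cf) (s(m := ?e, 0 := ?t))
          (3 * tsize (t x) + 10 * tsize (e x) + 3 + (if t x = Tip then bg x else bf x))
          (s(0 := word (if t x = Tip then g x else f x)))"
        using f(3)[of x s] x s0 s by (intro R) (auto simp: m_def)
    next
      assume "\<not> is_sym Item (top_sym ((s(m := ?e, 0 := ?t)) 0))"
      then have "t x = Tip" by (simp add: top_sym_word split: if_splits)
      then show "run (?R cg) (s(m := ?e, 0 := ?t))
          (3 * tsize (t x) + 10 * tsize (e x) + 3 + (if t x = Tip then bg x else bf x))
          (s(0 := word (if t x = Tip then g x else f x)))"
        using g(3)[of x s] x s0 s by (intro R) (auto simp: m_def)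
    qed auto
  qed simp
qed

text \<open>The letters of the clock word form a unary loop counter. Polynomially bounded steps
  alone are not enough, as repeated squaring of the size shows; therefore one polynomial
  \<open>b\<close> has to bound all intermediate states.\<close>

lemma computes_iterate:
  assumes clock: "computes X e n" and init: "computes X e (\<lambda>x. st x 0)"
    and step: "computes {(x, i). x \<in> X \<and> i < tsize (n x)} (\<lambda>(x, i). st x i) (\<lambda>(x, i). st x (Suc i))"
    and bound: "poly_bounded X (\<lambda>x. tsize (e x)) b"
      "\<And>x i. x \<in> X \<Longrightarrow> i \<le> tsize (n x) \<Longrightarrow> tsize (st x i) \<le> b x"
  shows "computes X e (\<lambda>x. st x (tsize (n x)))"
proof -
  from computes_Fork[OF clock init] obtain d l b0 where real_d: "realizes d l b0 X e (\<lambda>x. Fork (n x) (st x 0))"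
    by (auto simp: computes_def)
  note d = realizesD[OF real_d]
  from step obtain c k b1 where real_c:
    "realizes c k b1 {(x, i). x \<in> X \<and> i < tsize (n x)} (\<lambda>(x, i). st x i) (\<lambda>(x, i). st x (Suc i))"
    by (auto simp: computes_def)
  have c: "0 < k"
    "poly_bounded {(x, i). x \<in> X \<and> i < tsize (n x)} (\<lambda>z. tsize (case z of (x, i) \<Rightarrow> st x i)) b1"
    "\<And>x i s. x \<in> X \<Longrightarrow> i < tsize (n x) \<Longrightarrow> s 0 = word (st x i) \<Longrightarrow>
       (\<And>i. 0 < i \<Longrightarrow> i < k \<Longrightarrow> s i = []) \<Longrightarrow> run c s (b1 (x, i)) (s(0 := word (st x (Suc i))))"
    using real_c by (auto simp: realizes_def)
  from c(2) obtain p where p: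
    "\<And>x i. x \<in> X \<Longrightarrow> i < tsize (n x) \<Longrightarrow> b1 (x, i) \<le> poly p (tsize (st x i))"
    by (auto simp: poly_bounded_def)
  let ?L = "While_top k nonblank (Pop k ;; c)"
  \<comment> \<open>With \<open>j\<close> letters of the clock left, \<open>tsize (n x) - j\<close>
    iterations have been done.\<close>
  have loop: "run ?L s (Suc j * (3 + poly p (b x))) (s(k := [], 0 := word (st x (tsize (n x)))))"
    if "x \<in> X" "length (s k) = j" "j \<le> tsize (n x)" "s 0 = word (st x (tsize (n x) - j))"
      "\<And>i. 0 < i \<Longrightarrow> i < k \<Longrightarrow> s i = []" for j x s
    using that(2-)
  proof (induction j arbitrary: s)
    case 0
    then show ?case
      by (intro run_weaken[OF run_While_False]) (auto simp: fun_eq_iff)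
  next
    case (Suc j)
    let ?i = "tsize (n x) - Suc j"
    have i: "Suc ?i = tsize (n x) - j" "?i < tsize (n x)"
      using Suc.prems(2) by auto
    have "run c (s(k := tl (s k))) (b1 (x, ?i)) (s(k := tl (s k), 0 := word (st x (Suc ?i))))"
      by (rule c(3)[OF \<open>x \<in> X\<close>]) (use Suc.prems i c(1) in auto)
    moreover have "b1 (x, ?i) \<le> poly p (b x)"
      using p[OF \<open>x \<in> X\<close> i(2)] bound(2)[OF \<open>x \<in> X\<close>, of ?i]
      by (meson poly_nat_mono i(2) less_imp_le order_trans)
    ultimately have "run (Pop k ;; c) s (1 + poly p (b x)) (s(k := tl (s k), 0 := word (st x (Suc ?i))))"
      by (intro run_Seq[OF run_Pop]) (rule run_weaken, auto)
    moreover have "run ?L (s(k := tl (s k), 0 := word (st x (Suc ?i)))) (Suc j * (3 + poly p (b x)))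
        (s(k := [], 0 := word (st x (tsize (n x)))))"
      by (rule run_weaken[OF Suc.IH]) (use Suc.prems i c(1) in \<open>auto simp: fun_eq_iff\<close>)
    moreover have "nonblank (top_sym (s k))"
      using Suc.prems(1) by auto
    ultimately have "run ?L s (2 + (1 + poly p (b x)) + Suc j * (3 + poly p (b x)))
       (s(k := [], 0 := word (st x (tsize (n x)))))"
      by (intro run_While_True)
    then show ?case by (rule run_weaken) auto
  qed
  define m where "m = max k l"
  let ?P = "d ;; Pop 0 ;; split_word 0 (m + 1) k ;; move (m + 1) k ;; ?L"
  let ?b = "\<lambda>x. b0 x + 100 * tsize (n x) + 100 + (tsize (n x) + 1) * (3 + poly p (b x))"
  show ?thesis
  proof (rule computesI[where k = "m + 2" and c = ?P and b = ?b])
    have "poly_bounded X (\<lambda>x. tsize (e x)) (\<lambda>x. poly p (b x))"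
      using bound(1) by (rule poly_bounded_trans) (auto simp: poly_bounded_def)
    then show "poly_bounded X (\<lambda>x. tsize (e x)) ?b"
      by (intro poly_bounded_intros d(2) computes_size[OF clock])
    fix x and s :: "letter store"
    assume x: "x \<in> X" and s0: "s 0 = word (e x)" and s: "\<And>i. 0 < i \<Longrightarrow> i < m + 2 \<Longrightarrow> s i = []"
    let ?n = "word (n x)" and ?s = "word (st x 0)"
    have [simp]: "k \<noteq> 0" "0 \<noteq> k" "0 < m" "k \<noteq> Suc m" "s k = []"
      using c(1) s by (auto simp: m_def)
    have r0: "run d s (b0 x) (s(0 := word (Fork (n x) (st x 0))))"
      by (rule d(3)[OF x]) (auto simp: s0 s m_def)
    have r1: "run (Pop 0) (s(0 := word (Fork (n x) (st x 0)))) 1 (s(0 := ?n @ ?s))"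
      by (rule run_weaken[OF run_Pop]) auto
    have r2: "run (split_word 0 (m + 1) k) (s(0 := ?n @ ?s)) (9 * tsize (n x) + 3)
        (s(0 := ?s, m + 1 := rev ?n))"
      by (rule run_weaken[OF run_split_word[where xs = ?s]]) (auto simp: s)
    have r3: "run (move (m + 1) k) (s(0 := ?s, m + 1 := rev ?n)) (5 * tsize (n x) + 1)
        (s(0 := ?s, k := ?n))"
      by (rule run_weaken[OF run_move]) (auto simp: s fun_eq_iff)
    have r4: "run ?L (s(0 := ?s, k := ?n)) (Suc (tsize (n x)) * (3 + poly p (b x)))
        (s(0 := word (st x (tsize (n x)))))"
      by (rule run_weaken[OF loop[OF x, where j = "tsize (n x)"]])
        (auto simp: s fun_eq_iff m_def)
    show "run ?P s (?b x) (s(0 := word (st x (tsize (n x)))))"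
      by (rule run_weaken[OF run_Seq[OF r0 run_Seq[OF r1 run_Seq[OF r2 run_Seq[OF r3 r4]]]]]) auto
  qed simp
qed

text \<open>Mismatches leave marks on stack 3 instead of ending the loop, so stack 0 is always
  consumed. If stack 2 runs out first, its top is \<open>Blank\<close> and also counts as a
  mismatch.\<close>

definition compare_loop :: "letter com" where
  "compare_loop = While_top 0 nonblank
     (If_top 0 (is_sym Item) (If_top 2 (is_sym Item) Skip (Push 3 Item))
        (If_top 2 (is_sym Stop) Skip (Push 3 Item)) ;; Pop 0 ;; Pop 2)"

lemma run_compare_loop:
  assumes "set (s 0) \<subseteq> {Item, Stop}"
  shows "\<exists>m. run compare_loop s (10 * length (s 0) + 1)
      (s(0 := [], 2 := drop (length (s 0)) (s 2), 3 := replicate m Item @ s 3)) \<and>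
    (m = 0 \<longleftrightarrow> take (length (s 0)) (s 2) = s 0) \<and> m \<le> length (s 0)"
  using assms
proof (induction "s 0" arbitrary: s)
  case Nil
  then show ?case
    unfolding compare_loop_def
    by (intro exI[of _ 0] conjI run_weaken[OF run_While_False]) (auto simp: fun_eq_iff)
next
  case (Cons a as)
  let ?B = "If_top 0 (is_sym Item) (If_top 2 (is_sym Item) Skip (Push 3 Item))
        (If_top 2 (is_sym Stop) Skip (Push 3 Item)) ;; Pop 0 ;; Pop 2"
  define eq where "eq \<longleftrightarrow> top_sym (s 2) = Inp a"
  define s' where "s' = s(0 := as, 2 := tl (s 2), 3 := if eq then s 3 else Item # s 3)"
  have a: "a = Item \<or> a = Stop"
    using Cons.prems by (auto simp flip: Cons.hyps(2))
  have cmp: "run (If_top 0 (is_sym Item) (If_top 2 (is_sym Item) Skip (Push 3 Item))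
        (If_top 2 (is_sym Stop) Skip (Push 3 Item))) s (2 + 2 + 2)
      (s(3 := if eq then s 3 else Item # s 3))"
    by (intro run_If run_weaken[OF run_Skip] run_weaken[OF run_Push])
      (use a in \<open>auto simp: eq_def fun_eq_iff simp flip: Cons.hyps(2)\<close>)
  have body: "run ?B s (6 + (1 + 1)) s'"
    by (rule run_weaken[OF run_Seq[OF cmp run_Seq[OF run_Pop run_Pop]]])
      (auto simp: s'_def fun_eq_iff simp flip: Cons.hyps(2))
  have "as = s' 0" "set (s' 0) \<subseteq> {Item, Stop}"
    using Cons.prems by (simp_all add: s'_def flip: Cons.hyps(2))
  from Cons.hyps(1)[of s', OF this] obtain m where m: "run compare_loop s' (10 * length as + 1)
      (s'(0 := [], 2 := drop (length as) (s' 2), 3 := replicate m Item @ s' 3))"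
    "m = 0 \<longleftrightarrow> take (length as) (s' 2) = as" "m \<le> length as"
    by (auto simp: s'_def)
  define m' where "m' = (if eq then m else Suc m)"
  have "run compare_loop s (2 + (6 + (1 + 1)) + (10 * length as + 1))
      (s'(0 := [], 2 := drop (length as) (s' 2), 3 := replicate m Item @ s' 3))"
    using m(1) unfolding compare_loop_def
    by (intro run_While_True[OF _ body]) (auto simp flip: Cons.hyps(2))
  then have "run compare_loop s (10 * length (s 0) + 1)
      (s(0 := [], 2 := drop (length (s 0)) (s 2), 3 := replicate m' Item @ s 3))"
    by (rule run_weaken) (auto simp: s'_def m'_def fun_eq_iff drop_Suc replicate_app_Cons_same
        simp flip: Cons.hyps(2))
  moreover have "m' = 0 \<longleftrightarrow> take (length (s 0)) (s 2) = s 0"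
    using m(2) by (cases "s 2") (auto simp: m'_def eq_def s'_def simp flip: Cons.hyps(2))
  moreover have "m' \<le> length (s 0)"
    using m(3) by (auto simp: m'_def simp flip: Cons.hyps(2))
  ultimately show ?case by blast
qed

lemma computes_eq:
  assumes "computes X e f" "computes X e g"
  shows "computes X e (\<lambda>x. if f x = g x then Fork Tip Tip else Tip)"
proof (rule computes_comp[OF computes_Fork[OF assms]])
  let ?T = "Push 0 Stop ;; Push 0 Stop ;; Push 0 Item" and ?F = "clear 3 ;; Push 0 Stop"
  let ?P = "Pop 0 ;; split_word 0 1 3 ;; move 1 2 ;; compare_loop ;;
     If_top 2 nonblank (Push 3 Item ;; clear 2) Skip ;; If_top 3 nonblank ?F ?T"
  let ?b = "\<lambda>x. 100 * tsize (Fork (f x) (g x)) + 100"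
  show "computes X (\<lambda>x. Fork (f x) (g x)) (\<lambda>x. if f x = g x then Fork Tip Tip else Tip)"
  proof (rule computesI[where k = 4 and c = ?P and b = ?b])
    fix x and s :: "letter store"
    assume s0: "s 0 = word (Fork (f x) (g x))" and s: "\<And>i. 0 < i \<Longrightarrow> i < 4 \<Longrightarrow> s i = []"
    let ?f = "word (f x)" and ?g = "word (g x)"
    have [simp]: "s (Suc 0) = []" "s 2 = []" "s 3 = []" using s by auto
    have r1: "run (Pop 0) s 1 (s(0 := ?f @ ?g))"
      by (rule run_weaken[OF run_Pop]) (auto simp: s0)
    have r2: "run (split_word 0 1 3) (s(0 := ?f @ ?g)) (9 * tsize (f x) + 3)
        (s(0 := ?g, 1 := rev ?f))"
      by (rule run_weaken[OF run_split_word[where xs = ?g]]) auto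
    have r3: "run (move 1 2) (s(0 := ?g, 1 := rev ?f)) (5 * tsize (f x) + 1) (s(0 := ?g, 2 := ?f))"
      by (rule run_weaken[OF run_move]) (auto simp: fun_eq_iff)
    from run_compare_loop[of "s(0 := ?g, 2 := ?f)"] set_word[of "g x"] obtain m where m:
      "run compare_loop (s(0 := ?g, 2 := ?f)) (10 * tsize (g x) + 1)
        (s(0 := [], 2 := drop (tsize (g x)) ?f, 3 := replicate m Item))"
      "m = 0 \<longleftrightarrow> take (tsize (g x)) ?f = ?g" "m \<le> tsize (g x)"
      by (auto simp: fun_upd_twist)
    \<comment> \<open>Letters remaining on stack 2 contribute one more mark.\<close>
    define j where "j = (if drop (tsize (g x)) ?f = [] then m else Suc m)"
    have j: "j = 0 \<longleftrightarrow> f x = g x"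
    proof -
      have "take (length ?g) ?f = ?g \<and> drop (length ?g) ?f = [] \<longleftrightarrow> ?f = ?g"
        by (metis append.right_neutral append_take_drop_id drop_eq_Nil order_refl take_all)
      then show ?thesis
        using m(2) by (auto simp: j_def)
    qed
    have r5: "run (If_top 2 nonblank (Push 3 Item ;; clear 2) Skip)
      (s(0 := [], 2 := drop (tsize (g x)) ?f, 3 := replicate m Item))
      (2 + (3 * tsize (f x) + 1) + 2) (s(0 := [], 3 := replicate j Item))"
      by (intro run_If run_weaken[OF run_Seq[OF run_Push run_clear]] run_weaken[OF run_Skip])
        (auto simp: j_def fun_eq_iff)
    have r6: "run (If_top 3 nonblank ?F ?T) (s(0 := [], 3 := replicate j Item))
      (3 * tsize (g x) + 10 + 2) (s(0 := word (if f x = g x then Fork Tip Tip else Tip)))"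
      by (intro run_If run_weaken[OF run_Seq[OF run_clear run_Push]]
          run_weaken[OF run_Seq[OF run_Push run_Seq[OF run_Push run_Push]]])
        (use j m(3) in \<open>auto simp: j_def fun_eq_iff split: if_splits\<close>)
    show "run ?P s (?b x) (s(0 := word (if f x = g x then Fork Tip Tip else Tip)))"
      by (rule run_weaken[OF run_Seq[OF r1 run_Seq[OF r2 run_Seq[OF r3 run_Seq[OF m(1)
          run_Seq[OF r5 r6]]]]]]) auto
  qed (rule poly_bounded_intros | simp)+
qed

section \<open>Polynomial-time functions on structured data\<close>

text \<open>Injectivity makes the comparison of trees decide equality of data.\<close>

class data =
  fixes tree_of :: "'a \<Rightarrow> tree"
  assumes tree_of_inject: "tree_of x = tree_of y \<Longrightarrow> x = y"

lemma tree_of_eq_iff [simp]: "tree_of x = tree_of y \<longleftrightarrow> x = y"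
  using tree_of_inject by blast

instantiation bool :: data
begin

text \<open>Only \<open>False\<close> becomes \<open>Tip\<close>, the value that
  \<open>computes_If\<close> tests for.\<close>

definition tree_of_bool :: "bool \<Rightarrow> tree" where
  "tree_of_bool b = (if b then Fork Tip Tip else Tip)"

instance by standard (auto simp: tree_of_bool_def split: if_splits)

end

instantiation letter :: data
begin

fun tree_of_letter :: "letter \<Rightarrow> tree" where
  "tree_of_letter (Bit b) = Fork (Fork Tip Tip) (tree_of b)"
| "tree_of_letter Item = Fork Tip Tip"
| "tree_of_letter Stop = Tip"

instance
proof
  show "tree_of x = tree_of y \<Longrightarrow> x = y" for x y :: letter
    by (cases x; cases y) auto
qed

end

instantiation prod :: (data, data) data
begin

definition tree_of_prod :: "'a \<times> 'b \<Rightarrow> tree" where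
  "tree_of_prod p = Fork (tree_of (fst p)) (tree_of (snd p))"

instance by standard (auto simp: tree_of_prod_def prod_eq_iff)

end

instantiation list :: (data) data
begin

fun tree_of_list :: "'a list \<Rightarrow> tree" where
  "tree_of_list [] = Tip"
| "tree_of_list (x # xs) = Fork (tree_of x) (tree_of_list xs)"

instance
proof
  show "tree_of xs = tree_of ys \<Longrightarrow> xs = ys" for xs ys :: "'a list"
  proof (induction xs arbitrary: ys)
    case Nil
    then show ?case by (cases ys) auto
  next
    case (Cons x xs)
    then show ?case by (cases ys) auto
  qed
qed

end

section \<open>Sizes of structured data\<close>

definition datasize :: "'a::data \<Rightarrow> nat" where
  "datasize x = tsize (tree_of x)"

lemma datasize_simps [simp]:
  "datasize True = 3" "datasize False = 1"
  "datasize Item = 3" "datasize Stop = 1" "datasize (Bit u) = 4 + datasize u"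
  "datasize (a, b) = 1 + datasize a + datasize b"
  "datasize [] = 1" "datasize (x # xs) = 1 + datasize x + datasize xs"
  by (simp_all add: datasize_def tree_of_bool_def tree_of_prod_def)

lemma datasize_bool_le: "datasize (b :: bool) \<le> 3"
  by (cases b) auto

lemma datasize_letter_le: "datasize (x :: letter) \<le> 7"
  by (cases x) (use datasize_bool_le in \<open>auto intro: order_trans[OF add_left_mono]\<close>)

lemma datasize_pos: "1 \<le> datasize x"
  unfolding datasize_def by (cases "tree_of x") auto

lemma datasize_append [simp]: "datasize (xs @ ys) + 1 = datasize xs + datasize ys"
  by (induction xs) auto

lemma datasize_rev [simp]: "datasize (rev xs) = datasize xs"
proof (induction xs)
  case (Cons x xs)
  then show ?case using datasize_append[of "rev xs" "[x]"] by simp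
qed simp

lemma datasize_take_le: "datasize (take n xs) \<le> datasize xs"
  using datasize_append[of "take n xs" "drop n xs"] datasize_pos[of "drop n xs"]
  unfolding append_take_drop_id by linarith

lemma datasize_drop_le: "datasize (drop n xs) \<le> datasize xs"
  using datasize_append[of "take n xs" "drop n xs"] datasize_pos[of "take n xs"]
  unfolding append_take_drop_id by linarith

lemma length_le_datasize: "length xs \<le> datasize xs"
  by (induction xs) auto

lemma datasize_element_le: "x \<in> set xs \<Longrightarrow> datasize x \<le> datasize xs"
  by (induction xs) auto

section \<open>Polynomial-time functions: composition, pairs, branching and case
  distinctions\<close>

definition polysize :: "('a::data \<Rightarrow> nat) \<Rightarrow> bool" where
  "polysize n \<longleftrightarrow> poly_bounded UNIV datasize n"

definition polytime :: "('a::data \<Rightarrow> 'b::data) \<Rightarrow> bool" where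
  "polytime f \<longleftrightarrow> computes UNIV tree_of (\<lambda>x. tree_of (f x))"

lemma polytime_datasize: "polytime f \<Longrightarrow> polysize (\<lambda>x. datasize (f x))"
  using computes_size[of UNIV tree_of "\<lambda>x. tree_of (f x)"]
  by (simp add: polytime_def polysize_def datasize_def[abs_def])

lemma polysize_const: "polysize (\<lambda>_. c)"
  and polysize_add: "polysize m \<Longrightarrow> polysize n \<Longrightarrow> polysize (\<lambda>x. m x + n x)"
  and polysize_mult: "polysize m \<Longrightarrow> polysize n \<Longrightarrow> polysize (\<lambda>x. m x * n x)"
  unfolding polysize_def by (intro poly_bounded_intros; assumption)+

lemmas polysize_intros = polysize_const polysize_add polysize_mult polytime_datasize

lemma polytime_id: "polytime (\<lambda>x. x)"
  unfolding polytime_def by (rule computes_id)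

lemma computes_polytime:
  assumes "polytime g" "computes X e (\<lambda>x. tree_of (f x))"
  shows "computes X e (\<lambda>x. tree_of (g (f x)))"
  using assms(2)
proof (rule computes_comp)
  from assms(1) show "computes X (\<lambda>x. tree_of (f x)) (\<lambda>x. tree_of (g (f x)))"
    unfolding polytime_def by (rule computes_reindex) auto
qed

lemma polytime_comp: "polytime g \<Longrightarrow> polytime f \<Longrightarrow> polytime (\<lambda>x. g (f x))"
  using computes_polytime unfolding polytime_def by fastforce

lemma polytime_const: "polytime (\<lambda>_ :: 'a::data. c)"
proof -
  have "computes UNIV e (\<lambda>_. t)" for e :: "'a \<Rightarrow> tree" and t
    by (induction t) (auto intro: computes_Tip computes_Fork)
  then show ?thesis unfolding polytime_def by blast
qed

lemma polytime_Pair: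
  assumes "polytime f" "polytime g"
  shows "polytime (\<lambda>x. (f x, g x))"
  using computes_Fork[OF assms[unfolded polytime_def]]
  by (simp add: polytime_def tree_of_prod_def)

lemma polytime_fst: "polytime f \<Longrightarrow> polytime (\<lambda>x. fst (f x))"
  using computes_car[of UNIV tree_of "\<lambda>x. tree_of (f x)"]
  by (simp add: polytime_def tree_of_prod_def)

lemma polytime_snd: "polytime f \<Longrightarrow> polytime (\<lambda>x. snd (f x))"
  using computes_cdr[of UNIV tree_of "\<lambda>x. tree_of (f x)"]
  by (simp add: polytime_def tree_of_prod_def)

lemma polytime_comp2:
  "polytime (\<lambda>z. h (fst z) (snd z)) \<Longrightarrow> polytime f \<Longrightarrow> polytime g \<Longrightarrow> polytime (\<lambda>x. h (f x) (g x))"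
  using polytime_comp[of "\<lambda>z. h (fst z) (snd z)" "\<lambda>x. (f x, g x)"] polytime_Pair[of f g] by simp

lemma polytime_If:
  assumes "polytime b" "polytime f" "polytime g"
  shows "polytime (\<lambda>x. if b x then f x else g x)"
proof -
  have "computes UNIV tree_of (\<lambda>x. if tree_of (b x) = Tip then tree_of (g x) else tree_of (f x))"
    by (rule computes_If) (use assms in \<open>auto simp: polytime_def intro: computes_subset\<close>)
  then show ?thesis
    unfolding polytime_def by (rule computes_cong) (auto simp: tree_of_bool_def)
qed

lemma polytime_not: "polytime b \<Longrightarrow> polytime (\<lambda>x. \<not> b x)"
  using polytime_If[of b "\<lambda>_. False" "\<lambda>_. True"]
  by (simp add: polytime_const if_bool_eq_conj cong: if_cong)

lemma polytime_conj: "polytime b \<Longrightarrow> polytime c \<Longrightarrow> polytime (\<lambda>x. b x \<and> c x)"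
  using polytime_If[of b c "\<lambda>_. False"] by (simp add: polytime_const if_bool_eq_disj)

lemma polytime_disj: "polytime b \<Longrightarrow> polytime c \<Longrightarrow> polytime (\<lambda>x. b x \<or> c x)"
  using polytime_not[OF polytime_conj[OF polytime_not polytime_not], of b c] by simp

lemma polytime_eq:
  assumes "polytime f" "polytime g"
  shows "polytime (\<lambda>x. f x = g x)"
  using computes_eq[OF assms[unfolded polytime_def]]
  by (simp add: polytime_def tree_of_bool_def)

lemma polytime_Cons:
  assumes "polytime f" "polytime g"
  shows "polytime (\<lambda>x. f x # g x)"
  using computes_Fork[OF assms[unfolded polytime_def]] by (simp add: polytime_def)

lemma polytime_case_list:
  assumes l: "polytime l" and f: "polytime f"
    and g: "polytime (\<lambda>z. g (fst z) (fst (snd z)) (snd (snd z)))"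
  shows "polytime (\<lambda>x. case l x of [] \<Rightarrow> f x | y # ys \<Rightarrow> g x y ys)"
proof -
  let ?X = "{x. tree_of (l x) \<noteq> Tip}"
  have ne: "tree_of (l x) \<noteq> Tip \<longleftrightarrow> l x \<noteq> []" for x
    by (cases "l x") auto
  have l': "computes ?X tree_of (\<lambda>x. tree_of (l x))"
    using l unfolding polytime_def by (rule computes_subset) auto
  have "computes ?X tree_of (\<lambda>x. Fork (tree_of x) (Fork (car (tree_of (l x))) (cdr (tree_of (l x)))))"
    by (intro computes_Fork computes_id computes_car computes_cdr l')
  \<comment> \<open>A nonempty list and the pair of its head and tail have the same tree, so
    \<open>car\<close> and \<open>cdr\<close> deliver both components.\<close>
  then have "computes ?X tree_of (\<lambda>x. tree_of (x, hd (l x), tl (l x)))"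
    by (rule computes_cong) (auto simp: ne neq_Nil_conv tree_of_prod_def)
  from computes_polytime[OF g this] have "computes ?X tree_of (\<lambda>x. tree_of (g x (hd (l x)) (tl (l x))))"
    by simp
  moreover have "computes {x. tree_of (l x) = Tip} tree_of (\<lambda>x. tree_of (f x))"
    using f unfolding polytime_def by (rule computes_subset) auto
  ultimately have "computes UNIV tree_of
      (\<lambda>x. if tree_of (l x) = Tip then tree_of (f x) else tree_of (g x (hd (l x)) (tl (l x))))"
    using l by (intro computes_If) (auto simp: polytime_def)
  then show ?thesis
    unfolding polytime_def by (rule computes_cong) (auto split: list.split)
qed

lemma polytime_case_letter:
  assumes "polytime l" "polytime (\<lambda>z. f (fst z) (snd z))" "polytime g" "polytime h"
  shows "polytime (\<lambda>x. case l x of Bit b \<Rightarrow> f x b | Item \<Rightarrow> g x | Stop \<Rightarrow> h x)"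
proof -
  \<comment> \<open>In the remaining case the digit is recovered by comparing the letter with
    \<open>Bit True\<close>.\<close>
  have "polytime (\<lambda>x. if l x = Stop then h x else if l x = Item then g x else f x (l x = Bit True))"
    by (intro polytime_If polytime_eq polytime_const assms polytime_comp2[OF assms(2)] polytime_id)
  also have "(\<lambda>x. if l x = Stop then h x else if l x = Item then g x else f x (l x = Bit True)) =
      (\<lambda>x. case l x of Bit b \<Rightarrow> f x b | Item \<Rightarrow> g x | Stop \<Rightarrow> h x)"
    by (auto simp: fun_eq_iff split: letter.split)
  finally show ?thesis .
qed

lemma polytime_tl: "polytime l \<Longrightarrow> polytime (\<lambda>x. tl (l x))"
  using polytime_case_list[of l "\<lambda>_. []" "\<lambda>_ _ ys. ys"]
  by (simp add: polytime_const polytime_snd polytime_id tl_def)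

section \<open>Folds over lists and the list functions they express\<close>

lemma polytime_foldl:
  assumes h: "polytime (\<lambda>z. h (fst z) (fst (snd z)) (snd (snd z)))"
    and l: "polytime l" and a: "polytime a"
    and b: "polysize b" "\<And>x n. datasize (foldl (h x) (a x) (take n (l x))) \<le> b x"
  shows "polytime (\<lambda>x. foldl (h x) (a x) (l x))"
proof -
  \<comment> \<open>The state consists of the parameter, the unread list and the accumulator. The
    clock is the tree of the list, whose size is at least the length of the list; surplus iterations
    do nothing because \<open>S\<close> fixes states with an empty unread list.\<close>
  define S where "S z = (case fst (snd z) of [] \<Rightarrow> z
    | y # ys \<Rightarrow> (fst z, ys, h (fst z) (snd (snd z)) y))" for z
  define st where "st x i = (S ^^ i) (x, l x, a x)" for x i
  have st_eq: "st x i = (x, drop i (l x), foldl (h x) (a x) (take i (l x)))" for x i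
  proof (induction i)
    case (Suc i)
    show ?case
    proof (cases "drop i (l x)")
      case Nil
      then show ?thesis using Suc by (simp add: st_def S_def)
    next
      case (Cons y ys)
      then have "i < length (l x)" "y = l x ! i" "ys = drop (Suc i) (l x)"
        by (simp_all add: not_le[symmetric] nth_via_drop drop_Suc tl_drop)
         (metis drop_eq_Nil list.discI not_le, metis list.sel(3) tl_drop)
      then show ?thesis
        using Suc Cons by (simp add: st_def S_def take_Suc_conv_app_nth)
    qed
  qed (simp add: st_def)
  have "polytime (\<lambda>z. h (fst (fst z)) (snd (snd (fst z))) (fst (snd z)))"
    using polytime_comp[OF h, of "\<lambda>z. (fst (fst z), snd (snd (fst z)), fst (snd z))"]
    by (simp add: polytime_Pair polytime_fst polytime_snd polytime_id)
  then have S: "polytime S"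
    unfolding S_def[abs_def]
    by (intro polytime_case_list polytime_Pair polytime_fst polytime_snd polytime_id)
  have "computes UNIV tree_of (\<lambda>x. tree_of (st x (tsize (tree_of (l x)))))"
  proof (rule computes_iterate[where b = "\<lambda>x. 2 + datasize x + datasize (l x) + b x"])
    have "polytime (\<lambda>x. st x 0)"
      unfolding st_def by (simp add: polytime_Pair polytime_id l a)
    then show "computes UNIV tree_of (\<lambda>x. tree_of (st x 0))"
      by (simp add: polytime_def)
    show "computes {(x, i). x \<in> UNIV \<and> i < tsize (tree_of (l x))} (\<lambda>(x, i). tree_of (st x i))
        (\<lambda>(x, i). tree_of (st x (Suc i)))"
      using S unfolding polytime_def
      by (rule computes_reindex[where h = "\<lambda>(x, i). st x i"]) (auto simp: st_def)
    have "polysize (\<lambda>x. 2 + datasize x + datasize (l x) + b x)"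
      by (intro polysize_intros b(1) l polytime_id)
    then show "poly_bounded UNIV (\<lambda>x. tsize (tree_of x)) (\<lambda>x. 2 + datasize x + datasize (l x) + b x)"
      by (simp add: polysize_def datasize_def[abs_def])
    show "tsize (tree_of (st x i)) \<le> 2 + datasize x + datasize (l x) + b x" for x i
      using b(2)[of x i] datasize_drop_le[of i "l x"]
      by (simp add: st_eq flip: datasize_def)
  qed (use l in \<open>simp add: polytime_def\<close>)
  then have "polytime (\<lambda>x. st x (tsize (tree_of (l x))))"
    by (simp add: polytime_def)
  then have "polytime (\<lambda>x. snd (snd (st x (tsize (tree_of (l x))))))"
    by (intro polytime_snd)
  moreover have "take (tsize (tree_of (l x))) (l x) = l x" for x
    using length_le_datasize[of "l x"] by (simp add: datasize_def)
  ultimately show ?thesis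
    by (simp add: st_eq)
qed

lemma polytime_rev:
  assumes "polytime l"
  shows "polytime (\<lambda>x. rev (l x))"
proof -
  have rev: "foldl (\<lambda>a y. y # a) [] xs = rev xs" for xs :: "'c list"
    by (induction xs rule: rev_induct) auto
  have "polytime (\<lambda>x. foldl (\<lambda>a y. y # a) [] (l x))"
    by (rule polytime_foldl[where b = "\<lambda>x. datasize (l x)"])
      (auto simp: rev datasize_take_le
        intro!: polytime_Cons polytime_fst polytime_snd polytime_id polytime_const assms
          polytime_datasize)
  then show ?thesis by (simp add: rev)
qed

lemma polytime_foldr:
  assumes h: "polytime (\<lambda>z. h (fst z) (fst (snd z)) (snd (snd z)))"
    and l: "polytime l" and a: "polytime a"
    and b: "polysize b" "\<And>x n. datasize (foldr (h x) (drop n (l x)) (a x)) \<le> b x"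
  shows "polytime (\<lambda>x. foldr (h x) (l x) (a x))"
proof -
  have "polytime (\<lambda>z. h (fst z) (snd (snd z)) (fst (snd z)))"
    using polytime_comp[OF h, of "\<lambda>z. (fst z, snd (snd z), fst (snd z))"]
    by (simp add: polytime_Pair polytime_fst polytime_snd polytime_id)
  then have "polytime (\<lambda>x. foldl (\<lambda>a y. h x y a) (a x) (rev (l x)))"
    by (rule polytime_foldl[OF _ polytime_rev[OF l] a b(1)])
      (use b(2) in \<open>simp add: take_rev foldr_conv_foldl\<close>)
  then show ?thesis by (simp add: foldr_conv_foldl)
qed

lemma polytime_append:
  assumes "polytime f" "polytime g"
  shows "polytime (\<lambda>x. f x @ g x)"
proof -
  have fold: "foldr (\<lambda>y a. y # a) xs ys = xs @ ys" for xs ys :: "'c list"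
    by (induction xs) auto
  have "datasize (drop n (f x) @ g x) \<le> datasize (f x) + datasize (g x)" for n x
    using datasize_append[of "drop n (f x)" "g x"] datasize_drop_le[of n "f x"] by linarith
  then have "polytime (\<lambda>x. foldr (\<lambda>y a. y # a) (f x) (g x))"
    by (intro polytime_foldr[where b = "\<lambda>x. datasize (f x) + datasize (g x)"])
      (auto simp: fold intro!: polytime_Cons polytime_fst polytime_snd polytime_id assms polysize_intros)
  then show ?thesis by (simp add: fold)
qed

lemma datasize_map_le:
  "(\<And>y. y \<in> set xs \<Longrightarrow> datasize (h y) \<le> c) \<Longrightarrow> datasize (map h xs) \<le> 1 + length xs * (1 + c)"
  by (induction xs) fastforce+

lemma datasize_filter_le: "datasize (filter P xs) \<le> datasize xs"
  by (induction xs) auto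

lemma polytime_map:
  assumes h: "polytime (\<lambda>z. h (fst z) (snd z))" and l: "polytime l"
  shows "polytime (\<lambda>x. map (h x) (l x))"
proof -
  have fold: "foldr (\<lambda>y a. h x y # a) ys [] = map (h x) ys" for x ys
    by (induction ys) auto
  from polytime_datasize[OF h] obtain p where p: "\<And>z. datasize (h (fst z) (snd z)) \<le> poly p (datasize z)"
    unfolding polysize_def poly_bounded_def by blast
  \<comment> \<open>An entry \<open>y\<close> of \<open>l x\<close> is no larger than
    \<open>l x\<close>, so monotonicity of \<open>p\<close> turns the bound for the pair
    \<open>(x, y)\<close> into one that does not depend on \<open>y\<close>.\<close>
  let ?c = "\<lambda>x. poly p (1 + datasize x + datasize (l x))"
  have c: "polysize ?c"
    unfolding polysize_def
  proof (rule poly_bounded_trans)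
    show "poly_bounded UNIV datasize (\<lambda>x. 1 + datasize x + datasize (l x))"
      using polysize_add[OF polysize_add[OF polysize_const polytime_datasize[OF polytime_id]]
          polytime_datasize[OF l]]
      unfolding polysize_def .
  qed (auto simp: poly_bounded_def)
  have bound: "datasize (map (h x) (drop n (l x))) \<le> 1 + datasize (l x) * (1 + ?c x)" for x n
  proof -
    have "datasize (h x y) \<le> ?c x" if "y \<in> set (drop n (l x))" for y
    proof -
      have "datasize y \<le> datasize (l x)"
        using that by (meson datasize_element_le in_set_dropD)
      then have "poly p (datasize (x, y)) \<le> ?c x"
        by (intro poly_nat_mono) simp
      with p[of "(x, y)"] show ?thesis by simp
    qed
    then have "datasize (map (h x) (drop n (l x))) \<le> 1 + length (drop n (l x)) * (1 + ?c x)"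
      by (rule datasize_map_le)
    also have "\<dots> \<le> 1 + datasize (l x) * (1 + ?c x)"
      using length_le_datasize[of "l x"] by (intro add_mono mult_mono) auto
    finally show ?thesis .
  qed
  have h': "polytime (\<lambda>z. h (fst z) (fst (snd z)))"
    using polytime_comp[OF h, of "\<lambda>z. (fst z, fst (snd z))"]
    by (simp add: polytime_Pair polytime_fst polytime_snd polytime_id)
  have "polytime (\<lambda>x. foldr (\<lambda>y a. h x y # a) (l x) [])"
    by (rule polytime_foldr[where b = "\<lambda>x. 1 + datasize (l x) * (1 + ?c x)"])
      (auto simp only: fold intro!: polytime_Cons polytime_const polytime_fst polytime_snd polytime_id
        l polysize_const polysize_add polysize_mult polytime_datasize c h' bound)
  then show ?thesis by (simp add: fold)
qed

lemma polytime_filter: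
  assumes P: "polytime (\<lambda>z. P (fst z) (snd z))" and l: "polytime l"
  shows "polytime (\<lambda>x. filter (P x) (l x))"
proof -
  have fold: "foldr (\<lambda>y a. if P x y then y # a else a) ys [] = filter (P x) ys" for x ys
    by (induction ys) auto
  have P': "polytime (\<lambda>z. P (fst z) (fst (snd z)))"
    using polytime_comp[OF P, of "\<lambda>z. (fst z, fst (snd z))"]
    by (simp add: polytime_Pair polytime_fst polytime_snd polytime_id)
  have "polytime (\<lambda>x. foldr (\<lambda>y a. if P x y then y # a else a) (l x) [])"
    by (rule polytime_foldr[where b = "\<lambda>x. datasize (l x)"])
      (auto simp only: fold intro!: polytime_If polytime_Cons polytime_const polytime_fst polytime_snd
        polytime_id l polytime_datasize P' order_trans[OF datasize_filter_le datasize_drop_le])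
  then show ?thesis by (simp add: fold)
qed

lemma polytime_Ball:
  assumes "polytime (\<lambda>z. P (fst z) (snd z))" "polytime l"
  shows "polytime (\<lambda>x. \<forall>y\<in>set (l x). P x y)"
proof -
  have "polytime (\<lambda>x. filter (\<lambda>y. \<not> P x y) (l x) = [])"
    by (intro polytime_eq polytime_filter polytime_not polytime_const assms)
  then show ?thesis by (simp add: filter_empty_conv)
qed

lemma polytime_Bex:
  assumes "polytime (\<lambda>z. P (fst z) (snd z))" "polytime l"
  shows "polytime (\<lambda>x. \<exists>y\<in>set (l x). P x y)"
  using polytime_not[OF polytime_Ball[OF polytime_not[OF assms(1)] assms(2)]] by simp

lemma polytime_member:
  assumes "polytime f" "polytime l"
  shows "polytime (\<lambda>x. f x \<in> set (l x))"
proof -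
  have "polytime (\<lambda>z. f (fst z) = snd z)"
    by (intro polytime_eq polytime_comp[OF assms(1)] polytime_fst polytime_snd polytime_id)
  from polytime_Bex[OF this assms(2)] show ?thesis by simp
qed

lemma datasize_concat_le: "datasize (concat (drop n xss)) \<le> datasize xss"
  for xss :: "'b::data list list"
proof -
  have "datasize (concat yss) \<le> datasize yss" for yss :: "'b::data list list"
  proof (induction yss)
    case (Cons ys yss)
    then show ?case using datasize_append[of ys "concat yss"] by simp
  qed simp
  then show ?thesis using datasize_drop_le order_trans by blast
qed

lemma polytime_concat:
  assumes "polytime l"
  shows "polytime (\<lambda>x. concat (l x))"
proof -
  have fold: "foldr (\<lambda>y a. y @ a) xss [] = concat xss" for xss :: "'c list list"
    by (induction xss) auto
  have "polytime (\<lambda>x. foldr (\<lambda>y a. y @ a) (l x) [])"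
    by (rule polytime_foldr[where b = "\<lambda>x. datasize (l x)"])
      (auto simp only: fold intro!: polytime_append polytime_const polytime_fst polytime_snd
        polytime_id assms polytime_datasize datasize_concat_le)
  then show ?thesis by (simp add: fold)
qed

lemmas polytime_basic_intros = polytime_id polytime_const polytime_fst polytime_snd polytime_Pair
  polytime_If polytime_not polytime_conj polytime_disj polytime_eq polytime_Cons polytime_tl
  polytime_case_list polytime_case_letter polytime_rev polytime_append polytime_map
  polytime_filter polytime_Ball polytime_Bex polytime_member polytime_concat

section \<open>Conversion of the input word, and membership in \<open>class_P\<close>\<close>

fun push_list :: "nat \<Rightarrow> 'a list \<Rightarrow> 'a com" where
  "push_list i [] = Skip"
| "push_list i (a # as) = push_list i as ;; Push i a"

lemma run_push_list: "run (push_list i as) s (2 * length as) (s(i := as @ s i))"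
proof (induction as)
  case Nil
  show ?case by (auto intro: run_weaken[OF run_Skip])
next
  case (Cons a as)
  from run_Seq[OF this run_Push[of i a]] show ?case
    unfolding push_list.simps by (rule run_weaken) auto
qed

text \<open>A stack can only be extended at its top, so the word of the list is built from its last
  entry backwards, on top of a final \<open>Stop\<close>. This is why the input is reversed onto
  stack 1 beforehand.\<close>

definition input_loop :: "letter com" where
  "input_loop = While_top 1 nonblank
     (If_top 1 (is_sym Stop) (push_list 0 (word (tree_of Stop)))
       (If_top 1 (is_sym Item) (push_list 0 (word (tree_of Item)))
         (If_top 1 (is_sym (Bit True)) (push_list 0 (word (tree_of (Bit True))))
           (push_list 0 (word (tree_of (Bit False)))))) ;;
      Push 0 Item ;; Pop 1)"

lemma word_tree_of_list:
  "word (tree_of xs) = concat (map (\<lambda>x. Item # word (tree_of x)) xs) @ [Stop]"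
  by (induction xs) auto

lemma run_input_loop:
  "run input_loop s (30 * length (s 1) + 1)
     (s(1 := [], 0 := concat (map (\<lambda>x. Item # word (tree_of x)) (rev (s 1))) @ s 0))"
proof (induction "s 1" arbitrary: s)
  case Nil
  then show ?case
    unfolding input_loop_def
    by (intro run_weaken[OF run_While_False]) (auto simp: fun_eq_iff)
next
  case (Cons a as)
  let ?s = "s(0 := Item # word (tree_of a) @ s 0, 1 := as)"
  \<comment> \<open>The tree of a letter has size at most 7, and each push takes two steps.\<close>
  have push: "run (push_list 0 (word (tree_of x))) s 14 (s(0 := word (tree_of x) @ s 0))" for x :: letter
    using datasize_letter_le[of x] by (intro run_weaken[OF run_push_list]) (auto simp: datasize_def)
  have s1: "s (Suc 0) = a # as"
    using Cons.hyps(2) by simp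
  have "run (If_top 1 (is_sym Stop) (push_list 0 (word (tree_of Stop)))
       (If_top 1 (is_sym Item) (push_list 0 (word (tree_of Item)))
         (If_top 1 (is_sym (Bit True)) (push_list 0 (word (tree_of (Bit True))))
           (push_list 0 (word (tree_of (Bit False))))))) s (14 + 2 + 2 + 2) (s(0 := word (tree_of a) @ s 0))"
    by (intro run_If run_weaken[OF push]) (cases a; auto simp: s1 simp del: word.simps)+
  then have "run (If_top 1 (is_sym Stop) (push_list 0 (word (tree_of Stop)))
       (If_top 1 (is_sym Item) (push_list 0 (word (tree_of Item)))
         (If_top 1 (is_sym (Bit True)) (push_list 0 (word (tree_of (Bit True))))
           (push_list 0 (word (tree_of (Bit False)))))) ;; Push 0 Item ;; Pop 1) s (20 + (2 + 1)) ?s"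
    by (intro run_weaken[OF run_Seq[OF _ run_Seq[OF run_Push run_Pop]]])
      (auto simp: fun_eq_iff s1)
  note body = this
  have "run input_loop ?s (30 * length as + 1)
     (s(1 := [], 0 := concat (map (\<lambda>x. Item # word (tree_of x)) (rev (s 1))) @ s 0))"
    by (rule run_weaken[OF Cons.hyps(1)]) (auto simp: fun_eq_iff s1)
  then have "run input_loop s (2 + (20 + (2 + 1)) + (30 * length as + 1))
     (s(1 := [], 0 := concat (map (\<lambda>x. Item # word (tree_of x)) (rev (s 1))) @ s 0))"
    unfolding input_loop_def by (intro run_While_True[OF _ body]) (auto simp: s1)
  then show ?case
    by (rule run_weaken) (auto simp: s1)
qed

theorem class_P_if_polytime:
  assumes "polytime (\<lambda>w :: letter list. w \<in> L)"
  shows "L \<in> class_P"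
proof -
  from assms obtain c k b where "realizes c k b UNIV (tree_of :: letter list \<Rightarrow> tree) (\<lambda>w. tree_of (w \<in> L))"
    by (auto simp: polytime_def computes_def)
  note c = realizesD[OF this]
  from c(2) obtain p where p: "\<And>w. b w \<le> poly p (datasize w)"
    by (auto simp: poly_bounded_def datasize_def)
  have size: "datasize w \<le> 1 + 8 * length w" for w :: "letter list"
  proof (induction w)
    case (Cons a w)
    then show ?case using datasize_letter_le[of a] by simp
  qed simp
  \<comment> \<open>With \<open>n\<close> the length of the input, the conversion takes at most
    \<open>35 * n + 4\<close> steps and the decision one more. The argument \<open>1 + 8 * n\<close>
    bounds the size of the converted list: at most 7 for each letter and 1 for its
    \<open>Fork\<close>.\<close>
  define q where "q = [:0, 35:] + [:5:] + pcompose p [:1, 8:]"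
  let ?P = "move 0 1 ;; Push 0 Stop ;; input_loop ;; c"
  let ?M = "machine ?P (is_sym Item)"
  have "decides_in_time ?M L (poly q)"
    unfolding decides_in_time_def
  proof
    fix w :: "letter list"
    let ?s = "\<lambda>i::nat. if i = 0 then w else []"
    have r1: "run (move 0 1) ?s (5 * length w + 1) (\<lambda>i. if i = 1 then rev w else [])"
      by (rule run_weaken[OF run_move]) (auto simp: fun_eq_iff)
    have r2: "run (Push 0 Stop) (\<lambda>i. if i = 1 then rev w else []) 2
        ((\<lambda>i. if i = 1 then rev w else [])(0 := [Stop]))"
      by (rule run_weaken[OF run_Push]) auto
    have r3: "run input_loop ((\<lambda>i. if i = 1 then rev w else [])(0 := [Stop])) (30 * length w + 1)
       (\<lambda>i. if i = 0 then word (tree_of w) else [])"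
      by (rule run_weaken[OF run_input_loop]) (auto simp: fun_eq_iff word_tree_of_list)
    have r4: "run c (\<lambda>i. if i = 0 then word (tree_of w) else []) (b w)
      ((\<lambda>i. if i = 0 then word (tree_of w) else [])(0 := word (tree_of (w \<in> L))))"
      by (rule c(3)) auto
    from run_Seq[OF r1 run_Seq[OF r2 run_Seq[OF r3 r4]]] obtain t where
      t: "t \<le> 5 * length w + 1 + (2 + (30 * length w + 1 + b w))" "exec ?P ?s t
      ((\<lambda>i. if i = 0 then word (tree_of w) else [])(0 := word (tree_of (w \<in> L))))"
      unfolding run_def by blast
    have "b w \<le> poly p (1 + 8 * length w)"
      using p[of w] poly_nat_mono[OF size] by (rule order_trans)
    with t(1) have "Suc t \<le> poly q (length w)"
      by (simp add: q_def poly_pcompose algebra_simps)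
    moreover from machine_run[OF t(2), of "is_sym Item"]
    have "fst ((tm_step ?M ^^ Suc t) (initial_config ?M w)) =
        (if w \<in> L then accept_state ?M else reject_state ?M)"
      by (simp add: top_sym_word tree_of_bool_def del: funpow.simps)
    ultimately show "\<exists>t\<le>poly q (length w). fst ((tm_step ?M ^^ t) (initial_config ?M w)) =
        (if w \<in> L then accept_state ?M else reject_state ?M)"
      by blast
  qed
  then show ?thesis
    unfolding class_P_def using turing_machine_machine by blast
qed

section \<open>Folds whose accumulator grows additively\<close>

lemma foldl_datasize_le:
  assumes "\<And>z y. datasize (h z y) \<le> datasize z + c + datasize y"
  shows "datasize (foldl h z ys) \<le> datasize z + length ys * c + datasize ys"
proof (induction ys arbitrary: z)
  case (Cons y ys)
  from Cons[of "h z y"] assms[of z y] show ?case by simp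
qed simp

lemma foldr_datasize_le:
  assumes "\<And>y z. datasize (h y z) \<le> datasize z + c + datasize y"
  shows "datasize (foldr h ys z) \<le> datasize z + length ys * c + datasize ys"
proof (induction ys)
  case (Cons y ys)
  from Cons assms[of y "foldr h ys z"] show ?case by simp
qed simp

text \<open>The sizes of the entries are charged once each and add up to at most the size of the
  list. The global size condition of \<open>polytime_foldl\<close> thus becomes a condition on a
  single step.\<close>

lemma polytime_foldl_additive:
  assumes "polytime (\<lambda>z. h (fst z) (fst (snd z)) (snd (snd z)))" "polytime l" "polytime a"
    and inc: "\<And>x z y. datasize (h x z y) \<le> datasize z + c + datasize y"
  shows "polytime (\<lambda>x. foldl (h x) (a x) (l x))"
proof (rule polytime_foldl[where b = "\<lambda>x. datasize (a x) + datasize (l x) * c + datasize (l x)"])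
  show "polysize (\<lambda>x. datasize (a x) + datasize (l x) * c + datasize (l x))"
    by (intro polysize_intros assms)
  fix x n
  have "length (take n (l x)) \<le> datasize (l x)"
    using length_le_datasize[of "l x"] by simp
  then have "length (take n (l x)) * c \<le> datasize (l x) * c"
    by (rule mult_le_mono1)
  with foldl_datasize_le[of "h x" c "a x" "take n (l x)", OF inc] datasize_take_le[of n "l x"]
  show "datasize (foldl (h x) (a x) (take n (l x))) \<le> datasize (a x) + datasize (l x) * c + datasize (l x)"
    by linarith
qed (rule assms)+

lemma polytime_foldr_additive:
  assumes "polytime (\<lambda>z. h (fst z) (fst (snd z)) (snd (snd z)))" "polytime l" "polytime a"
    and inc: "\<And>x y z. datasize (h x y z) \<le> datasize z + c + datasize y"
  shows "polytime (\<lambda>x. foldr (h x) (l x) (a x))"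
proof (rule polytime_foldr[where b = "\<lambda>x. datasize (a x) + datasize (l x) * c + datasize (l x)"])
  show "polysize (\<lambda>x. datasize (a x) + datasize (l x) * c + datasize (l x))"
    by (intro polysize_intros assms)
  fix x n
  have "length (drop n (l x)) \<le> datasize (l x)"
    using length_le_datasize[of "l x"] by simp
  then have "length (drop n (l x)) * c \<le> datasize (l x) * c"
    by (rule mult_le_mono1)
  with foldr_datasize_le[of "h x" c "drop n (l x)" "a x", OF inc] datasize_drop_le[of n "l x"]
  show "datasize (foldr (h x) (drop n (l x)) (a x)) \<le> datasize (a x) + datasize (l x) * c + datasize (l x)"
    by linarith
qed (rule assms)+

definition hd_or :: "'a \<Rightarrow> 'a list \<Rightarrow> 'a" where
  "hd_or d xs = (case xs of [] \<Rightarrow> d | x # _ \<Rightarrow> x)"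

lemma hd_or_simps [simp]: "hd_or d [] = d" "hd_or d (x # xs) = x"
  by (simp_all add: hd_or_def)

lemma polytime_hd_or: "polytime d \<Longrightarrow> polytime l \<Longrightarrow> polytime (\<lambda>x. hd_or (d x) (l x))"
  unfolding hd_or_def by (intro polytime_basic_intros)

lemma polytime_butlast: "polytime l \<Longrightarrow> polytime (\<lambda>x. butlast (l x))"
  unfolding butlast_rev[of "rev _", simplified] by (intro polytime_basic_intros)

lemma datasize_tl_le: "datasize (tl xs) \<le> datasize xs"
  by (cases xs) auto

section \<open>Arithmetic on bit lists\<close>

text \<open>In contrast to the results of \<open>bits\<close>, high-order zeros are permitted, since
  \<open>add_bits\<close> produces them.\<close>

fun nat_of_bits :: "bool list \<Rightarrow> nat" where
  "nat_of_bits [] = 0"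
| "nat_of_bits (b # bs) = of_bool b + 2 * nat_of_bits bs"

lemma nat_of_bits_bits [simp]: "nat_of_bits (bits n) = n"
proof (induction n rule: bits.induct)
  case (1 n)
  have "of_bool (odd n) + 2 * (n div 2) = n"
    by (simp add: mod2_eq_if flip: odd_iff_mod_2_eq_one)
  with 1 show ?case
    by (cases "n = 0") (simp_all add: bits.simps[of n] bits.simps[of 0])
qed

lemma nat_of_bits_snoc: "nat_of_bits (bs @ [b]) = nat_of_bits bs + 2 ^ length bs * of_bool b"
  by (induction bs) (auto simp: algebra_simps)

lemma nat_of_bits_hd_tl: "nat_of_bits bs = of_bool (hd_or False bs) + 2 * nat_of_bits (tl bs)"
  by (cases bs) auto

text \<open>A full adder on two operands, a carry and the reversed output: the new carry is the
  majority, and the nested equality is the parity of the three bits.\<close>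

definition add_step ::
  "bool list \<times> bool list \<times> bool \<times> bool list \<Rightarrow> bool list \<times> bool list \<times> bool \<times> bool list" where
  "add_step z = (tl (fst z), tl (fst (snd z)),
     (hd_or False (fst z) \<and> hd_or False (fst (snd z)) \<or>
       fst (snd (snd z)) \<and> (hd_or False (fst z) \<or> hd_or False (fst (snd z)))),
     (hd_or False (fst z) = (hd_or False (fst (snd z)) = fst (snd (snd z)))) # snd (snd (snd z)))"

text \<open>The folded list serves only as a clock. It is long enough to exhaust both operands, and
  its additional entry makes the last step emit the carry.\<close>

definition add_bits :: "bool list \<Rightarrow> bool list \<Rightarrow> bool list" where
  "add_bits xs ys =
     rev (snd (snd (snd (foldl (\<lambda>z _. add_step z) (xs, ys, False, []) (xs @ ys @ [False])))))"

text \<open>The invariant of the addition: the emitted digits together with the unread operands and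
  the carry, at their place value.\<close>

definition add_value :: "bool list \<times> bool list \<times> bool \<times> bool list \<Rightarrow> nat" where
  "add_value = (\<lambda>(xs, ys, c, out). nat_of_bits (rev out) +
     2 ^ length out * (nat_of_bits xs + nat_of_bits ys + of_bool c))"

lemma add_value_step: "add_value (add_step z) = add_value z"
proof (cases z)
  case (fields xs ys c out)
  obtain d b where step: "add_step z = (tl xs, tl ys, d, b # out)"
    and d: "d = (hd_or False xs \<and> hd_or False ys \<or> c \<and> (hd_or False xs \<or> hd_or False ys))"
    and b: "b = (hd_or False xs = (hd_or False ys = c))"
    by (simp add: add_step_def fields)
  have "nat_of_bits xs + nat_of_bits ys + of_bool c =
      of_bool b + 2 * (nat_of_bits (tl xs) + nat_of_bits (tl ys) + of_bool d)"
    unfolding nat_of_bits_hd_tl[of xs] nat_of_bits_hd_tl[of ys] d b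
    by (cases "hd_or False xs"; cases "hd_or False ys"; cases c) simp_all
  note eq = this
  have "add_value (add_step z) = nat_of_bits (rev out) + (2 ^ length out * of_bool b +
      2 ^ Suc (length out) * (nat_of_bits (tl xs) + nat_of_bits (tl ys) + of_bool d))"
    unfolding step by (simp add: add_value_def nat_of_bits_snoc)
  also have "\<dots> = nat_of_bits (rev out) + 2 ^ length out *
      (of_bool b + 2 * (nat_of_bits (tl xs) + nat_of_bits (tl ys) + of_bool d))"
    by (simp only: distrib_left power_Suc mult.assoc mult.left_commute[of 2])
  also have "\<dots> = add_value z"
    unfolding eq[symmetric] by (simp add: fields add_value_def)
  finally show ?thesis .
qed

lemma foldl_add_step:
  "foldl (\<lambda>z _. add_step z) (xs, ys, c, out) zs = (xs', ys', c', out') \<Longrightarrow>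
   xs' = drop (length zs) xs \<and> ys' = drop (length zs) ys \<and> length out' = length out + length zs \<and>
   add_value (xs', ys', c', out') = add_value (xs, ys, c, out)"
proof (induction zs arbitrary: xs ys c out)
  case (Cons a zs)
  obtain d b where step: "add_step (xs, ys, c, out) = (tl xs, tl ys, d, b # out)"
    by (simp add: add_step_def)
  from Cons.prems Cons.IH[of "tl xs" "tl ys" d "b # out"] show ?case
    using add_value_step[of "(xs, ys, c, out)"] by (auto simp: step drop_Suc)
qed auto

lemma add_bits: "nat_of_bits (add_bits xs ys) = nat_of_bits xs + nat_of_bits ys"
  and length_add_bits: "length (add_bits xs ys) = length xs + length ys + 1"
proof -
  obtain xs' ys' c out where 1: "foldl (\<lambda>z _. add_step z) (xs, ys, False, []) (xs @ ys) = (xs', ys', c, out)"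
    by (metis prod.collapse)
  from foldl_add_step[OF this] have s: "xs' = []" "ys' = []" "length out = length xs + length ys"
    "add_value ([], [], c, out) = nat_of_bits xs + nat_of_bits ys"
    by (auto simp: add_value_def)
  have "foldl (\<lambda>z _. add_step z) (xs, ys, False, []) (xs @ ys @ [False]) = add_step ([], [], c, out)"
    using 1 s by simp
  also have "\<dots> = ([], [], False, c # out)"
    by (simp add: add_step_def)
  finally show "nat_of_bits (add_bits xs ys) = nat_of_bits xs + nat_of_bits ys"
    "length (add_bits xs ys) = length xs + length ys + 1"
    using s(3,4) by (simp_all add: add_bits_def add_value_def nat_of_bits_snoc)
qed

lemma datasize_bool_list_le: "datasize (bs :: bool list) \<le> 1 + 4 * length bs"
proof (induction bs)
  case (Cons b bs)
  then show ?case using datasize_bool_le[of b] by simp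
qed simp

lemma polytime_add_bits:
  assumes "polytime f" "polytime g"
  shows "polytime (\<lambda>x. add_bits (f x) (g x))"
proof -
  have "datasize (add_step z) \<le> datasize z + 6 + datasize y" for z and y :: bool
  proof (cases z)
    case (fields xs ys c out)
    obtain d b where "add_step z = (tl xs, tl ys, d, b # out)"
      by (simp add: add_step_def fields)
    then show ?thesis
      using datasize_tl_le[of xs] datasize_tl_le[of ys] datasize_bool_le[of d] datasize_bool_le[of b]
        datasize_pos[of c] datasize_pos[of y] by (simp add: fields)
  qed
  then show ?thesis
    unfolding add_bits_def
    by (intro polytime_basic_intros polytime_foldl_additive[where c = 6] assms)
      (unfold add_step_def, intro polytime_basic_intros polytime_hd_or)
qed

text \<open>The least significant digits come first, so each differing position overrides the
  verdict reached so far.\<close>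

definition less_step :: "bool list \<times> bool list \<times> bool \<Rightarrow> bool list \<times> bool list \<times> bool" where
  "less_step z = (tl (fst z), tl (fst (snd z)),
     if hd_or False (fst z) = hd_or False (fst (snd z)) then snd (snd z) else hd_or False (fst (snd z)))"

definition less_bits :: "bool list \<Rightarrow> bool list \<Rightarrow> bool" where
  "less_bits xs ys = snd (snd (foldl (\<lambda>z _. less_step z) (xs, ys, False) (xs @ ys)))"

text \<open>The flag is the verdict on the digits read; it matters only if the unread, more
  significant parts agree.\<close>

lemma foldl_less_step:
  "foldl (\<lambda>z _. less_step z) (xs, ys, r) zs = (xs', ys', r') \<Longrightarrow>
   xs' = drop (length zs) xs \<and> ys' = drop (length zs) ys \<and>
   (nat_of_bits xs' < nat_of_bits ys' \<or> nat_of_bits xs' = nat_of_bits ys' \<and> r' \<longleftrightarrow>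
    nat_of_bits xs < nat_of_bits ys \<or> nat_of_bits xs = nat_of_bits ys \<and> r)"
proof (induction zs arbitrary: xs ys r)
  case (Cons a zs)
  obtain d where step: "less_step (xs, ys, r) = (tl xs, tl ys, d)"
    and d: "d = (if hd_or False xs = hd_or False ys then r else hd_or False ys)"
    by (simp add: less_step_def)
  have "nat_of_bits (tl xs) < nat_of_bits (tl ys) \<or> nat_of_bits (tl xs) = nat_of_bits (tl ys) \<and> d \<longleftrightarrow>
    nat_of_bits xs < nat_of_bits ys \<or> nat_of_bits xs = nat_of_bits ys \<and> r"
    unfolding nat_of_bits_hd_tl[of xs] nat_of_bits_hd_tl[of ys] d
    by (cases "hd_or False xs"; cases "hd_or False ys") auto
  with Cons.prems Cons.IH[of "tl xs" "tl ys" d] show ?case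
    by (auto simp: step drop_Suc)
qed auto

lemma less_bits: "less_bits xs ys \<longleftrightarrow> nat_of_bits xs < nat_of_bits ys"
proof -
  obtain xs' ys' r where 1: "foldl (\<lambda>z _. less_step z) (xs, ys, False) (xs @ ys) = (xs', ys', r)"
    by (metis prod.collapse)
  from foldl_less_step[OF this] show ?thesis
    unfolding less_bits_def 1 by auto
qed

lemma polytime_less_bits:
  assumes "polytime f" "polytime g"
  shows "polytime (\<lambda>x. less_bits (f x) (g x))"
proof -
  have "datasize (less_step z) \<le> datasize z + 6 + datasize y" for z and y :: bool
  proof (cases z)
    case (fields xs ys c)
    obtain d where "less_step z = (tl xs, tl ys, d)"
      by (simp add: less_step_def fields)
    then show ?thesis
      using datasize_tl_le[of xs] datasize_tl_le[of ys] datasize_bool_le[of d]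
        datasize_pos[of c] datasize_pos[of y] by (simp add: fields)
  qed
  then show ?thesis
    unfolding less_bits_def
    by (intro polytime_basic_intros polytime_foldl_additive[where c = 6] assms)
      (unfold less_step_def, intro polytime_basic_intros polytime_hd_or)
qed

definition sum_bits :: "bool list list \<Rightarrow> bool list" where
  "sum_bits ws = foldr add_bits ws []"

lemma sum_bits: "nat_of_bits (sum_bits ws) = sum_list (map nat_of_bits ws)"
  by (induction ws) (auto simp: sum_bits_def add_bits)

text \<open>The length of a sum is known exactly from \<open>length_add_bits\<close>, whereas its
  \<open>datasize\<close> also depends on the number of ones. So the length is bounded here and
  \<open>datasize_bool_list_le\<close> converts the bound.\<close>

lemma length_sum_bits_le: "length (foldr add_bits ws []) \<le> datasize ws"
proof (induction ws)
  case (Cons w ws)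
  then show ?case
    using length_le_datasize[of w] by (simp add: length_add_bits)
qed simp

lemma polytime_sum_bits:
  assumes "polytime l"
  shows "polytime (\<lambda>x. sum_bits (l x))"
  unfolding sum_bits_def
proof (rule polytime_foldr[where b = "\<lambda>x. 1 + 4 * datasize (l x)"])
  show "polysize (\<lambda>x. 1 + 4 * datasize (l x))"
    by (intro polysize_intros assms)
  show "datasize (foldr add_bits (drop n (l x)) []) \<le> 1 + 4 * datasize (l x)" for n x
    using datasize_bool_list_le[of "foldr add_bits (drop n (l x)) []"]
      length_sum_bits_le[of "drop n (l x)"] datasize_drop_le[of n "l x"] by linarith
qed (intro polytime_add_bits polytime_basic_intros assms)+

text \<open>Leaf depths are represented by lists of that length. This is affordable because no leaf
  is deeper than the word of its tree is long.\<close>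

definition unary_le :: "bool list \<Rightarrow> bool list \<Rightarrow> bool" where
  "unary_le xs ys \<longleftrightarrow> foldl (\<lambda>z _. tl z) xs ys = []"

lemma unary_le: "unary_le xs ys \<longleftrightarrow> length xs \<le> length ys"
proof -
  have "foldl (\<lambda>z _. tl z) xs ys = drop (length ys) xs"
    by (induction ys arbitrary: xs) (auto simp: drop_Suc)
  then show ?thesis by (simp add: unary_le_def)
qed

lemma polytime_unary_le:
  assumes "polytime f" "polytime g"
  shows "polytime (\<lambda>x. unary_le (f x) (g x))"
  unfolding unary_le_def
  by (intro polytime_basic_intros polytime_foldl_additive[where c = 0] assms)
    (use datasize_tl_le in \<open>auto intro: trans_le_add1\<close>)

section \<open>Checks on votes\<close>

text \<open>One pass suffices: the first flag records that \<open>a\<close> has been passed. The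
  second flag uses the old value of the first, so \<open>b\<close> has to come strictly
  later.\<close>

lemma prefers_fold:
  "foldl (\<lambda>z y. (fst z \<or> y = a, snd z \<or> fst z \<and> y = b)) (False, False) v = (a \<in> set v, prefers v a b)"
proof (induction v rule: rev_induct)
  case Nil
  show ?case by (simp add: prefers_def)
next
  case (snoc y v)
  have "prefers (v @ [y]) a b \<longleftrightarrow> prefers v a b \<or> a \<in> set v \<and> y = b"
  proof
    assume "prefers (v @ [y]) a b"
    then obtain xs ys zs where eq: "v @ [y] = xs @ a # ys @ b # zs"
      by (auto simp: prefers_def)
    show "prefers v a b \<or> a \<in> set v \<and> y = b"
    proof (cases zs rule: rev_cases)
      case Nil
      with eq have "v @ [y] = (xs @ a # ys) @ [b]" by simp
      then have "v = xs @ a # ys" "y = b" unfolding append1_eq_conv by auto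
      then show ?thesis by simp
    next
      case (snoc zs' z)
      with eq have "v @ [y] = (xs @ a # ys @ b # zs') @ [z]" by simp
      then have "v = xs @ a # ys @ b # zs'" unfolding append1_eq_conv by auto
      then show ?thesis unfolding prefers_def by blast
    qed
  next
    assume "prefers v a b \<or> a \<in> set v \<and> y = b"
    then show "prefers (v @ [y]) a b"
    proof (elim disjE conjE)
      assume "prefers v a b"
      then obtain xs ys zs where "v = xs @ a # ys @ b # zs"
        by (auto simp: prefers_def)
      then have "v @ [y] = xs @ a # ys @ b # (zs @ [y])" by simp
      then show ?thesis unfolding prefers_def by blast
    next
      assume "a \<in> set v" "y = b"
      then obtain xs ys where "v = xs @ a # ys" by (meson split_list)
      with \<open>y = b\<close> have "v @ [y] = xs @ a # ys @ b # []" by simp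
      then show ?thesis unfolding prefers_def by blast
    qed
  qed
  with snoc show ?case by auto
qed

lemma polytime_prefers:
  assumes "polytime v" "polytime a" "polytime b"
  shows "polytime (\<lambda>x. prefers (v x) (a x) (b x))"
proof -
  have "polytime (\<lambda>x. snd (foldl (\<lambda>z y. (fst z \<or> y = a x, snd z \<or> fst z \<and> y = b x)) (False, False) (v x)))"
  proof (intro polytime_snd polytime_foldl_additive[where c = 6])
    show "polytime (\<lambda>z. (fst (fst (snd z)) \<or> snd (snd z) = a (fst z),
         snd (fst (snd z)) \<or> fst (fst (snd z)) \<and> snd (snd z) = b (fst z)))"
      by (intro polytime_basic_intros polytime_comp[OF assms(2)] polytime_comp[OF assms(3)])
    fix x y and z :: "bool \<times> bool"
    show "datasize (fst z \<or> y = a x, snd z \<or> fst z \<and> y = b x) \<le> datasize z + 6 + datasize y"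
      using datasize_bool_le[of "fst z \<or> y = a x"] datasize_bool_le[of "snd z \<or> fst z \<and> y = b x"]
        datasize_pos[of y] by simp
  qed (intro polytime_basic_intros assms)+
  then show ?thesis by (simp add: prefers_fold)
qed

lemma polytime_distinct:
  assumes "polytime l"
  shows "polytime (\<lambda>x. distinct (l x))"
proof -
  have fold: "foldl (\<lambda>z y. (fst z \<and> y \<notin> set (snd z), y # snd z)) (True, []) ys = (distinct ys, rev ys)" for ys :: "'b list"
    by (induction ys rule: rev_induct) auto
  have "polytime (\<lambda>x. fst (foldl (\<lambda>z y. (fst z \<and> y \<notin> set (snd z), y # snd z)) (True, []) (l x)))"
  proof (intro polytime_fst polytime_foldl_additive[where c = 6])
    fix y :: 'b and z :: "bool \<times> 'b list"
    show "datasize (fst z \<and> y \<notin> set (snd z), y # snd z) \<le> datasize z + 6 + datasize y"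
      using datasize_bool_le[of "fst z \<and> y \<notin> set (snd z)"] by (cases z) simp
  qed (intro polytime_basic_intros assms)+
  then show ?thesis by (simp add: fold)
qed

lemma polytime_is_vote:
  assumes "polytime c" "polytime v"
  shows "polytime (\<lambda>x. is_vote (set (c x)) (v x))"
proof -
  have "polytime (\<lambda>x. distinct (v x) \<and> (\<forall>y\<in>set (v x). y \<in> set (c x)) \<and> (\<forall>y\<in>set (c x). y \<in> set (v x)))"
    by (intro polytime_basic_intros polytime_distinct polytime_comp[OF assms(1)]
        polytime_comp[OF assms(2)] assms)
  also have "(\<lambda>x. distinct (v x) \<and> (\<forall>y\<in>set (v x). y \<in> set (c x)) \<and> (\<forall>y\<in>set (c x). y \<in> set (v x))) =
      (\<lambda>x. is_vote (set (c x)) (v x))"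
    by (auto simp: is_vote_def fun_eq_iff)
  finally show ?thesis .
qed

lemma polytime_Bit: "polytime b \<Longrightarrow> polytime (\<lambda>x. Bit (b x))"
proof -
  assume "polytime b"
  then have "polytime (\<lambda>x. if b x then Bit True else Bit False)"
    by (intro polytime_basic_intros)
  also have "(\<lambda>x. if b x then Bit True else Bit False) = (\<lambda>x. Bit (b x))"
    by auto
  finally show ?thesis .
qed

lemma polytime_enc_list:
  assumes "polytime (\<lambda>z. f (fst z) (snd z))" "polytime l"
  shows "polytime (\<lambda>x. enc_list (f x) (l x))"
  unfolding enc_list_def by (intro polytime_basic_intros assms)

section \<open>Reading an instance\<close>

text \<open>Every component of an encoded instance is the encoding of a tree, namely
  \<open>enc_nat c = enc_tree (Leaf c)\<close> and \<open>enc_list enc_nat xs = enc_tree (spine xs)\<close>.  Hence the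
  same bottom-up evaluation with a stack, reading the word from right to left, serves for all
  components.\<close>

fun spine :: "nat list \<Rightarrow> nat cup_tree" where
  "spine [] = Leaf 0"
| "spine (x # xs) = Match (Leaf x) (spine xs)"

lemma bits_0 [simp]: "bits 0 = []"
  by (subst bits.simps) simp

lemma enc_list_nat: "enc_list enc_nat xs = enc_tree (spine xs)"
  by (induction xs) (auto simp: enc_list_def enc_nat_def)

lemma leaves_spine: "leaves (spine xs) = xs @ [0]"
  by (induction xs) auto

text \<open>Too short a stack is emptied instead of signalling an error; this does not happen when
  an encoded tree is evaluated.\<close>

definition join_top :: "('a \<Rightarrow> 'a \<Rightarrow> 'a) \<Rightarrow> 'a list \<Rightarrow> 'a list" where
  "join_top f st = (case st of [] \<Rightarrow> [] | a # st' \<Rightarrow> (case st' of [] \<Rightarrow> [] | b # st'' \<Rightarrow> f a b # st''))"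

lemma join_top_simps [simp]: "join_top f (a # b # st) = f a b # st"
  by (simp add: join_top_def)

lemma polytime_join_top:
  assumes "polytime (\<lambda>z. f (fst z) (fst (snd z)) (snd (snd z)))" "polytime st"
  shows "polytime (\<lambda>x. join_top (f x) (st x))"
  unfolding join_top_def
  by (intro polytime_basic_intros assms
      polytime_comp[OF assms(1), where f = "\<lambda>z. (g z, h z, k z)" for g h k, simplified])

lemma datasize_join_top_le:
  assumes "\<And>a b. datasize (f a b) \<le> datasize a + datasize b + c"
  shows "datasize (join_top f st) \<le> datasize st + c"
  using assms unfolding join_top_def
  by (auto split: list.split) (metis add.assoc add.commute add_le_mono1 le_SucI)

text \<open>All stack entries stay encodings of trees, see \<open>set_split_trees\<close>. To this
  end the stack is cleared if a digit would become a most significant zero, directly before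
  \<open>Stop\<close>, or would precede the word of a \<open>Match\<close>.\<close>

definition split_step :: "letter \<Rightarrow> letter list list \<Rightarrow> letter list list" where
  "split_step x st = (case x of
     Bit b \<Rightarrow> (case st of [] \<Rightarrow> [] | e # st' \<Rightarrow>
       if e = [Stop] \<and> \<not> b \<or> hd_or Stop e = Item then [] else (Bit b # e) # st')
   | Item \<Rightarrow> join_top (\<lambda>a b. Item # a @ b) st
   | Stop \<Rightarrow> [Stop] # st)"

definition split_trees :: "letter list \<Rightarrow> letter list list" where
  "split_trees w = foldr split_step w []"

definition leaf_step :: "letter \<Rightarrow> bool list list \<Rightarrow> bool list list" where
  "leaf_step x st = (case x of
     Bit b \<Rightarrow> (case st of [] \<Rightarrow> [] | n # st' \<Rightarrow> (b # n) # st')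
   | Item \<Rightarrow> st
   | Stop \<Rightarrow> [] # st)"

definition leaf_bits :: "letter list \<Rightarrow> bool list list" where
  "leaf_bits w = foldr leaf_step w []"

text \<open>Each entry holds the minimal and the maximal leaf depth of a subtree, in unary.\<close>

definition depth_step ::
  "letter \<Rightarrow> (bool list \<times> bool list) list \<Rightarrow> (bool list \<times> bool list) list" where
  "depth_step x st = (case x of
     Bit b \<Rightarrow> st
   | Item \<Rightarrow> join_top (\<lambda>a b. (True # (if unary_le (fst a) (fst b) then fst a else fst b),
       True # (if unary_le (snd a) (snd b) then snd b else snd a))) st
   | Stop \<Rightarrow> ([], []) # st)"

definition depth_bounds :: "letter list \<Rightarrow> (bool list \<times> bool list) list" where
  "depth_bounds w = foldr depth_step w []"

text \<open>The result is never longer than both lists together, which keeps the bottom-up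
  evaluation of polynomial size.\<close>

definition survivors :: "('a \<Rightarrow> 'a \<Rightarrow> bool) \<Rightarrow> 'a list \<Rightarrow> 'a list \<Rightarrow> 'a list" where
  "survivors ok l r = filter (\<lambda>a. \<exists>b\<in>set r. ok a b) l @ filter (\<lambda>b. \<exists>a\<in>set l. ok b a) r"

text \<open>A leaf starts at its \<open>Stop\<close> as a list with one candidate, whose name is
  then completed digit by digit inside the top entry.\<close>

definition cup_step ::
  "(bool list \<Rightarrow> bool list \<Rightarrow> bool) \<Rightarrow> letter \<Rightarrow> bool list list list \<Rightarrow> bool list list list" where
  "cup_step ok x st = (case x of
     Bit b \<Rightarrow> (case st of [] \<Rightarrow> [] | e # st' \<Rightarrow> (case e of [] \<Rightarrow> [] | n # ns \<Rightarrow> ((b # n) # ns) # st'))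
   | Item \<Rightarrow> join_top (survivors ok) st
   | Stop \<Rightarrow> [[]] # st)"

definition cup_eval :: "(bool list \<Rightarrow> bool list \<Rightarrow> bool) \<Rightarrow> letter list \<Rightarrow> bool list list list" where
  "cup_eval ok w = foldr (cup_step ok) w []"

section \<open>Polynomial time of the stack evaluations\<close>

lemma polytime_split_trees:
  assumes "polytime l"
  shows "polytime (\<lambda>x. split_trees (l x))"
  unfolding split_trees_def
proof (rule polytime_foldr_additive[where c = 10])
  show "polytime (\<lambda>z :: 'a \<times> _. split_step (fst (snd z)) (snd (snd z)))"
    unfolding split_step_def
    by (intro polytime_basic_intros polytime_join_top polytime_hd_or polytime_Bit)
  fix y z
  have "datasize (join_top (\<lambda>a b. Item # a @ b) z) \<le> datasize z + 10"
  proof (rule datasize_join_top_le)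
    show "datasize (Item # a @ b) \<le> datasize a + datasize b + 10" for a b
      using datasize_append[of a b] by simp
  qed
  then show "datasize (split_step y z) \<le> datasize z + 10 + datasize y"
    using datasize_bool_le by (auto simp: split_step_def split: letter.split list.split)
qed (intro polytime_basic_intros assms)+

lemma polytime_leaf_bits:
  assumes "polytime l"
  shows "polytime (\<lambda>x. leaf_bits (l x))"
  unfolding leaf_bits_def
proof (rule polytime_foldr_additive[where c = 10])
  show "polytime (\<lambda>z :: 'a \<times> _. leaf_step (fst (snd z)) (snd (snd z)))"
    unfolding leaf_step_def by (intro polytime_basic_intros)
  show "datasize (leaf_step y z) \<le> datasize z + 10 + datasize y" for y z
    by (auto simp: leaf_step_def split: letter.split list.split)
qed (intro polytime_basic_intros assms)+

lemma polytime_depth_bounds: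
  assumes "polytime l"
  shows "polytime (\<lambda>x. depth_bounds (l x))"
  unfolding depth_bounds_def
proof (rule polytime_foldr_additive[where c = 10])
  show "polytime (\<lambda>z :: 'a \<times> _. depth_step (fst (snd z)) (snd (snd z)))"
    unfolding depth_step_def by (intro polytime_basic_intros polytime_join_top polytime_unary_le)
  fix y and z :: "(bool list \<times> bool list) list"
  have "datasize (depth_step Item z) \<le> datasize z + 10"
    unfolding depth_step_def letter.case
    by (rule datasize_join_top_le) (auto split: prod.split)
  then show "datasize (depth_step y z) \<le> datasize z + 10 + datasize y"
    by (cases y) (auto simp: depth_step_def)
qed (intro polytime_basic_intros assms)+

lemma polytime_cup_eval:
  assumes ok: "polytime (\<lambda>z. ok (fst z) (fst (snd z)) (snd (snd z)))" and "polytime l"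
  shows "polytime (\<lambda>x. cup_eval (ok x) (l x))"
  unfolding cup_eval_def
proof (rule polytime_foldr_additive[where c = 10])
  have ok': "polytime f \<Longrightarrow> polytime g \<Longrightarrow> polytime h \<Longrightarrow> polytime (\<lambda>z. ok (f z) (g z) (h z))"
    for f :: "'b::data \<Rightarrow> _" and g h
    using polytime_comp[OF ok, of "\<lambda>z. (f z, g z, h z)"] by (simp add: polytime_Pair)
  show "polytime (\<lambda>z. cup_step (ok (fst z)) (fst (snd z)) (snd (snd z)))"
    unfolding cup_step_def survivors_def by (intro polytime_basic_intros polytime_join_top ok')
  fix x y and z :: "bool list list list"
  have "datasize (cup_step (ok x) Item z) \<le> datasize z + 10"
    unfolding cup_step_def letter.case
  proof (rule datasize_join_top_le)
    show "datasize (survivors (ok x) a b) \<le> datasize a + datasize b + 10" for a b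
      using datasize_append[of "filter (\<lambda>a. \<exists>b\<in>set b. ok x a b) a" "filter (\<lambda>b. \<exists>a\<in>set a. ok x b a) b"]
        datasize_filter_le[of "\<lambda>a. \<exists>b\<in>set b. ok x a b" a]
        datasize_filter_le[of "\<lambda>b. \<exists>a\<in>set a. ok x b a" b]
      unfolding survivors_def by linarith
  qed
  then show "datasize (cup_step (ok x) y z) \<le> datasize z + 10 + datasize y"
    by (cases y) (auto simp: cup_step_def split: list.split)
qed (intro polytime_basic_intros assms)+

section \<open>Possible winners of a cup\<close>

lemma prefers_Nil [simp]: "\<not> prefers [] a b"
  by (simp add: prefers_def)

lemma prefers_Cons [simp]: "prefers (x # v) a b \<longleftrightarrow> x = a \<and> b \<in> set v \<or> prefers v a b"
proof
  assume "prefers (x # v) a b"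
  then obtain xs ys zs where "x # v = xs @ a # ys @ b # zs"
    by (auto simp: prefers_def)
  then show "x = a \<and> b \<in> set v \<or> prefers v a b"
    by (cases xs) (auto simp: prefers_def)
next
  assume "x = a \<and> b \<in> set v \<or> prefers v a b"
  then show "prefers (x # v) a b"
  proof
    assume "x = a \<and> b \<in> set v"
    moreover then obtain ys zs where "v = ys @ b # zs" by (meson split_list)
    ultimately have "x # v = [] @ a # ys @ b # zs" by simp
    then show ?thesis unfolding prefers_def by blast
  next
    assume "prefers v a b"
    then obtain xs ys zs where "v = xs @ a # ys @ b # zs"
      by (auto simp: prefers_def)
    then have "x # v = (x # xs) @ a # ys @ b # zs" by simp
    then show ?thesis unfolding prefers_def by blast
  qed
qed

lemma prefers_in_set: "prefers v a b \<Longrightarrow> a \<in> set v \<and> b \<in> set v"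
  by (induction v) auto

lemma prefers_append: "prefers (v @ w) a b \<longleftrightarrow> prefers v a b \<or> a \<in> set v \<and> b \<in> set w \<or> prefers w a b"
  by (induction v) auto

lemma prefers_asym: "distinct v \<Longrightarrow> prefers v a b \<Longrightarrow> a \<noteq> b \<and> \<not> prefers v b a"
  by (induction v) (auto dest: prefers_in_set)

lemma prefers_total: "a \<in> set v \<Longrightarrow> b \<in> set v \<Longrightarrow> a \<noteq> b \<Longrightarrow> prefers v a b \<or> prefers v b a"
  by (induction v) auto

lemma prefers_map:
  assumes "inj f"
  shows "prefers (map f v) (f a) (f b) \<longleftrightarrow> prefers v a b"
  by (induction v) (auto simp: inj_eq[OF assms] inj_image_mem_iff[OF assms])

text \<open>A count in the unfolded election that avoids the unfolding, whose length can be
  exponential in the size of the weights.\<close>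

definition support :: "(nat \<times> 'c vote) list \<Rightarrow> 'c \<Rightarrow> 'c \<Rightarrow> nat" where
  "support S a b = sum_list (map fst (filter (\<lambda>kv. prefers (snd kv) a b) S))"

lemma support_append: "support (S @ S') a b = support S a b + support S' a b"
  by (simp add: support_def)

lemma length_filter_unweighted:
  "length (filter (\<lambda>v. prefers v a b) (unweighted S)) = support S a b"
  by (induction S) (auto simp: unweighted_def support_def)

text \<open>Every vote ranks the two candidates one way or the other, so the two supports add up to
  the number of votes and an absolute majority is a strict excess.\<close>

lemma beats_iff:
  assumes "\<forall>(k, v)\<in>set S. is_vote C v" "a \<in> C" "b \<in> C" "a \<noteq> b"
  shows "beats (unweighted S) a b \<longleftrightarrow> support S b a < support S a b"
proof -
  have "length (unweighted S) = support S a b + support S b a"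
    using assms(1)
  proof (induction S)
    case (Cons kv S)
    obtain k v where kv: "kv = (k, v)" by (cases kv)
    have "is_vote C v" using Cons.prems by (simp add: kv)
    then have "prefers v a b \<longleftrightarrow> \<not> prefers v b a"
      using prefers_total[of a v b] prefers_asym[of v a b] assms(2-) by (auto simp: is_vote_def)
    then show ?case
      using Cons by (auto simp: unweighted_def support_def kv)
  qed (simp add: unweighted_def support_def)
  then show ?thesis
    by (auto simp: beats_def length_filter_unweighted)
qed

lemma support_zip_le: "support (zip T vs) a b \<le> sum_list T"
proof (induction T arbitrary: vs)
  case (Cons k T)
  show ?case
  proof (cases vs)
    case (Cons v vs')
    then show ?thesis using Cons.IH[of vs'] by (auto simp: support_def)
  qed (simp add: support_def)
qed (simp add: support_def)

lemma support_zip_replicate: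
  "support (zip T (replicate (length T) v)) a b = (if prefers v a b then sum_list T else 0)"
  by (induction T) (auto simp: support_def)

section \<open>Possible winners of a schedule and manipulability\<close>

fun possible_winners :: "('c \<Rightarrow> 'c \<Rightarrow> bool) \<Rightarrow> 'c cup_tree \<Rightarrow> 'c list" where
  "possible_winners ok (Leaf c) = [c]"
| "possible_winners ok (Match l r) = survivors ok (possible_winners ok l) (possible_winners ok r)"

text \<open>Votes and tie-breaking are merged into one relation, whose first argument is the left
  participant; the arguments about the schedule then no longer mention votes.\<close>

fun winner_by :: "('c \<Rightarrow> 'c \<Rightarrow> bool) \<Rightarrow> 'c cup_tree \<Rightarrow> 'c" where
  "winner_by adv (Leaf c) = c"
| "winner_by adv (Match l r) =
     (if adv (winner_by adv l) (winner_by adv r) then winner_by adv l else winner_by adv r)"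

lemma cup_winner_eq:
  "cup_winner tie V t = winner_by (\<lambda>a b. beats V a b \<or> \<not> beats V b a \<and> tie a b) t"
  by (induction t) (auto simp: Let_def)

lemma winner_by_in_leaves: "winner_by adv t \<in> set (leaves t)"
  by (induction t) auto

lemma possible_winners_in_leaves: "set (possible_winners ok t) \<subseteq> set (leaves t)"
  by (induction t) (auto simp: survivors_def)

text \<open>The actual loser of a match is a possible winner of its own side by induction, and so is
  the witness that \<open>survivors\<close> asks for.\<close>

lemma winner_by_possible:
  assumes "distinct (leaves t)"
    "\<And>a b. a \<in> set (leaves t) \<Longrightarrow> b \<in> set (leaves t) \<Longrightarrow> a \<noteq> b \<Longrightarrow> if adv a b then ok a b else ok b a"
  shows "winner_by adv t \<in> set (possible_winners ok t)"
  using assms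
proof (induction t)
  case (Match l r)
  let ?a = "winner_by adv l" and ?b = "winner_by adv r"
  have "?a \<in> set (possible_winners ok l)" "?b \<in> set (possible_winners ok r)"
    using Match by auto
  moreover have "?a \<in> set (leaves l)" "?b \<in> set (leaves r)"
    by (rule winner_by_in_leaves)+
  with Match.prems(1) have "if adv ?a ?b then ok ?a ?b else ok ?b ?a"
    by (intro Match.prems(2)) auto
  ultimately show ?case by (auto simp: survivors_def)
qed simp

text \<open>If all manipulators rank the side of the eventual winner of each match above the other side,
  they support the favoured winner in every match that matters.\<close>

lemma possible_winner_order:
  assumes "c \<in> set (possible_winners ok t)" "distinct (leaves t)"
  shows "\<exists>v. distinct v \<and> set v = set (leaves t) \<and>
    (\<forall>adv. (\<forall>a b. prefers v a b \<and> ok a b \<longrightarrow> adv a b \<and> \<not> adv b a) \<longrightarrow> winner_by adv t = c)"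
  using assms
proof (induction t arbitrary: c)
  case (Leaf d)
  then show ?case by (intro exI[of _ "[d]"]) auto
next
  case (Match l r)
  from Match.prems consider
    d where "c \<in> set (possible_winners ok l)" "d \<in> set (possible_winners ok r)" "ok c d"
    | d where "c \<in> set (possible_winners ok r)" "d \<in> set (possible_winners ok l)" "ok c d"
    by (auto simp: survivors_def)
  then show ?case
  proof cases
    case 1
    from Match.IH(1)[OF 1(1)] Match.prems(2) obtain v where v: "distinct v" "set v = set (leaves l)"
      "\<And>adv. \<forall>a b. prefers v a b \<and> ok a b \<longrightarrow> adv a b \<and> \<not> adv b a \<Longrightarrow> winner_by adv l = c" by auto
    from Match.IH(2)[OF 1(2)] Match.prems(2) obtain w where w: "distinct w" "set w = set (leaves r)"
      "\<And>adv. \<forall>a b. prefers w a b \<and> ok a b \<longrightarrow> adv a b \<and> \<not> adv b a \<Longrightarrow> winner_by adv r = d" by auto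
    have cd: "prefers (v @ w) c d"
      using subsetD[OF possible_winners_in_leaves 1(1)] subsetD[OF possible_winners_in_leaves 1(2)] v w
      by (simp add: prefers_append)
    have "winner_by adv (Match l r) = c"
      if adv: "\<forall>a b. prefers (v @ w) a b \<and> ok a b \<longrightarrow> adv a b \<and> \<not> adv b a" for adv
    proof -
      have "winner_by adv l = c" "winner_by adv r = d"
        by (rule v(3) w(3), use adv in \<open>simp add: prefers_append\<close>)+
      with adv cd 1(3) show ?thesis by auto
    qed
    then show ?thesis
      using v w Match.prems(2) by (intro exI[of _ "v @ w"]) auto
  next
    case 2
    from Match.IH(2)[OF 2(1)] Match.prems(2) obtain v where v: "distinct v" "set v = set (leaves r)"
      "\<And>adv. \<forall>a b. prefers v a b \<and> ok a b \<longrightarrow> adv a b \<and> \<not> adv b a \<Longrightarrow> winner_by adv r = c" by auto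
    from Match.IH(1)[OF 2(2)] Match.prems(2) obtain w where w: "distinct w" "set w = set (leaves l)"
      "\<And>adv. \<forall>a b. prefers w a b \<and> ok a b \<longrightarrow> adv a b \<and> \<not> adv b a \<Longrightarrow> winner_by adv l = d" by auto
    have cd: "prefers (v @ w) c d"
      using subsetD[OF possible_winners_in_leaves 2(1)] subsetD[OF possible_winners_in_leaves 2(2)] v w
      by (simp add: prefers_append)
    have "winner_by adv (Match l r) = c"
      if adv: "\<forall>a b. prefers (v @ w) a b \<and> ok a b \<longrightarrow> adv a b \<and> \<not> adv b a" for adv
    proof -
      have "winner_by adv r = c" "winner_by adv l = d"
        by (rule v(3) w(3), use adv in \<open>simp add: prefers_append\<close>)+
      \<comment> \<open>Here the winner is the right participant and advances because
        \<open>adv d c\<close> fails. For this reason the hypothesis on \<open>adv\<close> restricts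
        both orders of a pair.\<close>
      with adv cd 2(3) show ?thesis by auto
    qed
    then show ?thesis
      using v w Match.prems(2) by (intro exI[of _ "v @ w"]) auto
  qed
qed

text \<open>With positive total weight \<open>\<Sum>T\<close>, the relation says that the manipulators can make \<open>a\<close> beat
  \<open>b\<close>; with total weight \<open>0\<close>, that \<open>b\<close> does not beat \<open>a\<close>.\<close>

definition can_advance :: "(nat \<times> 'c vote) list \<Rightarrow> nat list \<Rightarrow> 'c \<Rightarrow> 'c \<Rightarrow> bool" where
  "can_advance S T a b \<longleftrightarrow> support S b a < support S a b + max 1 (sum_list T)"

lemma CCWM_cup_iff:
  assumes C: "distinct (leaves t)" and S: "\<forall>(k, v)\<in>set S. is_vote (set (leaves t)) v"
  shows "CCWM (cup_wins t) (set (leaves t)) S T p \<longleftrightarrow>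
    p \<in> set (possible_winners (can_advance S T) t) \<and>
    ((\<exists>k\<in>set T. k \<noteq> 0) \<or> (\<forall>q\<in>set (possible_winners (can_advance S T) t). q = p))"
    (is "?L \<longleftrightarrow> ?p \<and> (?pos \<or> ?unique)")
proof -
  let ?C = "set (leaves t)" and ?ok = "can_advance S T"
  have pos: "?pos \<longleftrightarrow> sum_list T \<noteq> 0"
    by auto
  have beats: "beats (unweighted (S @ zip T vs)) a b \<longleftrightarrow>
      support S b a + support (zip T vs) b a < support S a b + support (zip T vs) a b"
    if "\<forall>v\<in>set vs. is_vote ?C v" "a \<in> ?C" "b \<in> ?C" "a \<noteq> b" for vs a b
    using that S by (subst beats_iff[where C = ?C]) (auto simp: support_append dest!: set_zip_rightD)
  show ?thesis
  proof
    assume ?L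
    then obtain vs where vs: "\<forall>v\<in>set vs. is_vote ?C v"
      and win: "\<And>tie. cup_winner tie (unweighted (S @ zip T vs)) t = p"
      by (auto simp: CCWM_def cup_wins_def)
    note beats = beats[OF vs]
    \<comment> \<open>As \<open>p\<close> wins under every tie-breaking, a convenient one may be
      chosen. Breaking ties by \<open>?ok\<close> works because \<open>?ok b a\<close> holds
      whenever \<open>?ok a b\<close> fails, and a strict victory implies \<open>?ok\<close> since
      no support gains more than the total weight.\<close>
    have "cup_winner ?ok (unweighted (S @ zip T vs)) t \<in> set (possible_winners ?ok t)"
      unfolding cup_winner_eq
    proof (rule winner_by_possible[OF C])
      fix a b
      assume "a \<in> ?C" "b \<in> ?C" "a \<noteq> b"
      then show "if beats (unweighted (S @ zip T vs)) a b \<or>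
          \<not> beats (unweighted (S @ zip T vs)) b a \<and> ?ok a b then ?ok a b else ?ok b a"
        using support_zip_le[of T vs a b] support_zip_le[of T vs b a]
        by (auto simp: beats can_advance_def)
    qed
    then have ?p by (simp add: win)
    moreover have ?unique if "\<not> ?pos"
    proof
      fix q
      assume "q \<in> set (possible_winners ?ok t)"
      from possible_winner_order[OF this C] obtain v where v: "distinct v" "set v = ?C"
        "\<And>adv. \<forall>a b. prefers v a b \<and> ?ok a b \<longrightarrow> adv a b \<and> \<not> adv b a \<Longrightarrow> winner_by adv t = q"
        by auto
      have zero: "sum_list T = 0" using that pos by blast
      \<comment> \<open>With total weight 0 the order \<open>v\<close> that favours \<open>q\<close>
        acts as a tie-breaking rule instead of a vote: \<open>?ok a b\<close> now leaves only a
        victory of \<open>a\<close> or a tie.\<close>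
      have "cup_winner (prefers v) (unweighted (S @ zip T vs)) t = q"
        unfolding cup_winner_eq
      proof (rule v(3), intro allI impI)
        fix a b
        assume ab: "prefers v a b \<and> ?ok a b"
        then have "a \<in> ?C" "b \<in> ?C" "a \<noteq> b" "\<not> prefers v b a"
          using prefers_in_set[of v a b] prefers_asym[of v a b] v by auto
        moreover have "support (zip T vs) a b = 0" "support (zip T vs) b a = 0"
          using support_zip_le[of T vs a b] support_zip_le[of T vs b a] unfolding zero by simp_all
        ultimately show "(beats (unweighted (S @ zip T vs)) a b \<or>
            \<not> beats (unweighted (S @ zip T vs)) b a \<and> prefers v a b) \<and>
          \<not> (beats (unweighted (S @ zip T vs)) b a \<or>
            \<not> beats (unweighted (S @ zip T vs)) a b \<and> prefers v b a)"
          using ab zero by (auto simp: beats can_advance_def)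
      qed
      then show "q = p" by (simp add: win)
    qed
    ultimately show "?p \<and> (?pos \<or> ?unique)" by blast
  next
    assume R: "?p \<and> (?pos \<or> ?unique)"
    then obtain v where v: "distinct v" "set v = ?C"
      "\<And>adv. \<forall>a b. prefers v a b \<and> ?ok a b \<longrightarrow> adv a b \<and> \<not> adv b a \<Longrightarrow> winner_by adv t = p"
      using possible_winner_order[OF _ C] by blast
    let ?vs = "replicate (length T) v"
    have vs: "\<forall>w\<in>set ?vs. is_vote ?C w"
      using v by (simp add: is_vote_def)
    note beats = beats[OF vs]
    have "cup_winner tie (unweighted (S @ zip T ?vs)) t = p" for tie
    proof (cases ?pos)
      case True
      then have "sum_list T \<noteq> 0" using pos by blast
      show ?thesis
        unfolding cup_winner_eq
      proof (rule v(3), intro allI impI)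
        fix a b
        assume ab: "prefers v a b \<and> ?ok a b"
        then have "a \<in> ?C" "b \<in> ?C" "a \<noteq> b" "\<not> prefers v b a"
          using prefers_in_set[of v a b] prefers_asym[of v a b] v by auto
        \<comment> \<open>The whole positive weight supports \<open>a\<close>, so
          \<open>?ok a b\<close> becomes a strict majority and the tie rule is not
          consulted.\<close>
        with ab \<open>sum_list T \<noteq> 0\<close>
        show "(beats (unweighted (S @ zip T ?vs)) a b \<or>
            \<not> beats (unweighted (S @ zip T ?vs)) b a \<and> tie a b) \<and>
          \<not> (beats (unweighted (S @ zip T ?vs)) b a \<or>
            \<not> beats (unweighted (S @ zip T ?vs)) a b \<and> tie b a)"
          by (auto simp: beats can_advance_def support_zip_replicate max_def split: if_splits)
      qed
    next
      case False
      then have zero: "sum_list T = 0" using pos by blast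
      have zip: "support (zip T ?vs) a b = 0" for a b
        using support_zip_le[of T ?vs a b] unfolding zero by simp
      have ok: "?ok a b \<longleftrightarrow> support S b a < support S a b + 1" for a b
        unfolding can_advance_def zero by simp
      \<comment> \<open>The open votes contribute nothing, so any tie rule produces some possible
        winner, and \<open>p\<close> is the only one.\<close>
      have "cup_winner tie (unweighted (S @ zip T ?vs)) t \<in> set (possible_winners ?ok t)"
        unfolding cup_winner_eq
      proof (rule winner_by_possible[OF C])
        fix a b
        assume "a \<in> ?C" "b \<in> ?C" "a \<noteq> b"
        then show "if beats (unweighted (S @ zip T ?vs)) a b \<or>
            \<not> beats (unweighted (S @ zip T ?vs)) b a \<and> tie a b then ?ok a b else ?ok b a"
          by (auto simp: beats ok zip)
      qed
      with R False show ?thesis by blast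
    qed
    then show ?L
      unfolding CCWM_def cup_wins_def using vs by (intro exI[of _ ?vs]) simp
  qed
qed

section \<open>The decision procedure\<close>

lemma bits_eq_Nil_iff [simp]: "bits n = [] \<longleftrightarrow> n = 0"
  by (simp add: bits.simps[of n])

lemma inj_bits: "inj bits"
  by (rule injI) (rule bits_inject)

lemma bits_double: "b \<or> n \<noteq> 0 \<Longrightarrow> bits (of_bool b + 2 * n) = b # bits n"
  by (subst bits.simps) auto

lemma hd_enc_tree: "hd_or Stop (enc_tree t) = Item \<longleftrightarrow> (\<exists>l r. t = Match l r)"
proof (cases t)
  case (Leaf c)
  then show ?thesis by (cases "bits c") (auto simp: enc_nat_def)
qed simp

text \<open>Reading from the right, the fold meets both arguments of an \<open>Item\<close> before
  the \<open>Item\<close> itself, with the left one ending on top.\<close>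

lemma foldr_split_step: "foldr split_step (enc_tree t) st = enc_tree t # st"
proof (induction t arbitrary: st)
  case (Leaf n)
  show ?case
  proof (induction n rule: bits.induct)
    case (1 n)
    show ?case
    proof (cases "n = 0")
      case True
      then show ?thesis by (simp add: enc_nat_def split_step_def)
    next
      case False
      then have enc: "enc_tree (Leaf n) = Bit (odd n) # enc_tree (Leaf (n div 2))"
        by (simp add: enc_nat_def bits.simps[of n])
      \<comment> \<open>The guard against most significant zeros is not triggered: for nonzero
        \<open>n\<close> the quotient is 0 only if \<open>n = 1\<close>, which is odd.\<close>
      have "\<not> (enc_tree (Leaf (n div 2)) = [Stop] \<and> \<not> odd n)"
        using False by (auto simp: enc_nat_def elim: evenE)
      with 1[OF False] hd_enc_tree[of "Leaf (n div 2)"] show ?thesis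
        unfolding enc by (simp add: split_step_def)
    qed
  qed
next
  case (Match l r)
  then show ?case by (simp add: split_step_def)
qed

lemma foldr_leaf_step: "foldr leaf_step (enc_tree t) st = map bits (leaves t) @ st"
proof (induction t arbitrary: st)
  case (Leaf n)
  have "foldr leaf_step (map Bit bs @ [Stop]) st = bs # st" for bs
    by (induction bs) (auto simp: leaf_step_def)
  then show ?case by (simp add: enc_nat_def)
next
  case (Match l r)
  then show ?case by (simp add: leaf_step_def)
qed

lemma leaf_bits_enc_tree: "leaf_bits (enc_tree t) = map bits (leaves t)"
  using foldr_leaf_step[of t "[]"] by (simp add: leaf_bits_def)

fun min_depth :: "'c cup_tree \<Rightarrow> nat" where
  "min_depth (Leaf c) = 0"
| "min_depth (Match l r) = Suc (min (min_depth l) (min_depth r))"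

fun max_depth :: "'c cup_tree \<Rightarrow> nat" where
  "max_depth (Leaf c) = 0"
| "max_depth (Match l r) = Suc (max (max_depth l) (max_depth r))"

text \<open>Both extreme depths are attained at leaves, so this single comparison covers all
  pairs.\<close>

lemma balanced_iff: "balanced t \<longleftrightarrow> max_depth t \<le> min_depth t + 1"
proof -
  have "min_depth t \<in> set (leaf_depths t) \<and> max_depth t \<in> set (leaf_depths t)"
    by (induction t) (auto simp: min_def max_def)
  moreover have "\<forall>d\<in>set (leaf_depths t). min_depth t \<le> d \<and> d \<le> max_depth t"
    by (induction t) (auto simp: min_le_iff_disj le_max_iff_disj)
  ultimately show ?thesis
    unfolding balanced_def by (meson add_le_mono1 order_trans)
qed

lemma depth_bounds_enc_tree:
  "depth_bounds (enc_tree t) = [(replicate (min_depth t) True, replicate (max_depth t) True)]"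
proof -
  have "foldr depth_step (enc_tree t) st =
      (replicate (min_depth t) True, replicate (max_depth t) True) # st" for st
  proof (induction t arbitrary: st)
    case (Leaf n)
    have "foldr depth_step (map Bit bs @ [Stop]) st = ([], []) # st" for bs
      by (induction bs) (auto simp: depth_step_def)
    then show ?case by (simp add: enc_nat_def)
  next
    case (Match l r)
    then show ?case by (auto simp: depth_step_def unary_le min_def max_def)
  qed
  then show ?thesis by (simp add: depth_bounds_def)
qed

text \<open>The two relations have to agree only on canonical bit lists, as the evaluation of an
  encoded tree produces no other names.\<close>

lemma cup_eval_enc_tree:
  assumes ok: "\<And>a b. ok' (bits a) (bits b) = ok a b"
  shows "cup_eval ok' (enc_tree t) = [map bits (possible_winners ok t)]"
proof -
  have surv: "survivors ok' (map bits l) (map bits r) = map bits (survivors ok l r)" for l r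
    by (simp add: survivors_def filter_map comp_def ok)
  have "foldr (cup_step ok') (enc_tree t) st = map bits (possible_winners ok t) # st" for st
  proof (induction t arbitrary: st)
    case (Leaf n)
    have "foldr (cup_step ok') (map Bit bs @ [Stop]) st = [bs] # st" for bs
      by (induction bs) (auto simp: cup_step_def)
    then show ?case by (simp add: enc_nat_def)
  next
    case (Match l r)
    then show ?case by (simp add: cup_step_def surv)
  qed
  then show ?thesis by (simp add: cup_eval_def)
qed

section \<open>The acceptance condition on bit lists\<close>

definition support_bits ::
  "(bool list \<times> bool list list) list \<Rightarrow> bool list \<Rightarrow> bool list \<Rightarrow> bool list" where
  "support_bits S a b = sum_bits (map fst (filter (\<lambda>kv. prefers (snd kv) a b) S))"

text \<open>The list \<open>[True]\<close> is the 1 in \<open>max 1 (sum_list T)\<close>. The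
  individual weights are tested because a canonical weight is 0 only if it is empty, whereas a sum
  may carry high-order zeros.\<close>

definition can_advance_bits ::
  "(bool list \<times> bool list list) list \<Rightarrow> bool list list \<Rightarrow> bool list \<Rightarrow> bool list \<Rightarrow> bool" where
  "can_advance_bits S T a b = less_bits (support_bits S b a)
     (add_bits (support_bits S a b) (if \<exists>k\<in>set T. k \<noteq> [] then sum_bits T else [True]))"

text \<open>The additional \<open>True\<close> is the tolerance of one level in
  \<open>balanced\<close>, added in unary.\<close>

definition accepts ::
  "letter list \<Rightarrow> (bool list \<times> bool list list) list \<Rightarrow> bool list list \<Rightarrow> bool list \<Rightarrow> bool" where
  "accepts e S T p \<longleftrightarrow>
     unary_le (snd (hd_or ([], []) (depth_bounds e))) (True # fst (hd_or ([], []) (depth_bounds e))) \<and>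
     distinct (leaf_bits e) \<and> (\<forall>kv\<in>set S. is_vote (set (leaf_bits e)) (snd kv)) \<and>
     p \<in> set (leaf_bits e) \<and> p \<in> set (hd_or [] (cup_eval (can_advance_bits S T) e)) \<and>
     ((\<exists>k\<in>set T. k \<noteq> []) \<or> (\<forall>q\<in>set (hd_or [] (cup_eval (can_advance_bits S T) e)). q = p))"

definition wvote_bits :: "nat \<times> nat vote \<Rightarrow> bool list \<times> bool list list" where
  "wvote_bits kv = (bits (fst kv), map bits (snd kv))"

lemma support_bits: "nat_of_bits (support_bits (map wvote_bits S) (bits a) (bits b)) = support S a b"
  by (simp add: support_bits_def support_def sum_bits filter_map comp_def wvote_bits_def
      prefers_map[OF inj_bits])

lemma can_advance_bits:
  "can_advance_bits (map wvote_bits S) (map bits T) (bits a) (bits b) = can_advance S T a b"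
proof (cases "\<exists>k\<in>set T. k \<noteq> 0")
  case True
  then have "1 \<le> sum_list T"
    by (metis One_nat_def Suc_leI bot_nat_0.not_eq_extremum sum_list_eq_0_iff)
  with True show ?thesis
    by (auto simp: can_advance_bits_def can_advance_def less_bits add_bits support_bits sum_bits comp_def)
next
  case False
  then have "sum_list T = 0" by auto
  with False show ?thesis
    by (auto simp: can_advance_bits_def can_advance_def less_bits add_bits support_bits)
qed

lemma is_vote_map: "inj f \<Longrightarrow> is_vote (f ` C) (map f v) \<longleftrightarrow> is_vote C v"
  by (auto simp: is_vote_def distinct_map inj_image_eq_iff intro: inj_on_subset)

lemma accepts_iff:
  "accepts (enc_tree (schedule I)) (map wvote_bits (fixed_votes I)) (map bits (open_weights I))
     (bits (preferred I)) \<longleftrightarrow> I \<in> cup_CCWM"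
proof -
  let ?t = "schedule I" and ?S = "fixed_votes I" and ?T = "open_weights I" and ?p = "preferred I"
  have "accepts (enc_tree ?t) (map wvote_bits ?S) (map bits ?T) (bits ?p) \<longleftrightarrow>
     valid_instance I \<and> ?p \<in> set (possible_winners (can_advance ?S ?T) ?t) \<and>
     ((\<exists>k\<in>set ?T. k \<noteq> 0) \<or> (\<forall>q\<in>set (possible_winners (can_advance ?S ?T) ?t). q = ?p))"
  proof -
    have eval: "cup_eval (can_advance_bits (map wvote_bits ?S) (map bits ?T)) (enc_tree ?t) =
        [map bits (possible_winners (can_advance ?S ?T) ?t)]"
      by (rule cup_eval_enc_tree) (rule can_advance_bits)
    have votes: "(\<forall>kv\<in>set (map wvote_bits ?S). is_vote (set (leaf_bits (enc_tree ?t))) (snd kv)) \<longleftrightarrow>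
        (\<forall>(k, v)\<in>set ?S. is_vote (set (leaves ?t)) v)"
      by (simp add: leaf_bits_enc_tree wvote_bits_def is_vote_map[OF inj_bits] split_beta)
    have "distinct (leaf_bits (enc_tree ?t)) \<longleftrightarrow> distinct (leaves ?t)"
      by (simp add: leaf_bits_enc_tree distinct_map inj_on_subset[OF inj_bits])
    moreover have "bits ?p \<in> set (leaf_bits (enc_tree ?t)) \<longleftrightarrow> ?p \<in> set (leaves ?t)"
      by (simp add: leaf_bits_enc_tree inj_image_mem_iff[OF inj_bits])
    moreover have "(\<exists>k\<in>set (map bits ?T). k \<noteq> []) \<longleftrightarrow> (\<exists>k\<in>set ?T. k \<noteq> 0)"
      by simp
    ultimately show ?thesis
      unfolding accepts_def eval votes
      by (simp add: valid_instance_def candidates_def depth_bounds_enc_tree unary_le balanced_iff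
          inj_image_mem_iff[OF inj_bits] inj_eq[OF inj_bits] conj_assoc)
  qed
  also have "\<dots> \<longleftrightarrow> I \<in> cup_CCWM"
    using CCWM_cup_iff[of ?t ?S ?T ?p]
    by (auto simp: cup_CCWM_def valid_instance_def candidates_def)
  finally show ?thesis .
qed

section \<open>Cutting a word into parts and encoding them again\<close>

definition enc_bits :: "bool list \<Rightarrow> letter list" where
  "enc_bits bs = map Bit bs @ [Stop]"

definition encode_bits ::
  "letter list \<Rightarrow> (bool list \<times> bool list list) list \<Rightarrow> bool list list \<Rightarrow> bool list \<Rightarrow> letter list" where
  "encode_bits e S T p = e @ enc_list (\<lambda>kv. enc_bits (fst kv) @ enc_list enc_bits (snd kv)) S @
     enc_list enc_bits T @ enc_bits p"

lemma enc_list_map: "enc_list f (map g xs) = enc_list (\<lambda>x. f (g x)) xs"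
  by (simp add: enc_list_def comp_def)

lemma encode_bits:
  "encode_bits (enc_tree (schedule I)) (map wvote_bits (fixed_votes I)) (map bits (open_weights I))
     (bits (preferred I)) = encode I"
proof -
  have nat: "enc_bits (bits n) = enc_nat n" for n
    by (simp add: enc_bits_def enc_nat_def)
  then show ?thesis
    by (simp add: encode_bits_def encode_def enc_list_map wvote_bits_def flip: enc_wvote_def)
qed

text \<open>The last leaf of a spine is the end marker of the list, hence the \<open>butlast\<close>.  The words of
  the last two components and of the end marker of the votes are found from the end.\<close>

definition tree_part :: "letter list \<Rightarrow> letter list" where
  "tree_part w = hd_or [Stop] (split_trees w)"

definition votes_part :: "letter list \<Rightarrow> (bool list \<times> bool list list) list" where
  "votes_part w = map (\<lambda>e. (hd_or [] (leaf_bits e), butlast (tl (leaf_bits e))))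
     (rev (tl (tl (tl (rev (tl (split_trees w)))))))"

definition weights_part :: "letter list \<Rightarrow> bool list list" where
  "weights_part w = butlast (leaf_bits (hd_or [Stop] (tl (rev (tl (split_trees w))))))"

definition preferred_part :: "letter list \<Rightarrow> bool list" where
  "preferred_part w = hd_or [] (leaf_bits (hd_or [Stop] (rev (tl (split_trees w)))))"

text \<open>The \<open>Item\<close> in front of a vote is read as a \<open>Match\<close> that joins
  the weight with the spine of the ranking, and the \<open>Stop\<close> that ends the list of votes
  is the word of \<open>Leaf 0\<close>. An encoding is thereby a plain sequence of tree
  words.\<close>

lemma encode_trees:
  "encode I = concat (map enc_tree (schedule I #
     map (\<lambda>kv. Match (Leaf (fst kv)) (spine (snd kv))) (fixed_votes I) @
     [Leaf 0, spine (open_weights I), Leaf (preferred I)]))"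
proof -
  have "enc_list enc_wvote S =
      concat (map (\<lambda>kv. enc_tree (Match (Leaf (fst kv)) (spine (snd kv)))) S) @ [Stop]" for S
    by (simp add: enc_list_def[of enc_wvote] enc_wvote_def enc_list_nat)
  then show ?thesis
    by (simp add: encode_def enc_list_nat comp_def) (simp add: enc_nat_def)
qed

lemma split_trees_concat: "split_trees (concat (map enc_tree ts)) = map enc_tree ts"
  by (induction ts) (auto simp: split_trees_def foldr_split_step)

lemma parts_encode:
  "tree_part (encode I) = enc_tree (schedule I)"
  "votes_part (encode I) = map wvote_bits (fixed_votes I)"
  "weights_part (encode I) = map bits (open_weights I)"
  "preferred_part (encode I) = bits (preferred I)"
  unfolding encode_trees tree_part_def votes_part_def weights_part_def preferred_part_def
    split_trees_concat
  by (simp_all add: leaf_bits_enc_tree leaves_spine wvote_bits_def butlast_append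
      del: enc_tree.simps)

text \<open>The guards of \<open>split_step\<close> let a digit only extend the canonical
  representation of a number. This holds for arbitrary words and makes their parts come from an
  instance.\<close>

lemma set_split_trees: "set (split_trees w) \<subseteq> range enc_tree"
proof -
  have "set (split_step x st) \<subseteq> range enc_tree" if st: "set st \<subseteq> range enc_tree" for x st
  proof (cases x)
    case (Bit b)
    show ?thesis
    proof (cases st)
      case (Cons e st')
      with st obtain t where t: "e = enc_tree t" by auto
      show ?thesis
      proof (cases "e = [Stop] \<and> \<not> b \<or> hd_or Stop e = Item")
        case False
        then obtain n where n: "t = Leaf n"
          using hd_enc_tree[of t] t by (cases t) auto
        with False t have "b \<or> n \<noteq> 0"
          by (auto simp: enc_nat_def)
        from bits_double[OF this] have "Bit b # e = enc_tree (Leaf (of_bool b + 2 * n))"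
          by (simp add: t n enc_nat_def)
        then have "Bit b # e \<in> range enc_tree" by (rule range_eqI)
        then show ?thesis
          using st Cons False by (simp add: Bit split_step_def)
      qed (use Cons Bit in \<open>auto simp: split_step_def\<close>)
    qed (use Bit in \<open>auto simp: split_step_def\<close>)
  next
    case Item
    have "Item # enc_tree l @ enc_tree r \<in> range enc_tree" for l r
      by (metis enc_tree.simps(2) rangeI)
    with st show ?thesis
      by (auto simp: Item split_step_def join_top_def split: list.split)
  next
    case Stop
    have "[Stop] = enc_tree (Leaf 0)" by (simp add: enc_nat_def)
    then have "[Stop] \<in> range enc_tree" by (rule range_eqI)
    with st show ?thesis
      by (auto simp: Stop split_step_def)
  qed
  then show ?thesis
    unfolding split_trees_def by (induction w) auto
qed

text \<open>The instance may be invalid and unrelated to \<open>w\<close>. It is only meant to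
  ensure that the word compared with \<open>w\<close> in \<open>decide_cup\<close> is the encoding
  of an instance and that \<open>accepts\<close> is applied to its parts.\<close>

lemma parts_in_range:
  obtains I :: cup_instance where "tree_part w = enc_tree (schedule I)" "votes_part w = map wvote_bits (fixed_votes I)"
    "weights_part w = map bits (open_weights I)" "preferred_part w = bits (preferred I)"
proof -
  have range: "hd_or [Stop] es \<in> range enc_tree" if "set es \<subseteq> range enc_tree" for es
  proof (cases es)
    case Nil
    \<comment> \<open>The default for a missing part is itself the word of a leaf and so does not
      leave the range.\<close>
    have "[Stop] = enc_tree (Leaf 0)" by (simp add: enc_nat_def)
    then have "[Stop] \<in> range enc_tree" by (rule range_eqI)
    with Nil show ?thesis by simp
  qed (use that in auto)
  have tl: "set (tl es) \<subseteq> range enc_tree" if "set es \<subseteq> range enc_tree" for es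
    using that by (cases es) auto
  let ?r = "rev (tl (split_trees w))"
  have r: "set ?r \<subseteq> range enc_tree"
    using tl[OF set_split_trees] by simp
  obtain t where t: "tree_part w = enc_tree t"
    using range[OF set_split_trees] by (auto simp: tree_part_def)
  obtain tT where "hd_or [Stop] (tl ?r) = enc_tree tT"
    using range[OF tl[OF r]] by auto
  then have T: "weights_part w = map bits (butlast (leaves tT))"
    by (simp add: weights_part_def leaf_bits_enc_tree map_butlast)
  have hd_bits: "hd_or [] (map bits ns) = bits (hd_or 0 ns)" for ns
    by (cases ns) auto
  obtain tp where "hd_or [Stop] ?r = enc_tree tp"
    using range[OF r] by auto
  then have p: "preferred_part w = bits (hd_or 0 (leaves tp))"
    by (simp add: preferred_part_def leaf_bits_enc_tree hd_bits)
  have "set (rev (tl (tl (tl ?r)))) \<subseteq> range enc_tree"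
    using tl[OF tl[OF tl[OF r]]] by simp
  then have "\<exists>ts. rev (tl (tl (tl ?r))) = map enc_tree ts"
    unfolding ex_map_conv by (blast dest: subsetD)
  then obtain ts where "rev (tl (tl (tl ?r))) = map enc_tree ts" ..
  then have S: "votes_part w = map wvote_bits (map (\<lambda>t. (hd_or 0 (leaves t), butlast (tl (leaves t)))) ts)"
    by (simp add: votes_part_def leaf_bits_enc_tree hd_bits wvote_bits_def map_butlast map_tl)
  define I where "I = \<lparr>schedule = t,
    fixed_votes = map (\<lambda>t. (hd_or 0 (leaves t), butlast (tl (leaves t)))) ts,
    open_weights = butlast (leaves tT), preferred = hd_or 0 (leaves tp)\<rparr>"
  show ?thesis
  proof (rule that[of I])
    show "tree_part w = enc_tree (schedule I)" by (simp add: I_def t)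
    show "votes_part w = map wvote_bits (fixed_votes I)" unfolding S I_def by simp
    show "weights_part w = map bits (open_weights I)" by (simp add: I_def T)
    show "preferred_part w = bits (preferred I)" by (simp add: I_def p)
  qed
qed

text \<open>Since only encodings of instances are reproduced by re-encoding the parts, the parts need
  not be sensible on other words.\<close>

definition decide_cup :: "letter list \<Rightarrow> bool" where
  "decide_cup w \<longleftrightarrow>
     w = encode_bits (tree_part w) (votes_part w) (weights_part w) (preferred_part w) \<and>
     accepts (tree_part w) (votes_part w) (weights_part w) (preferred_part w)"

lemma decide_cup_iff: "decide_cup w \<longleftrightarrow> w \<in> encode ` cup_CCWM"
proof
  assume d: "decide_cup w"
  obtain I :: cup_instance where I: "tree_part w = enc_tree (schedule I)"
    "votes_part w = map wvote_bits (fixed_votes I)"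
    "weights_part w = map bits (open_weights I)" "preferred_part w = bits (preferred I)"
    by (rule parts_in_range[of w])
  from d show "w \<in> encode ` cup_CCWM"
    unfolding decide_cup_def I encode_bits accepts_iff by blast
next
  assume "w \<in> encode ` cup_CCWM"
  then obtain I where "w = encode I" "I \<in> cup_CCWM" by blast
  then show "decide_cup w"
    by (simp add: decide_cup_def parts_encode encode_bits accepts_iff)
qed

section \<open>Polynomial time of the decision procedure\<close>

lemma polytime_support_bits:
  assumes "polytime S" "polytime a" "polytime b"
  shows "polytime (\<lambda>x. support_bits (S x) (a x) (b x))"
  unfolding support_bits_def
  by (intro polytime_sum_bits polytime_basic_intros polytime_prefers assms
      polytime_comp[OF assms(2)] polytime_comp[OF assms(3)])

lemma polytime_can_advance_bits:
  assumes "polytime S" "polytime T" "polytime a" "polytime b"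
  shows "polytime (\<lambda>x. can_advance_bits (S x) (T x) (a x) (b x))"
  unfolding can_advance_bits_def
  by (intro polytime_less_bits polytime_add_bits polytime_support_bits polytime_sum_bits
      polytime_basic_intros assms)

lemma polytime_accepts:
  assumes "polytime e" "polytime S" "polytime T" "polytime p"
  shows "polytime (\<lambda>x. accepts (e x) (S x) (T x) (p x))"
  unfolding accepts_def
  by (intro polytime_basic_intros polytime_unary_le polytime_hd_or polytime_depth_bounds
      polytime_distinct polytime_leaf_bits polytime_is_vote polytime_cup_eval
      polytime_can_advance_bits assms assms[THEN polytime_comp])

lemma polytime_enc_bits: "polytime b \<Longrightarrow> polytime (\<lambda>x. enc_bits (b x))"
  unfolding enc_bits_def by (intro polytime_basic_intros polytime_Bit)

lemma polytime_decide_cup: "polytime decide_cup"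
proof -
  have tree: "polytime (\<lambda>x. tree_part x)"
    unfolding tree_part_def by (intro polytime_basic_intros polytime_hd_or polytime_split_trees)
  have votes: "polytime (\<lambda>x. votes_part x)"
    unfolding votes_part_def
    by (intro polytime_basic_intros polytime_hd_or polytime_split_trees polytime_leaf_bits
        polytime_butlast)
  have weights: "polytime (\<lambda>x. weights_part x)"
    unfolding weights_part_def
    by (intro polytime_basic_intros polytime_hd_or polytime_split_trees polytime_leaf_bits
        polytime_butlast)
  have pref: "polytime (\<lambda>x. preferred_part x)"
    unfolding preferred_part_def
    by (intro polytime_basic_intros polytime_hd_or polytime_split_trees polytime_leaf_bits)
  have "polytime (\<lambda>w. w = encode_bits (tree_part w) (votes_part w) (weights_part w) (preferred_part w) \<and>
     accepts (tree_part w) (votes_part w) (weights_part w) (preferred_part w))"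
    unfolding encode_bits_def
    by (intro polytime_basic_intros polytime_accepts polytime_enc_list polytime_enc_bits
        tree votes weights pref)
  then show ?thesis
    by (simp add: decide_cup_def[abs_def])
qed

theorem theorem7: "encode ` cup_CCWM \<in> class_P"
proof (rule class_P_if_polytime)
  show "polytime (\<lambda>w. w \<in> encode ` cup_CCWM)"
    using polytime_decide_cup by (simp add: decide_cup_iff[abs_def])
qed

end
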